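(* Assuming ETH, there exist constants $\zeta, d_0>0$ such that for every integer $d>d_0$ there is no algorithm that solves $d$-dimensional knapsack exactly in time $O\left((n+W)^{\zeta\cdot\frac{d}{\log d}}\right)$, where $n$ is the encoding size of the input instance and $W=\max_{j\in[d]}B_j$ is its maximum budget.
   Context: $d$-dimensional knapsack: an instance $\mathcal{I}=(I,p,c,B)$ consists of a finite set of items $I$, a profit function $p: I\to\mathbb{N}$, a cost function $c: I\to \mathbb{N}^d$, and a budget $B\in\mathbb{N}^d$ (here $0\in\mathbb{N}$). A solution is a subset $S\subseteq I$ with $c_j(S):=\sum_{i\in S}c_j(i)\le B_j$ for all $j\in[d]=\{1,\dots,d\}$; its profit is $p(S)=\sum_{i\in S}p(i)$. Solving exactly means returning a solution of maximum profit. 3-SAT: an instance is $\phi=(V,C)$, where $V$ is a set of variables and $C$ a set of clauses, each a disjunction of three literals (variables of $V$ or their negations). $\mathrm{SAT}(\phi)$ is the maximum number of clauses satisfied by a single assignment $V\to\{0,1\}$. ETH (Exponential-Time Hypothesis): there is a constant $\xi>0$ such that no algorithm, given a 3-SAT formula $\phi$ with $n$ variables and $m$ clauses, decides whether $\mathrm{SAT}(\phi)=m$ in time $O(2^{\xi n})$. *)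

theory Defs
  imports Complex_Main
begin

section \<open>Algorithms and running time\<close>

text \<open>
  Algorithms are programs of the language WHILE of N. D. Jones (Computability and Complexity
  from a Programming Perspective, MIT Press 1997): imperative programs over binary trees, charged
  one unit for every elementary operation on the trees (copying a variable copies a pointer).
  WHILE programs and deterministic Turing machines simulate each other with polynomial overhead
  in the running time. Such an overhead changes the exponents \<open>\<xi> n\<close> and \<open>\<zeta> d / log d\<close> below by
  constant factors only, so neither the Exponential-Time Hypothesis nor the lower bound depends
  on the choice of the machine model.
\<close>

datatype tree = Leaf | Node tree tree

datatype exp = Var nat | ELeaf | ENode exp exp | Hd exp | Tl exp

datatype com = Assign nat exp | Seq com com | If exp com com | While exp com

type_synonym store = "nat \<Rightarrow> tree"

fun hd_tree :: "tree \<Rightarrow> tree" where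
  "hd_tree Leaf = Leaf"
| "hd_tree (Node l r) = l"

fun tl_tree :: "tree \<Rightarrow> tree" where
  "tl_tree Leaf = Leaf"
| "tl_tree (Node l r) = r"

fun eval_exp :: "exp \<Rightarrow> store \<Rightarrow> tree" where
  "eval_exp (Var v) s = s v"
| "eval_exp ELeaf s = Leaf"
| "eval_exp (ENode e1 e2) s = Node (eval_exp e1 s) (eval_exp e2 s)"
| "eval_exp (Hd e) s = hd_tree (eval_exp e s)"
| "eval_exp (Tl e) s = tl_tree (eval_exp e s)"

fun exp_time :: "exp \<Rightarrow> nat" where
  "exp_time (Var v) = 1"
| "exp_time ELeaf = 1"
| "exp_time (ENode e1 e2) = 1 + exp_time e1 + exp_time e2"
| "exp_time (Hd e) = 1 + exp_time e"
| "exp_time (Tl e) = 1 + exp_time e"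

text \<open>\<open>exec c s t s'\<close>: started in store \<open>s\<close>, the command \<open>c\<close> halts after exactly \<open>t\<close> time units
  in store \<open>s'\<close>. In tests, \<^const>\<open>Leaf\<close> is false and every other tree is true.\<close>

inductive exec :: "com \<Rightarrow> store \<Rightarrow> nat \<Rightarrow> store \<Rightarrow> bool" where
  Assign: "exec (Assign v e) s (1 + exp_time e) (s(v := eval_exp e s))"
| Seq: "exec c1 s t1 s1 \<Longrightarrow> exec c2 s1 t2 s2 \<Longrightarrow> exec (Seq c1 c2) s (t1 + t2) s2"
| IfTrue: "eval_exp e s \<noteq> Leaf \<Longrightarrow> exec c1 s t s1 \<Longrightarrow> exec (If e c1 c2) s (1 + exp_time e + t) s1"
| IfFalse: "eval_exp e s = Leaf \<Longrightarrow> exec c2 s t s1 \<Longrightarrow> exec (If e c1 c2) s (1 + exp_time e + t) s1"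
| WhileFalse: "eval_exp e s = Leaf \<Longrightarrow> exec (While e c) s (1 + exp_time e) s"
| WhileTrue: "eval_exp e s \<noteq> Leaf \<Longrightarrow> exec c s t1 s1 \<Longrightarrow> exec (While e c) s1 t2 s2 \<Longrightarrow>
    exec (While e c) s (1 + exp_time e + t1 + t2) s2"

lemma exec_deterministic:
  "exec c s t s' \<Longrightarrow> exec c s u s'' \<Longrightarrow> t = u \<and> s' = s''"
proof (induction arbitrary: u s'' rule: exec.induct)
  case (Assign v e s)
  from Assign.prems show ?case by cases simp_all
next
  case (Seq c1 s t1 s1 c2 t2 s2)
  from Seq.prems obtain u1 r u2 where *: "exec c1 s u1 r" "exec c2 r u2 s''" "u = u1 + u2"
    by cases
  from Seq.IH(1)[OF *(1)] have "t1 = u1" "s1 = r" by simp_all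
  with Seq.IH(2) *(2,3) show ?case by simp
next
  case (IfTrue e s c1 t s1 c2)
  with IfTrue.prems obtain u1 where *: "exec c1 s u1 s''" "u = 1 + exp_time e + u1"
    by cases simp_all
  from IfTrue.IH[OF *(1)] *(2) show ?case by simp
next
  case (IfFalse e s c2 t s1 c1)
  with IfFalse.prems obtain u1 where *: "exec c2 s u1 s''" "u = 1 + exp_time e + u1"
    by cases simp_all
  from IfFalse.IH[OF *(1)] *(2) show ?case by simp
next
  case (WhileFalse e s c)
  from WhileFalse.prems WhileFalse.hyps show ?case by cases simp_all
next
  case (WhileTrue e s c t1 s1 t2 s2)
  from WhileTrue.prems WhileTrue.hyps(1) obtain u1 r u2
    where *: "exec c s u1 r" "exec (While e c) r u2 s''" "u = 1 + exp_time e + u1 + u2"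
    by cases simp_all
  from WhileTrue.IH(1)[OF *(1)] have "t1 = u1" "s1 = r" by simp_all
  with WhileTrue.IH(2) *(2,3) show ?case by simp
qed

text \<open>Input and output are passed in variable 0; all other variables are initially \<^const>\<open>Leaf\<close>.\<close>

definition runs :: "com \<Rightarrow> tree \<Rightarrow> nat \<Rightarrow> tree \<Rightarrow> bool" where
  "runs P x t y \<longleftrightarrow> (\<exists>s. exec P ((\<lambda>_. Leaf)(0 := x)) t s \<and> s 0 = y)"


section \<open>Encodings\<close>

text \<open>Numbers are encoded in binary, least significant bit first. The number of nodes of an
  encoding, \<^const>\<open>size\<close>, agrees up to constant factors with the length of the corresponding
  bit string.\<close>

fun bits :: "nat \<Rightarrow> bool list" where
  "bits 0 = []"
| "bits (Suc n) = odd (Suc n) # bits (Suc n div 2)"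

definition enc_bool :: "bool \<Rightarrow> tree" where
  "enc_bool b = (if b then Node Leaf Leaf else Leaf)"

fun enc_list :: "tree list \<Rightarrow> tree" where
  "enc_list [] = Leaf"
| "enc_list (x # xs) = Node x (enc_list xs)"

definition enc_nat :: "nat \<Rightarrow> tree" where
  "enc_nat n = enc_list (map enc_bool (bits n))"


section \<open>3-SAT and the Exponential-Time Hypothesis\<close>

type_synonym literal = "nat \<times> bool"  \<comment> \<open>\<open>(v, False)\<close> is the negation of the variable \<open>v\<close>\<close>

type_synonym clause = "literal \<times> literal \<times> literal"

text \<open>The \<open>n\<close> variables of a formula are \<open>0, \<dots>, n - 1\<close>. With arbitrary names, the length of the
  input would not be bounded in terms of the number of variables, and no algorithm at all could run
  in time \<open>O(2\<^sup>\<xi>\<^sup>n)\<close>. For the same reason it matters that the clauses form a set.\<close>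

record formula =
  num_vars :: nat
  clauses :: "clause set"

definition formula_wf :: "formula \<Rightarrow> bool" where
  "formula_wf \<phi> \<longleftrightarrow> finite (clauses \<phi>) \<and>
    (\<forall>(l1, l2, l3) \<in> clauses \<phi>. \<forall>l \<in> {l1, l2, l3}. fst l < num_vars \<phi>)"

definition lit_holds :: "(nat \<Rightarrow> bool) \<Rightarrow> literal \<Rightarrow> bool" where
  "lit_holds a l \<longleftrightarrow> a (fst l) = snd l"

definition clause_holds :: "(nat \<Rightarrow> bool) \<Rightarrow> clause \<Rightarrow> bool" where
  "clause_holds a = (\<lambda>(l1, l2, l3). lit_holds a l1 \<or> lit_holds a l2 \<or> lit_holds a l3)"

definition SAT :: "formula \<Rightarrow> nat" where
  "SAT \<phi> = Max (range (\<lambda>a. card {C \<in> clauses \<phi>. clause_holds a C}))"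

definition enc_literal :: "literal \<Rightarrow> tree" where
  "enc_literal l = Node (enc_nat (fst l)) (enc_bool (snd l))"

definition enc_clause :: "clause \<Rightarrow> tree" where
  "enc_clause = (\<lambda>(l1, l2, l3). enc_list [enc_literal l1, enc_literal l2, enc_literal l3])"

text \<open>The clauses are listed in any order, without repetitions.\<close>

definition encodes_formula :: "tree \<Rightarrow> formula \<Rightarrow> bool" where
  "encodes_formula x \<phi> \<longleftrightarrow> (\<exists>Cs. distinct Cs \<and> set Cs = clauses \<phi> \<and>
    x = Node (enc_nat (num_vars \<phi>)) (enc_list (map enc_clause Cs)))"

text \<open>In the two \<open>O\<close>-bounds below the constant \<open>K\<close> is uniform over all instances. As the bounding
  functions are positive and only finitely many inputs have a given number of variables
  (a given encoding size, respectively), this is the same as an asymptotic bound.\<close>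

definition decides_3SAT_in_time :: "com \<Rightarrow> (nat \<Rightarrow> real) \<Rightarrow> bool" where
  "decides_3SAT_in_time P f \<longleftrightarrow>
    (\<exists>K. \<forall>\<phi> x. formula_wf \<phi> \<and> encodes_formula x \<phi> \<longrightarrow>
      (\<exists>t y. runs P x t y \<and> (y \<noteq> Leaf \<longleftrightarrow> SAT \<phi> = card (clauses \<phi>)) \<and>
        real t \<le> K * f (num_vars \<phi>)))"

definition ETH :: bool where
  "ETH \<longleftrightarrow> (\<exists>\<xi>::real. \<xi> > 0 \<and> \<not> (\<exists>P. decides_3SAT_in_time P (\<lambda>n. 2 powr (\<xi> * real n))))"


section \<open>Multidimensional knapsack\<close>

text \<open>In dimension \<open>d\<close>, the coordinates of costs (second argument of \<open>cost\<close>) and budgets that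
  matter are \<open>1, \<dots>, d\<close>.\<close>

record knapsack =
  items :: "nat set"
  profit :: "nat \<Rightarrow> nat"
  cost :: "nat \<Rightarrow> nat \<Rightarrow> nat"
  budget :: "nat \<Rightarrow> nat"

definition is_solution :: "nat \<Rightarrow> knapsack \<Rightarrow> nat set \<Rightarrow> bool" where
  "is_solution d I S \<longleftrightarrow> S \<subseteq> items I \<and> (\<forall>j\<in>{1..d}. (\<Sum>i\<in>S. cost I i j) \<le> budget I j)"

definition is_optimal_solution :: "nat \<Rightarrow> knapsack \<Rightarrow> nat set \<Rightarrow> bool" where
  "is_optimal_solution d I S \<longleftrightarrow> is_solution d I S \<and>
    (\<forall>T. is_solution d I T \<longrightarrow> sum (profit I) T \<le> sum (profit I) S)"

definition max_budget :: "nat \<Rightarrow> knapsack \<Rightarrow> nat" where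
  "max_budget d I = Max (budget I ` {1..d})"

definition enc_item :: "nat \<Rightarrow> knapsack \<Rightarrow> nat \<Rightarrow> tree" where
  "enc_item d I i =
    enc_list (enc_nat i # enc_nat (profit I i) # map (\<lambda>j. enc_nat (cost I i j)) [1..<d + 1])"

text \<open>The items are listed in any order, without repetitions.\<close>

definition encodes_knapsack :: "nat \<Rightarrow> tree \<Rightarrow> knapsack \<Rightarrow> bool" where
  "encodes_knapsack d x I \<longleftrightarrow> (\<exists>xs. distinct xs \<and> set xs = items I \<and>
    x = Node (enc_list (map (\<lambda>j. enc_nat (budget I j)) [1..<d + 1]))
             (enc_list (map (enc_item d I) xs)))"

definition encodes_item_set :: "tree \<Rightarrow> nat set \<Rightarrow> bool" where
  "encodes_item_set y S \<longleftrightarrow> (\<exists>xs. distinct xs \<and> set xs = S \<and> y = enc_list (map enc_nat xs))"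

text \<open>The time bound is a function of the encoding size and the maximum budget.\<close>

definition solves_knapsack_in_time :: "nat \<Rightarrow> com \<Rightarrow> (nat \<Rightarrow> nat \<Rightarrow> real) \<Rightarrow> bool" where
  "solves_knapsack_in_time d P f \<longleftrightarrow>
    (\<exists>K. \<forall>I x. finite (items I) \<and> encodes_knapsack d x I \<longrightarrow>
      (\<exists>t y S. runs P x t y \<and> encodes_item_set y S \<and> is_optimal_solution d I S \<and>
        real t \<le> K * f (size x) (max_budget d I)))"

end

theory Submission
  imports Defs
begin

text \<open>
  A 3-SAT algorithm is built from a knapsack solver. By a branching procedure in the style of the
  sparsification lemma of Impagliazzo, Paturi and Zane, a formula with \<open>n\<close> variables is the
  disjunction of \<open>2\<^bsup>O(\<epsilon> n)\<^esup>\<close> formulas with \<open>O\<^sub>\<epsilon>(n)\<close> clauses. Such a sparse formula becomes a subset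
  sum problem on vectors with one column per variable and per clause, as in the classical reduction;
  all column sums are less than 8, so several columns can be stored as the base-8 digits of one
  number without carries. Spreading the \<open>O\<^sub>\<epsilon>(n)\<close> columns evenly over \<open>d\<close> dimensions gives budgets
  \<open>W \<le> 2\<^bsup>O(n / d)\<^esup>\<close>, whence \<open>W\<^bsup>\<zeta> d / log d\<^esup> \<le> 2\<^bsup>O(\<zeta> n)\<^esup>\<close>. The profits are chosen such that
  only a solution exhausting all budgets reaches the maximum possible profit. The
  assignment read off from an optimal solution is checked against the original formula, so only
  completeness of the reduction has to be proved.
\<close>

section \<open>Polynomial-time WHILE programs\<close>

text \<open>Sparsification is forced by the number of columns: a formula may have cubically many
  clauses, and one column for each would make the budgets exponential in the cube of n over d. The
  branching is measured by a weight, the exponential of \<open>pot\<close>. The weights of two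
  children add up to at most the weight of the parent, and no weight falls below 1, so the weight of
  the root bounds the number of leaves. An assignment found at a leaf can be checked against the
  input because every input clause contains a clause of the leaf. Running times are proved for
  concrete programs. Polynomial-time functions are handled by a calculus closed under composition,
  pairing, case distinction and folds of bounded growth; only the search loop and the call of the
  solver are programmed by hand. The constant 16 splits the exponent \<open>\<xi>\<close>: the
  search has about 2 to the power \<open>\<xi> n / 8\<close> nodes, and one solver call costs
  \<open>3 \<xi> / 16\<close> through the budgets and \<open>\<xi> / 16\<close> through the instance
  size, in total \<open>3 \<xi> / 8\<close>.\<close>

fun exp_bound :: "exp \<Rightarrow> nat" where
  "exp_bound (Var v) = Suc v"
| "exp_bound ELeaf = 0"
| "exp_bound (ENode e1 e2) = max (exp_bound e1) (exp_bound e2)"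
| "exp_bound (Hd e) = exp_bound e"
| "exp_bound (Tl e) = exp_bound e"

fun com_bound :: "com \<Rightarrow> nat" where
  "com_bound (Assign v e) = max (Suc v) (exp_bound e)"
| "com_bound (Seq c1 c2) = max (com_bound c1) (com_bound c2)"
| "com_bound (If e c1 c2) = max (exp_bound e) (max (com_bound c1) (com_bound c2))"
| "com_bound (While e c) = max (exp_bound e) (com_bound c)"

text \<open>Needed for an arbitrary solver: only finitely many variables can be left dirty, so a
  fixed program can reset them.\<close>

lemma exec_frame: "exec c s t s' \<Longrightarrow> com_bound c \<le> v \<Longrightarrow> s' v = s v"
  by (induction rule: exec.induct) auto

section \<open>Renaming variables, so that a program can be called as a subroutine\<close>

fun shift_exp :: "nat \<Rightarrow> exp \<Rightarrow> exp" where
  "shift_exp k (Var v) = Var (v + k)"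
| "shift_exp k ELeaf = ELeaf"
| "shift_exp k (ENode e1 e2) = ENode (shift_exp k e1) (shift_exp k e2)"
| "shift_exp k (Hd e) = Hd (shift_exp k e)"
| "shift_exp k (Tl e) = Tl (shift_exp k e)"

fun shift_com :: "nat \<Rightarrow> com \<Rightarrow> com" where
  "shift_com k (Assign v e) = Assign (v + k) (shift_exp k e)"
| "shift_com k (Seq c1 c2) = Seq (shift_com k c1) (shift_com k c2)"
| "shift_com k (If e c1 c2) = If (shift_exp k e) (shift_com k c1) (shift_com k c2)"
| "shift_com k (While e c) = While (shift_exp k e) (shift_com k c)"

lemma eval_shift_exp: "eval_exp (shift_exp k e) s = eval_exp e (\<lambda>v. s (v + k))"
  by (induction e) auto

lemma exp_time_shift_exp [simp]: "exp_time (shift_exp k e) = exp_time e"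
  by (induction e) auto

lemma exec_shift:
  "exec c s t s' \<Longrightarrow> s = (\<lambda>v. r (v + k)) \<Longrightarrow>
    \<exists>r'. exec (shift_com k c) r t r' \<and> (\<lambda>v. r' (v + k)) = s' \<and> (\<forall>v<k. r' v = r v)"
proof (induction arbitrary: r rule: exec.induct)
  case (Assign v e s)
  let ?r = "r(v + k := eval_exp (shift_exp k e) r)"
  have "exec (shift_com k (Assign v e)) r (1 + exp_time e) ?r"
    using exec.Assign[of "v + k" "shift_exp k e" r] by simp
  moreover have "(\<lambda>v. ?r (v + k)) = s(v := eval_exp e s)"
    using Assign by (auto simp: eval_shift_exp)
  moreover have "\<forall>v<k. ?r v = r v" by auto
  ultimately show ?case by (intro exI[of _ ?r] conjI)
next
  case (Seq c1 s t1 s1 c2 t2 s2)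
  from Seq.IH(1)[OF Seq.prems] obtain r1 where r1: "exec (shift_com k c1) r t1 r1"
    "s1 = (\<lambda>v. r1 (v + k))" "\<forall>v<k. r1 v = r v" by auto
  from Seq.IH(2)[OF r1(2)] obtain r2 where r2: "exec (shift_com k c2) r1 t2 r2"
    "(\<lambda>v. r2 (v + k)) = s2" "\<forall>v<k. r2 v = r1 v" by auto
  from exec.Seq[OF r1(1) r2(1)] r1(3) r2(2,3) show ?case
    by (intro exI[of _ r2]) auto
next
  case (IfTrue e s c1 t s1 c2)
  from IfTrue.IH[OF IfTrue.prems] obtain r1 where r1: "exec (shift_com k c1) r t r1"
    "(\<lambda>v. r1 (v + k)) = s1" "\<forall>v<k. r1 v = r v" by auto
  have "eval_exp (shift_exp k e) r \<noteq> Leaf" using IfTrue by (simp add: eval_shift_exp)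
  from exec.IfTrue[OF this r1(1)] r1(2,3) show ?case by (intro exI[of _ r1]) auto
next
  case (IfFalse e s c2 t s1 c1)
  from IfFalse.IH[OF IfFalse.prems] obtain r1 where r1: "exec (shift_com k c2) r t r1"
    "(\<lambda>v. r1 (v + k)) = s1" "\<forall>v<k. r1 v = r v" by auto
  have "eval_exp (shift_exp k e) r = Leaf" using IfFalse by (simp add: eval_shift_exp)
  from exec.IfFalse[OF this r1(1)] r1(2,3) show ?case by (intro exI[of _ r1]) auto
next
  case (WhileFalse e s c)
  have "eval_exp (shift_exp k e) r = Leaf" using WhileFalse by (simp add: eval_shift_exp)
  from exec.WhileFalse[OF this] WhileFalse show ?case by (intro exI[of _ r]) auto
next
  case (WhileTrue e s c t1 s1 t2 s2)
  have *: "eval_exp (shift_exp k e) r \<noteq> Leaf" using WhileTrue by (simp add: eval_shift_exp)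
  from WhileTrue.IH(1)[OF WhileTrue.prems] obtain r1 where r1: "exec (shift_com k c) r t1 r1"
    "s1 = (\<lambda>v. r1 (v + k))" "\<forall>v<k. r1 v = r v" by auto
  from WhileTrue.IH(2)[OF r1(2)] obtain r2 where r2: "exec (shift_com k (While e c)) r1 t2 r2"
    "(\<lambda>v. r2 (v + k)) = s2" "\<forall>v<k. r2 v = r1 v" by auto
  from exec.WhileTrue[OF * r1(1)] r2 r1(3) show ?case by (intro exI[of _ r2]) auto
qed

text \<open>A list and its extension by \<open>Leaf\<close> denote the same store. Hence a fresh
  variable is pushed by one assignment and popped by resetting it to \<open>Leaf\<close>.\<close>

definition st :: "tree list \<Rightarrow> store" where
  "st xs = (\<lambda>v. if v < length xs then xs ! v else Leaf)"

lemma st_single: "st [x] = (\<lambda>_. Leaf)(0 := x)"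
  by (auto simp: st_def fun_eq_iff)

lemma st_Leaf: "st (xs @ [Leaf]) = st xs"
  by (auto simp: st_def fun_eq_iff nth_append)

lemma exec_shift_st:
  assumes "exec P (st [x]) t (st [y])"
  shows "exec (shift_com (length xs) P) (st (xs @ [x])) t (st (xs @ [y]))"
proof -
  have "st [x] = (\<lambda>v. st (xs @ [x]) (v + length xs))"
    by (auto simp: st_def fun_eq_iff nth_append)
  from exec_shift[OF assms this] obtain r where r: "exec (shift_com (length xs) P) (st (xs @ [x])) t r"
    "(\<lambda>v. r (v + length xs)) = st [y]" "\<forall>v<length xs. r v = st (xs @ [x]) v" by auto
  have "r v = st (xs @ [y]) v" for v
  proof (cases "v < length xs")
    case True
    then show ?thesis using r(3) by (simp add: st_def nth_append)
  next
    case False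
    then have "r v = st [y] (v - length xs)" using fun_cong[OF r(2), of "v - length xs"] by simp
    then show ?thesis using False by (auto simp: st_def nth_append)
  qed
  then have "r = st (xs @ [y])" by auto
  with r(1) show ?thesis by simp
qed

lemma exec_AssignI: "s' = s(v := eval_exp e s) \<Longrightarrow> exec (Assign v e) s (1 + exp_time e) s'"
  using exec.Assign by simp

lemma st_simps [simp]: "st [] v = Leaf" "st (x # xs) 0 = x" "st (x # xs) (Suc v) = st xs v"
  "st (x # xs) (numeral k) = st xs (pred_numeral k)"
  by (auto simp: st_def numeral_eq_Suc)

lemma exec_push:
  assumes "v = length xs" "y = eval_exp e (st xs)" "t = 1 + exp_time e" "ys = xs @ [y]"
  shows "exec (Assign v e) (st xs) t (st ys)"
  unfolding assms(3) by (rule exec_AssignI) (auto simp: assms(1,2,4) st_def nth_append fun_eq_iff)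

lemma exec_pop:
  assumes "v = length xs" "ys = xs @ [y]"
  shows "exec (Assign v ELeaf) (st ys) 2 (st xs)"
proof -
  have "st xs = (st ys)(v := eval_exp ELeaf (st ys))"
    using assms by (auto simp: st_def nth_append fun_eq_iff)
  from exec_AssignI[OF this] show ?thesis by (simp add: numeral_2_eq_2)
qed

lemma exec_set:
  assumes "v < length xs" "y = eval_exp e (st xs)" "t = 1 + exp_time e" "ys = xs[v := y]"
  shows "exec (Assign v e) (st xs) t (st ys)"
  unfolding assms(3) by (rule exec_AssignI) (use assms in \<open>auto simp: st_def fun_eq_iff nth_list_update\<close>)

subsection \<open>Polynomial bounds\<close>

text \<open>The base is at least 2, so a single exponent absorbs constants, sums, products and
  compositions, and no coefficients have to be carried along.\<close>

definition pbounded :: "'a set \<Rightarrow> ('a \<Rightarrow> tree) \<Rightarrow> ('a \<Rightarrow> nat) \<Rightarrow> bool" where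
  "pbounded A u T \<longleftrightarrow> (\<exists>c. \<forall>x\<in>A. T x \<le> (size (u x) + 2) ^ c)"

lemma pboundedI: "(\<And>x. x \<in> A \<Longrightarrow> T x \<le> (size (u x) + 2) ^ c) \<Longrightarrow> pbounded A u T"
  by (auto simp: pbounded_def)

lemma pbounded_mono:
  "pbounded A u T \<Longrightarrow> (\<And>x. x \<in> B \<Longrightarrow> x \<in> A) \<Longrightarrow> (\<And>x. x \<in> B \<Longrightarrow> T' x \<le> T x) \<Longrightarrow> pbounded B u T'"
  unfolding pbounded_def by (meson order_trans)

lemma pbounded_const: "pbounded A u (\<lambda>_. c)"
proof (rule pboundedI)
  fix x
  have "c \<le> 2 ^ c" by (simp add: less_imp_le)
  also have "\<dots> \<le> (size (u x) + 2) ^ c" by (rule power_mono) auto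
  finally show "c \<le> (size (u x) + 2) ^ c" .
qed

lemma pbounded_size: "pbounded A u (\<lambda>x. size (u x))"
  by (rule pboundedI[where c = 1]) simp

lemma pbounded_mult:
  assumes "pbounded A u S" "pbounded A u T"
  shows "pbounded A u (\<lambda>x. S x * T x)"
proof -
  from assms obtain a b where "\<And>x. x \<in> A \<Longrightarrow> S x \<le> (size (u x) + 2) ^ a"
    "\<And>x. x \<in> A \<Longrightarrow> T x \<le> (size (u x) + 2) ^ b" by (auto simp: pbounded_def)
  then show ?thesis by (intro pboundedI[where c = "a + b"]) (simp add: power_add mult_mono)
qed

lemma pbounded_add:
  assumes "pbounded A u S" "pbounded A u T"
  shows "pbounded A u (\<lambda>x. S x + T x)"
proof -
  from assms obtain a b where ab: "\<And>x. x \<in> A \<Longrightarrow> S x \<le> (size (u x) + 2) ^ a"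
    "\<And>x. x \<in> A \<Longrightarrow> T x \<le> (size (u x) + 2) ^ b" by (auto simp: pbounded_def)
  have "S x + T x \<le> (size (u x) + 2) ^ Suc (a + b)" if "x \<in> A" for x
  proof -
    let ?n = "size (u x) + 2"
    have "S x \<le> ?n ^ (a + b)" using ab(1)[OF that] power_increasing[of a "a + b" ?n] by linarith
    moreover have "T x \<le> ?n ^ (a + b)" using ab(2)[OF that] power_increasing[of b "a + b" ?n] by linarith
    ultimately have "S x + T x \<le> 2 * ?n ^ (a + b)" by simp
    also have "\<dots> \<le> ?n * ?n ^ (a + b)" by (rule mult_right_mono) auto
    finally show ?thesis by simp
  qed
  then show ?thesis by (rule pboundedI)
qed

lemma pbounded_trans:
  assumes "pbounded A w T" "pbounded A u (\<lambda>x. size (w x))"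
  shows "pbounded A u T"
proof -
  from assms obtain a b where ab: "\<And>x. x \<in> A \<Longrightarrow> T x \<le> (size (w x) + 2) ^ a"
    "\<And>x. x \<in> A \<Longrightarrow> size (w x) \<le> (size (u x) + 2) ^ b" by (auto simp: pbounded_def)
  have "T x \<le> (size (u x) + 2) ^ ((b + 2) * a)" if "x \<in> A" for x
  proof -
    let ?n = "size (u x) + 2"
    have "1 \<le> ?n ^ b" by simp
    then have "?n ^ b + 2 \<le> 4 * ?n ^ b" by linarith
    also have "\<dots> \<le> (?n * ?n) * ?n ^ b" by (rule mult_right_mono) auto
    also have "\<dots> = ?n ^ (b + 2)" by (simp only: power_add power2_eq_square mult.commute)
    finally have "size (w x) + 2 \<le> ?n ^ (b + 2)" using ab(2)[OF that] by linarith
    then have "(size (w x) + 2) ^ a \<le> (?n ^ (b + 2)) ^ a" by (rule power_mono) simp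
    then show ?thesis using ab(1)[OF that] by (simp only: power_mult)
  qed
  then show ?thesis by (rule pboundedI)
qed

lemma pbounded_reindex:
  "pbounded A u T \<Longrightarrow> (\<And>y. y \<in> B \<Longrightarrow> h y \<in> A) \<Longrightarrow> pbounded B (\<lambda>y. u (h y)) (\<lambda>y. T (h y))"
  by (auto simp: pbounded_def)

text \<open>All variables but 0 are \<^const>\<open>Leaf\<close> before and after the run, so that programs can be
  composed and, after renaming their variables, called from other programs.\<close>

definition computes :: "'a set \<Rightarrow> ('a \<Rightarrow> tree) \<Rightarrow> ('a \<Rightarrow> tree) \<Rightarrow> bool" where
  "computes A u v \<longleftrightarrow> (\<exists>P T. (\<forall>x\<in>A. exec P (st [u x]) (T x) (st [v x])) \<and>
     pbounded A u T \<and> pbounded A u (\<lambda>x. size (v x)))"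

lemma computesI:
  assumes "\<And>x. x \<in> A \<Longrightarrow> exec P (st [u x]) (T x) (st [v x])"
    "pbounded A u T" "pbounded A u (\<lambda>x. size (v x))"
  shows "computes A u v"
  using assms unfolding computes_def by (intro exI[of _ P] exI[of _ T]) simp

lemma computesE:
  assumes "computes A u v"
  obtains P T where "\<And>x. x \<in> A \<Longrightarrow> exec P (st [u x]) (T x) (st [v x])"
    "pbounded A u T" "pbounded A u (\<lambda>x. size (v x))"
  using assms unfolding computes_def by metis

lemma computes_mono:
  assumes "computes A u v" "\<And>x. x \<in> B \<Longrightarrow> x \<in> A"
  shows "computes B u v"
  using assms(1)
proof (rule computesE)
  fix P T assume *: "\<And>x. x \<in> A \<Longrightarrow> exec P (st [u x]) (T x) (st [v x])"
    "pbounded A u T" "pbounded A u (\<lambda>x. size (v x))"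
  show ?thesis
    by (rule computesI[OF *(1)]) (auto intro: assms(2) pbounded_mono[OF *(2)] pbounded_mono[OF *(3)])
qed

lemma computes_cong:
  assumes "computes A u v" "\<And>x. x \<in> A \<Longrightarrow> u x = u' x" "\<And>x. x \<in> A \<Longrightarrow> v x = v' x"
  shows "computes A u' v'"
  using assms(1)
proof (rule computesE)
  fix P T assume *: "\<And>x. x \<in> A \<Longrightarrow> exec P (st [u x]) (T x) (st [v x])"
    "pbounded A u T" "pbounded A u (\<lambda>x. size (v x))"
  show ?thesis
  proof (rule computesI)
    show "exec P (st [u' x]) (T x) (st [v' x])" if "x \<in> A" for x
      using *(1)[OF that] assms(2,3)[OF that] by simp
  qed (use *(2,3) assms(2,3) in \<open>simp_all add: pbounded_def\<close>)
qed

lemma computes_reindex: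
  assumes "computes A u v" "\<And>y. y \<in> B \<Longrightarrow> h y \<in> A"
  shows "computes B (\<lambda>y. u (h y)) (\<lambda>y. v (h y))"
  using assms(1)
proof (rule computesE)
  fix P T assume *: "\<And>x. x \<in> A \<Longrightarrow> exec P (st [u x]) (T x) (st [v x])"
    "pbounded A u T" "pbounded A u (\<lambda>x. size (v x))"
  show ?thesis
    by (rule computesI[OF *(1)[OF assms(2)]])
      (auto intro: assms(2) pbounded_reindex[OF *(2)] pbounded_reindex[OF *(3)])
qed

lemma computes_exp:
  assumes "\<And>x. x \<in> A \<Longrightarrow> eval_exp e (st [u x]) = v x" "pbounded A u (\<lambda>x. size (v x))"
  shows "computes A u v"
proof -
  have "exec (Assign 0 e) (st [u x]) (1 + exp_time e) (st [v x])" if "x \<in> A" for x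
    by (rule exec_set[of _ _ "v x"]) (simp_all add: assms(1)[OF that])
  then show ?thesis by (rule computesI) (simp_all only: assms(2) pbounded_const)
qed

lemma computes_trans:
  assumes "computes A u v" "computes A v w"
  shows "computes A u w"
proof -
  from assms(1) obtain P S where P: "\<And>x. x \<in> A \<Longrightarrow> exec P (st [u x]) (S x) (st [v x])"
    "pbounded A u S" "pbounded A u (\<lambda>x. size (v x))" by (rule computesE) blast
  from assms(2) obtain Q T where Q: "\<And>x. x \<in> A \<Longrightarrow> exec Q (st [v x]) (T x) (st [w x])"
    "pbounded A v T" "pbounded A v (\<lambda>x. size (w x))" by (rule computesE) blast
  show ?thesis
  proof (rule computesI)
    show "exec (Seq P Q) (st [u x]) (S x + T x) (st [w x])" if "x \<in> A" for x
      by (rule exec.Seq[OF P(1)[OF that] Q(1)[OF that]])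
    show "pbounded A u (\<lambda>x. S x + T x)"
      by (rule pbounded_add[OF P(2) pbounded_trans[OF Q(2) P(3)]])
    show "pbounded A u (\<lambda>x. size (w x))" by (rule pbounded_trans[OF Q(3) P(3)])
  qed
qed

lemma computes_pair:
  assumes "computes A u v" "computes A u w"
  shows "computes A u (\<lambda>x. Node (v x) (w x))"
proof -
  from assms(1) obtain P S where P: "\<And>x. x \<in> A \<Longrightarrow> exec P (st [u x]) (S x) (st [v x])"
    "pbounded A u S" "pbounded A u (\<lambda>x. size (v x))" by (rule computesE) blast
  from assms(2) obtain Q T where Q: "\<And>x. x \<in> A \<Longrightarrow> exec Q (st [u x]) (T x) (st [w x])"
    "pbounded A u T" "pbounded A u (\<lambda>x. size (w x))" by (rule computesE) blast
  let ?P = "Seq (Assign 1 (Var 0)) (Seq (shift_com 1 P) (Seq (Assign 2 (Var 0)) (Seq (shift_com 2 Q)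
    (Seq (Assign 0 (ENode (Var 1) (Var 2))) (Seq (Assign 2 ELeaf) (Assign 1 ELeaf))))))"
  have "exec ?P (st [u x]) (2 + (S x + (2 + (T x + (4 + (2 + 2)))))) (st [Node (v x) (w x)])" if x: "x \<in> A" for x
  proof (intro exec.Seq)
    show "exec (Assign 1 (Var 0)) (st [u x]) 2 (st [u x, u x])"
      by (rule exec_push) simp_all
    show "exec (shift_com 1 P) (st [u x, u x]) (S x) (st [u x, v x])"
      using exec_shift_st[OF P(1)[OF x], of "[u x]"] by simp
    show "exec (Assign 2 (Var 0)) (st [u x, v x]) 2 (st [u x, v x, u x])"
      by (rule exec_push) simp_all
    show "exec (shift_com 2 Q) (st [u x, v x, u x]) (T x) (st [u x, v x, w x])"
      using exec_shift_st[OF Q(1)[OF x], of "[u x, v x]"] by (simp add: numeral_2_eq_2)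
    show "exec (Assign 0 (ENode (Var 1) (Var 2))) (st [u x, v x, w x]) 4 (st [Node (v x) (w x), v x, w x])"
      by (rule exec_set) simp_all
    show "exec (Assign 2 ELeaf) (st [Node (v x) (w x), v x, w x]) 2 (st [Node (v x) (w x), v x])"
      by (rule exec_pop) simp_all
    show "exec (Assign 1 ELeaf) (st [Node (v x) (w x), v x]) 2 (st [Node (v x) (w x)])"
      by (rule exec_pop) simp_all
  qed
  moreover have "pbounded A u (\<lambda>x. 2 + (S x + (2 + (T x + (4 + (2 + 2))))))"
    by (intro pbounded_add pbounded_const P(2) Q(2))
  moreover have "pbounded A u (\<lambda>x. size (Node (v x) (w x)))"
    using pbounded_add[OF pbounded_add[OF P(3) Q(3)] pbounded_const[of _ _ 1]] by simp
  ultimately show ?thesis by (rule computesI)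
qed

text \<open>In the nonempty case the continuation receives the input paired with the value that was
  tested. In this way the components of a pattern match become available to the branch.\<close>

lemma computes_case:
  assumes "computes A u l"
    and "computes {x \<in> A. l x \<noteq> Leaf} (\<lambda>x. Node (u x) (l x)) v"
    and "computes {x \<in> A. l x = Leaf} u v"
  shows "computes A u v"
proof -
  from assms(1) obtain P S where P: "\<And>x. x \<in> A \<Longrightarrow> exec P (st [u x]) (S x) (st [l x])"
    "pbounded A u S" "pbounded A u (\<lambda>x. size (l x))" by (rule computesE) blast
  from assms(2) obtain Q T where Q: "\<And>x. x \<in> A \<Longrightarrow> l x \<noteq> Leaf \<Longrightarrow> exec Q (st [Node (u x) (l x)]) (T x) (st [v x])"
    "pbounded {x \<in> A. l x \<noteq> Leaf} (\<lambda>x. Node (u x) (l x)) T"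
    "pbounded {x \<in> A. l x \<noteq> Leaf} (\<lambda>x. Node (u x) (l x)) (\<lambda>x. size (v x))" by (rule computesE) blast
  from assms(3) obtain R U where R: "\<And>x. x \<in> A \<Longrightarrow> l x = Leaf \<Longrightarrow> exec R (st [u x]) (U x) (st [v x])"
    "pbounded {x \<in> A. l x = Leaf} u U"
    "pbounded {x \<in> A. l x = Leaf} u (\<lambda>x. size (v x))" by (rule computesE) blast
  have nb: "pbounded A u (\<lambda>x. size (Node (u x) (l x)))"
    using pbounded_add[OF pbounded_add[OF pbounded_size P(3)] pbounded_const[of _ _ 1]] by simp
  then have nb': "pbounded {x \<in> A. l x \<noteq> Leaf} u (\<lambda>x. size (Node (u x) (l x)))"
    by (rule pbounded_mono) auto
  have ext: "pbounded A u (\<lambda>x. if l x = Leaf then f x else g x)"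
    if g: "pbounded {x \<in> A. l x \<noteq> Leaf} (\<lambda>x. Node (u x) (l x)) g"
      and f: "pbounded {x \<in> A. l x = Leaf} u f" for f g
  proof -
    obtain c where c: "\<And>x. x \<in> A \<Longrightarrow> l x = Leaf \<Longrightarrow> f x \<le> (size (u x) + 2) ^ c"
      using f by (auto simp: pbounded_def)
    obtain b where b: "\<And>x. x \<in> A \<Longrightarrow> l x \<noteq> Leaf \<Longrightarrow> g x \<le> (size (u x) + 2) ^ b"
      using pbounded_trans[OF g nb'] by (auto simp: pbounded_def)
    have "pbounded A u (\<lambda>x. (size (u x) + 2) ^ c + (size (u x) + 2) ^ b)"
      by (rule pbounded_add; rule pboundedI; rule order_refl)
    then show ?thesis
    proof (rule pbounded_mono)
      fix x assume "x \<in> A"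
      then show "(if l x = Leaf then f x else g x) \<le> (size (u x) + 2) ^ c + (size (u x) + 2) ^ b"
        using b[of x] c[of x] by (cases "l x = Leaf") (simp_all del: add_2_eq_Suc')
    qed
  qed
  let ?P = "Seq (Assign 1 (Var 0)) (Seq (shift_com 1 P)
    (If (Var 1) (Seq (Assign 0 (ENode (Var 0) (Var 1))) (Seq (Assign 1 ELeaf) Q)) R))"
  let ?T = "\<lambda>x. 2 + (S x + (if l x = Leaf then 1 + 1 + U x else 1 + 1 + (4 + (2 + T x))))"
  have "exec ?P (st [u x]) (?T x) (st [v x])" if x: "x \<in> A" for x
  proof (intro exec.Seq)
    \<comment> \<open>The value is computed on a copy, since both branches still need the input in
      variable 0.\<close>
    show "exec (Assign 1 (Var 0)) (st [u x]) 2 (st [u x, u x])"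
      by (rule exec_push) simp_all
    show "exec (shift_com 1 P) (st [u x, u x]) (S x) (st [u x, l x])"
      using exec_shift_st[OF P(1)[OF x], of "[u x]"] by simp
    show "exec (If (Var 1) (Seq (Assign 0 (ENode (Var 0) (Var 1))) (Seq (Assign 1 ELeaf) Q)) R)
      (st [u x, l x]) (if l x = Leaf then 1 + 1 + U x else 1 + 1 + (4 + (2 + T x))) (st [v x])"
    proof (cases "l x = Leaf")
      case True
      then have "st [u x, l x] = st [u x]" using st_Leaf[of "[u x]"] by simp
      with True exec.IfFalse[OF _ R(1)[OF x True], of "Var 1"] show ?thesis
        by (simp add: st_def)
    next
      case False
      have "exec (Seq (Assign 0 (ENode (Var 0) (Var 1))) (Seq (Assign 1 ELeaf) Q)) (st [u x, l x])
         (4 + (2 + T x)) (st [v x])"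
      proof (intro exec.Seq)
        show "exec (Assign 0 (ENode (Var 0) (Var 1))) (st [u x, l x]) 4 (st [Node (u x) (l x), l x])"
      by (rule exec_set) simp_all
        show "exec (Assign 1 ELeaf) (st [Node (u x) (l x), l x]) 2 (st [Node (u x) (l x)])"
      by (rule exec_pop) simp_all
        show "exec Q (st [Node (u x) (l x)]) (T x) (st [v x])" by (rule Q(1)[OF x False])
      qed
      from exec.IfTrue[OF _ this, of "Var 1"] False show ?thesis by (simp add: st_def)
    qed
  qed
  moreover have "pbounded A u ?T"
  proof (intro pbounded_add pbounded_const P(2) ext)
    show "pbounded {x \<in> A. l x = Leaf} u U" "pbounded {x \<in> A. l x \<noteq> Leaf} (\<lambda>x. Node (u x) (l x)) T"
      by (rule R(2), rule Q(2))
  qed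
  moreover have "pbounded A u (\<lambda>x. size (v x))"
    using ext[OF Q(3) R(3)] by simp
  ultimately show ?thesis by (rule computesI)
qed

subsection \<open>Typed encodings\<close>

class enc =
  fixes enc :: "'a \<Rightarrow> tree"

instantiation tree :: enc
begin
definition [simp]: "enc (x :: tree) = x"
instance ..
end

instantiation unit :: enc
begin
definition [simp]: "enc (x :: unit) = Leaf"
instance ..
end

instantiation bool :: enc
begin
definition enc_bool_eq: "enc b = enc_bool b"
instance ..
end

instantiation nat :: enc
begin
definition enc_nat_eq: "enc n = enc_nat n"
instance ..
end

instantiation list :: (enc) enc
begin
definition "enc xs = enc_list (map enc xs)"
instance ..
end

instantiation prod :: (enc, enc) enc
begin
definition "enc p = Node (enc (fst p)) (enc (snd p))"
instance ..
end

lemma enc_simps [simp]: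
  "enc True = Node Leaf Leaf" "enc False = Leaf"
  "enc [] = Leaf" "enc (x # xs) = Node (enc x) (enc xs)"
  "enc (a, b) = Node (enc a) (enc b)"
  by (simp_all add: enc_bool_eq enc_bool_def enc_list_def enc_prod_def)

lemma enc_list_Leaf_iff: "enc xs = Leaf \<longleftrightarrow> xs = []"
  by (cases xs) auto

abbreviation esize :: "'a::enc \<Rightarrow> nat" where
  "esize x \<equiv> size (enc x)"

lemma length_le_size_enc: "length xs \<le> esize xs"
  by (induction xs) auto

lemma size_enc_append: "esize (xs @ ys) = esize xs + esize ys"
  by (induction xs) auto

lemma size_enc_mem: "x \<in> set xs \<Longrightarrow> esize x \<le> esize xs"
  by (induction xs) auto

definition ptime :: "('a::enc \<Rightarrow> 'b::enc) \<Rightarrow> bool" where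
  "ptime f \<longleftrightarrow> computes UNIV enc (\<lambda>x. enc (f x))"

named_theorems ptime_intros

lemma ptime_comp: "ptime g \<Longrightarrow> ptime f \<Longrightarrow> ptime (\<lambda>x. g (f x))"
  using computes_trans[OF _ computes_reindex[of UNIV enc "\<lambda>x. enc (g x)" UNIV f]] unfolding ptime_def by blast

lemma ptime_exp:
  assumes "\<And>x. eval_exp e (st [enc x]) = enc (f x)" "\<And>x. esize (f x) \<le> esize x + c"
  shows "ptime f"
  unfolding ptime_def
proof (rule computes_exp[of _ e])
  show "pbounded UNIV enc (\<lambda>x. esize (f x))"
    by (rule pbounded_mono[where A = UNIV, OF pbounded_add[OF pbounded_size pbounded_const[of _ _ c]]])
      (simp_all add: assms(2))
qed (simp add: assms(1))

lemma ptime_id [ptime_intros]: "ptime (\<lambda>x. x)"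
  by (rule ptime_exp[of "Var 0" _ 0]) auto

fun exp_of :: "tree \<Rightarrow> exp" where
  "exp_of Leaf = ELeaf"
| "exp_of (Node l r) = ENode (exp_of l) (exp_of r)"

lemma eval_exp_of: "eval_exp (exp_of x) s = x"
  by (induction x) auto

lemma ptime_const [ptime_intros]: "ptime (\<lambda>x. c)"
  by (rule ptime_exp[of "exp_of (enc c)" _ "esize c"]) (auto simp: eval_exp_of)

lemma ptime_fst [ptime_intros]: "ptime f \<Longrightarrow> ptime (\<lambda>x. fst (f x))"
  by (rule ptime_comp[of fst]) (rule ptime_exp[of "Hd (Var 0)" _ 0], auto simp: enc_prod_def)

lemma ptime_snd [ptime_intros]: "ptime f \<Longrightarrow> ptime (\<lambda>x. snd (f x))"
  by (rule ptime_comp[of snd]) (rule ptime_exp[of "Tl (Var 0)" _ 0], auto simp: enc_prod_def)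

lemma ptime_Pair [ptime_intros]: "ptime f \<Longrightarrow> ptime g \<Longrightarrow> ptime (\<lambda>x. (f x, g x))"
  unfolding ptime_def by (simp add: computes_pair)

lemma ptime_Cons [ptime_intros]: "ptime f \<Longrightarrow> ptime g \<Longrightarrow> ptime (\<lambda>x. f x # g x)"
  unfolding ptime_def by (simp add: computes_pair)

text \<open>A nonempty list is encoded as the pair of its head and tail, so input and list together
  are already the encoding of the triple on which the branch \<open>c\<close> is assumed to be
  computable.\<close>

lemma ptime_case_list [ptime_intros]:
  assumes "ptime l" "ptime n" "ptime (\<lambda>z. c (fst z) (fst (snd z)) (snd (snd z)))"
  shows "ptime (\<lambda>x. case l x of [] \<Rightarrow> n x | a # r \<Rightarrow> c x a r)"
  unfolding ptime_def
proof (rule computes_case)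
  show "computes UNIV enc (\<lambda>x. enc (l x))" using assms(1) by (simp add: ptime_def)
  have "computes {x \<in> UNIV. enc (l x) \<noteq> Leaf} (\<lambda>x. enc (x, hd (l x), tl (l x)))
    (\<lambda>x. enc ((\<lambda>z. c (fst z) (fst (snd z)) (snd (snd z))) (x, hd (l x), tl (l x))))"
    by (rule computes_reindex[OF assms(3)[unfolded ptime_def]]) auto
  then show "computes {x \<in> UNIV. enc (l x) \<noteq> Leaf} (\<lambda>x. Node (enc x) (enc (l x)))
     (\<lambda>x. enc (case l x of [] \<Rightarrow> n x | a # r \<Rightarrow> c x a r))"
    by (rule computes_cong) (auto simp: enc_list_Leaf_iff neq_Nil_conv)
  have "computes {x \<in> UNIV. enc (l x) = Leaf} enc (\<lambda>x. enc (n x))"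
    by (rule computes_mono[OF assms(2)[unfolded ptime_def]]) auto
  then show "computes {x \<in> UNIV. enc (l x) = Leaf} enc (\<lambda>x. enc (case l x of [] \<Rightarrow> n x | a # r \<Rightarrow> c x a r))"
    by (rule computes_cong) (auto simp: enc_list_Leaf_iff)
qed

text \<open>\<open>True\<close> and \<open>[()]\<close> have the same encoding, as have
  \<open>False\<close> and \<open>[]\<close>. A conditional is therefore a case distinction on
  lists.\<close>

lemma ptime_if [ptime_intros]:
  assumes "ptime b" "ptime f" "ptime g"
  shows "ptime (\<lambda>x. if b x then f x else g x)"
proof -
  have "computes UNIV enc (\<lambda>x. enc (if b x then [()] else []))"
    by (rule computes_cong[OF assms(1)[unfolded ptime_def]]) auto
  then have "ptime (\<lambda>x. if b x then [()] else [])" by (simp add: ptime_def)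
  from ptime_case_list[OF this assms(3), of "\<lambda>x _ _. f x"] ptime_comp[OF assms(2) ptime_fst[OF ptime_id]]
  have "ptime (\<lambda>x. case if b x then [()] else [] of [] \<Rightarrow> g x | a # r \<Rightarrow> f x)" by blast
  moreover have "(\<lambda>x. case if b x then [()] else [] of [] \<Rightarrow> g x | a # r \<Rightarrow> f x) = (\<lambda>x. if b x then f x else g x)"
    by auto
  ultimately show ?thesis by simp
qed

text \<open>Variable 0 keeps the parameter of the fold, 1 the unread rest of the list, 2 the
  accumulator; the step function runs shifted to variable 3.\<close>

definition fold_body :: "com \<Rightarrow> com" where
  "fold_body P = Seq (Assign 3 (ENode (Var 0) (ENode (Hd (Var 1)) (Var 2))))
    (Seq (shift_com 3 P) (Seq (Assign 2 (Var 3)) (Seq (Assign 3 ELeaf) (Assign 1 (Tl (Var 1))))))"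

lemma exec_fold_loop:
  fixes f :: "'a::enc \<Rightarrow> 'c::enc \<Rightarrow> 'c"
  assumes "\<And>a acc. exec P (st [enc (x, a, acc)]) (T a acc) (st [enc (f a acc)])"
    and "\<And>ys a zs. xs = ys @ a # zs \<Longrightarrow> T a (fold f ys acc) \<le> M"
  shows "\<exists>t \<le> length xs * (M + 16) + 2.
    exec (While (Var 1) (fold_body P)) (st [enc x, enc xs, enc acc]) t (st [enc x, Leaf, enc (fold f xs acc)])"
  using assms(2)
proof (induction xs arbitrary: acc)
  case Nil
  have "exec (While (Var 1) (fold_body P)) (st [enc x, Leaf, enc acc]) (1 + exp_time (Var 1)) (st [enc x, Leaf, enc acc])"
    by (rule exec.WhileFalse) simp
  then show ?case by (auto simp: numeral_2_eq_2)
next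
  case (Cons a xs)
  have "T b (fold f ys (f a acc)) \<le> M" if "xs = ys @ b # zs" for ys b zs
    using Cons.prems[of "a # ys" b zs] that by simp
  then have "\<exists>t \<le> length xs * (M + 16) + 2.
    exec (While (Var 1) (fold_body P)) (st [enc x, enc xs, enc (f a acc)]) t (st [enc x, Leaf, enc (fold f xs (f a acc))])"
    by (rule Cons.IH)
  then obtain t where t: "t \<le> length xs * (M + 16) + 2"
    "exec (While (Var 1) (fold_body P)) (st [enc x, enc xs, enc (f a acc)]) t (st [enc x, Leaf, enc (fold f xs (f a acc))])"
    by auto
  let ?l = "Node (enc a) (enc xs)"
  have "exec (fold_body P) (st [enc x, ?l, enc acc]) (7 + (T a acc + (2 + (2 + 3))))
    (st [enc x, enc xs, enc (f a acc)])"
    unfolding fold_body_def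
  proof (intro exec.Seq)
    show "exec (Assign 3 (ENode (Var 0) (ENode (Hd (Var 1)) (Var 2)))) (st [enc x, ?l, enc acc]) 7
      (st [enc x, ?l, enc acc, enc (x, a, acc)])"
      by (rule exec_push) (simp_all add: numeral_eq_Suc)
    show "exec (shift_com 3 P) (st [enc x, ?l, enc acc, enc (x, a, acc)]) (T a acc)
      (st [enc x, ?l, enc acc, enc (f a acc)])"
      using exec_shift_st[OF assms(1)[of a acc], of "[enc x, ?l, enc acc]"] by (simp add: numeral_eq_Suc)
    show "exec (Assign 2 (Var 3)) (st [enc x, ?l, enc acc, enc (f a acc)]) 2
      (st [enc x, ?l, enc (f a acc), enc (f a acc)])"
      by (rule exec_set) (simp_all add: numeral_eq_Suc)
    show "exec (Assign 3 ELeaf) (st [enc x, ?l, enc (f a acc), enc (f a acc)]) 2 (st [enc x, ?l, enc (f a acc)])"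
      by (rule exec_pop) simp_all
    show "exec (Assign 1 (Tl (Var 1))) (st [enc x, ?l, enc (f a acc)]) 3 (st [enc x, enc xs, enc (f a acc)])"
      by (rule exec_set) (simp_all add: numeral_eq_Suc)
  qed
  from exec.WhileTrue[OF _ this t(2)]
  have "exec (While (Var 1) (fold_body P)) (st [enc x, ?l, enc acc]) (2 + (7 + (T a acc + (2 + (2 + 3)))) + t)
     (st [enc x, Leaf, enc (fold f (a # xs) acc)])"
    by simp
  moreover have "T a acc \<le> M" using Cons.prems[of "[]"] by simp
  \<comment> \<open>The 16 units per element are 2 for the loop test and 7, 2, 2 and 3 for the four
    assignments of \<open>fold_body\<close>.\<close>
  then have "2 + (7 + (T a acc + (2 + (2 + 3)))) + t \<le> length (a # xs) * (M + 16) + 2"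
    using t(1) by simp
  ultimately show ?case
    by (intro exI[of _ "2 + (7 + (T a acc + (2 + (2 + 3)))) + t"] conjI) (simp_all only: enc_simps)
qed

lemma pbounded_power: "pbounded A u T \<Longrightarrow> pbounded A u (\<lambda>x. T x ^ c)"
  by (induction c) (auto intro: pbounded_const pbounded_mult)

text \<open>Iterating a polynomial-time step can square the size of the accumulator every time.
  Therefore \<open>B\<close> has to bound all intermediate accumulators, not only the last one; then
  every step runs within one polynomial \<open>M\<close>.\<close>

lemma ptime_fold_general:
  fixes f :: "'x::enc \<Rightarrow> 'a::enc \<Rightarrow> 'c::enc \<Rightarrow> 'c"
  assumes l: "ptime l" and i: "ptime i" and f: "ptime (\<lambda>z. f (fst z) (fst (snd z)) (snd (snd z)))"
    and B: "pbounded UNIV enc B"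
    and fB: "\<And>x ys zs. l x = ys @ zs \<Longrightarrow> esize (fold (f x) ys (i x)) \<le> B x"
  shows "ptime (\<lambda>x. fold (f x) (l x) (i x))"
proof -
  from l obtain L S where L: "\<And>x. exec L (st [enc x]) (S x) (st [enc (l x)])"
    "pbounded UNIV enc S" "pbounded UNIV enc (\<lambda>x. esize (l x))"
    unfolding ptime_def by (rule computesE) blast
  from i obtain I U where I: "\<And>x. exec I (st [enc x]) (U x) (st [enc (i x)])"
    "pbounded UNIV enc U" unfolding ptime_def by (rule computesE) blast
  from f obtain F T where F: "\<And>x. exec F (st [enc x]) (T x) (st [enc (f (fst x) (fst (snd x)) (snd (snd x)))])"
    "pbounded UNIV enc T" unfolding ptime_def by (rule computesE) blast
  from F(2) obtain c where c: "\<And>x. T x \<le> (esize x + 2) ^ c"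
    unfolding pbounded_def by blast
  define M where "M x = (esize x + esize (l x) + B x + 4) ^ c" for x
  have M: "pbounded UNIV enc M" unfolding M_def
    by (intro pbounded_power pbounded_add pbounded_const pbounded_size L(3) B)
  have TM: "T (x, a, fold (f x) ys (i x)) \<le> M x" if "l x = ys @ a # zs" for x ys a zs
  proof -
    have "esize a \<le> esize (l x)" by (rule size_enc_mem) (simp add: that)
    with fB[OF that]
    have "esize (x, a, fold (f x) ys (i x)) + 2 \<le> esize x + esize (l x) + B x + 4" by simp
    then have "(esize (x, a, fold (f x) ys (i x)) + 2) ^ c \<le> M x"
      unfolding M_def by (rule power_mono) simp
    with c show ?thesis by (rule order_trans)
  qed
  let ?P = "Seq (Assign 1 (Var 0)) (Seq (shift_com 1 L) (Seq (Assign 2 (Var 0)) (Seq (shift_com 2 I)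
     (Seq (While (Var 1) (fold_body F)) (Seq (Assign 0 (Var 2)) (Assign 2 ELeaf))))))"
  let ?r = "\<lambda>x. fold (f x) (l x) (i x)"
  have "\<exists>t. exec ?P (st [enc x]) t (st [enc (?r x)]) \<and>
    t \<le> 2 + (S x + (2 + (U x + (esize (l x) * (M x + 16) + 2 + (2 + 2)))))" for x
  proof -
    have "\<And>a acc. exec F (st [enc (x, a, acc)]) (T (x, a, acc)) (st [enc (f x a acc)])"
      using F(1) by (metis fst_conv snd_conv)
    from exec_fold_loop[where T = "\<lambda>a acc. T (x, a, acc)", OF this TM]
    have "\<exists>t \<le> length (l x) * (M x + 16) + 2.
      exec (While (Var 1) (fold_body F)) (st [enc x, enc (l x), enc (i x)]) t (st [enc x, Leaf, enc (?r x)])" .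
    then obtain t
      where t: "t \<le> length (l x) * (M x + 16) + 2"
        "exec (While (Var 1) (fold_body F)) (st [enc x, enc (l x), enc (i x)]) t (st [enc x, Leaf, enc (?r x)])"
      by auto
    have "exec ?P (st [enc x]) (2 + (S x + (2 + (U x + (t + (2 + 2)))))) (st [enc (?r x)])"
    proof (intro exec.Seq)
      show "exec (Assign 1 (Var 0)) (st [enc x]) 2 (st [enc x, enc x])" by (rule exec_push) simp_all
      show "exec (shift_com 1 L) (st [enc x, enc x]) (S x) (st [enc x, enc (l x)])"
        using exec_shift_st[OF L(1)[of x], of "[enc x]"] by simp
      show "exec (Assign 2 (Var 0)) (st [enc x, enc (l x)]) 2 (st [enc x, enc (l x), enc x])"
        by (rule exec_push) simp_all
      show "exec (shift_com 2 I) (st [enc x, enc (l x), enc x]) (U x) (st [enc x, enc (l x), enc (i x)])"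
        using exec_shift_st[OF I(1)[of x], of "[enc x, enc (l x)]"] by (simp add: numeral_2_eq_2)
      show "exec (While (Var 1) (fold_body F)) (st [enc x, enc (l x), enc (i x)]) t (st [enc x, Leaf, enc (?r x)])" by fact
      show "exec (Assign 0 (Var 2)) (st [enc x, Leaf, enc (?r x)]) 2 (st [enc (?r x), Leaf, enc (?r x)])"
        by (rule exec_set) (simp_all add: numeral_eq_Suc)
      show "exec (Assign 2 ELeaf) (st [enc (?r x), Leaf, enc (?r x)]) 2 (st [enc (?r x)])"
        using exec_pop[of 2 "[enc (?r x), Leaf]"] st_Leaf[of "[enc (?r x)]"] by simp
    qed
    moreover have "t \<le> esize (l x) * (M x + 16) + 2"
      using t(1) mult_right_mono[OF length_le_size_enc[of "l x"], of "M x + 16"] by linarith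
    ultimately show ?thesis by (intro exI conjI) (assumption, linarith)
  qed
  then obtain V where V: "\<And>x. exec ?P (st [enc x]) (V x) (st [enc (?r x)])"
    "\<And>x. V x \<le> 2 + (S x + (2 + (U x + (esize (l x) * (M x + 16) + 2 + (2 + 2)))))" by metis
  show ?thesis unfolding ptime_def
  proof (rule computesI)
    show "exec ?P (st [enc x]) (V x) (st [enc (?r x)])" for x by (rule V(1))
    have "pbounded UNIV enc (\<lambda>x. 2 + (S x + (2 + (U x + (esize (l x) * (M x + 16) + 2 + (2 + 2))))))"
      by (intro pbounded_add pbounded_mult pbounded_const L(2,3) I(2) M)
    then show "pbounded UNIV enc V" by (rule pbounded_mono) (use V(2) in auto)
    show "pbounded UNIV enc (\<lambda>x. esize (?r x))"
      by (rule pbounded_mono[OF B]) (auto intro: fB[of _ _ "[]"])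
  qed
qed

text \<open>If a step enlarges the accumulator by an amount that does not depend on the accumulator,
  growth is additive and the intermediate sizes stay polynomial. All folds below are of this
  kind.\<close>

lemma ptime_fold:
  fixes f :: "'x::enc \<Rightarrow> 'a::enc \<Rightarrow> 'c::enc \<Rightarrow> 'c"
  assumes l: "ptime l" and i: "ptime i" and f: "ptime (\<lambda>z. f (fst z) (fst (snd z)) (snd (snd z)))"
    and g: "pbounded UNIV enc (\<lambda>z. g (fst z) (snd z))"
    and fg: "\<And>x a acc. esize (f x a acc) \<le> esize acc + g x a"
  shows "ptime (\<lambda>x. fold (f x) (l x) (i x))"
proof -
  from g obtain c where c: "\<And>x a. g x a \<le> (esize (x, a) + 2) ^ c"
    unfolding pbounded_def by (metis UNIV_I fst_conv snd_conv)
  define h where "h x = (esize x + esize (l x) + 3) ^ c" for x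
  have gh: "g x a \<le> h x" if "a \<in> set (l x)" for x a
  proof -
    have "esize (x, a) + 2 \<le> esize x + esize (l x) + 3"
      using size_enc_mem[OF that] by simp
    then have "(esize (x, a) + 2) ^ c \<le> h x" unfolding h_def by (rule power_mono) simp
    with c[of x a] show ?thesis by (rule order_trans)
  qed
  have L: "pbounded UNIV enc (\<lambda>x. esize (l x))" and I: "pbounded UNIV enc (\<lambda>x. esize (i x))"
    using l i unfolding ptime_def computes_def by auto
  have *: "esize (fold (f x) ys s) \<le> esize s + length ys * h x" if "set ys \<subseteq> set (l x)" for x ys s
    using that
  proof (induction ys arbitrary: s)
    case (Cons a ys)
    then have "esize (fold (f x) ys (f x a s)) \<le> esize (f x a s) + length ys * h x" by simp
    also have "esize (f x a s) \<le> esize s + h x"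
      using fg[of x a s] gh[of a x] Cons.prems by simp
    finally show ?case by simp
  qed simp
  show ?thesis
  proof (rule ptime_fold_general[OF l i f])
    show "pbounded UNIV enc (\<lambda>x. esize (i x) + esize (l x) * h x)"
      unfolding h_def by (intro pbounded_add pbounded_mult pbounded_power pbounded_const pbounded_size L I)
    fix x ys zs assume "l x = ys @ zs"
    then have "set ys \<subseteq> set (l x)" "length ys \<le> esize (l x)"
      using length_le_size_enc[of "l x"] by auto
    with *[of ys x "i x"] show "esize (fold (f x) ys (i x)) \<le> esize (i x) + esize (l x) * h x"
      by (meson add_left_mono mult_le_mono1 order_trans)
  qed
qed

section \<open>Closure of polynomial time under logic, list operations and comparisons\<close>

lemma ptime_size: "ptime f \<Longrightarrow> pbounded UNIV enc (\<lambda>x. esize (f x))"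
  unfolding ptime_def computes_def by auto

lemma ptime_cong: "ptime f \<Longrightarrow> (\<And>x. f x = g x) \<Longrightarrow> ptime g"
  by (metis ext)

lemma ptime_Not [ptime_intros]: "ptime f \<Longrightarrow> ptime (\<lambda>x. \<not> f x)"
  by (rule ptime_cong[OF ptime_if[OF _ ptime_const[of False] ptime_const[of True]]]) auto

lemma ptime_conj [ptime_intros]:
  assumes "ptime f" "ptime g" shows "ptime (\<lambda>x. f x \<and> g x)"
proof -
  have "ptime (\<lambda>x. if f x then g x else False)" by (intro ptime_if ptime_const assms)
  then show ?thesis by (rule ptime_cong) simp
qed

lemma ptime_disj [ptime_intros]:
  assumes "ptime f" "ptime g" shows "ptime (\<lambda>x. f x \<or> g x)"
proof -
  have "ptime (\<lambda>x. if f x then True else g x)" by (intro ptime_if ptime_const assms)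
  then show ?thesis by (rule ptime_cong) simp
qed

lemma ptime_tl [ptime_intros]:
  assumes "ptime l" shows "ptime (\<lambda>x. tl (l x))"
proof -
  have "ptime (\<lambda>x. case l x of [] \<Rightarrow> [] | a # r \<Rightarrow> r)" by (intro ptime_intros assms)
  then show ?thesis by (rule ptime_cong) (simp split: list.split)
qed

lemma ptime_null [ptime_intros]:
  assumes "ptime l" shows "ptime (\<lambda>x. l x = [])"
proof -
  have "ptime (\<lambda>x. case l x of [] \<Rightarrow> True | a # r \<Rightarrow> False)" by (intro ptime_intros assms)
  then show ?thesis by (rule ptime_cong) (simp split: list.split)
qed

lemma ptime_fold_Cons: "ptime f \<Longrightarrow> ptime g \<Longrightarrow> ptime (\<lambda>x. fold (#) (f x) (g x))"
  by (rule ptime_fold[where g = "\<lambda>x a. esize a + 1"])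
    (intro ptime_intros ptime_size pbounded_add pbounded_const | simp)+

lemma ptime_rev: "ptime f \<Longrightarrow> ptime (\<lambda>x. rev (f x))"
  using ptime_fold_Cons[of f "\<lambda>_. []"] by (simp add: fold_Cons_rev ptime_const)

lemma ptime_append [ptime_intros]: "ptime f \<Longrightarrow> ptime g \<Longrightarrow> ptime (\<lambda>x. f x @ g x)"
  using ptime_fold_Cons[OF ptime_rev] by (simp add: fold_Cons_rev)

lemma fold_append_conv_concat: "fold (\<lambda>a acc. acc @ h a) ys zs = zs @ concat (map h ys)"
  by (induction ys arbitrary: zs) auto

lemma ptime_concat_map:
  assumes "ptime l" "ptime (\<lambda>z. f (fst z) (snd z))"
  shows "ptime (\<lambda>x. concat (map (f x) (l x)))"
proof -
  have f': "ptime (\<lambda>z. f (fst z) (fst (snd z)))"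
    using ptime_comp[OF assms(2), of "\<lambda>z. (fst z, fst (snd z))"] by (simp add: ptime_intros)
  have "ptime (\<lambda>x. fold (\<lambda>a acc. acc @ f x a) (l x) [])"
    by (rule ptime_fold[where g = "\<lambda>x a. esize (f x a)"])
      (intro ptime_intros f' assms ptime_size pbounded_add pbounded_const | simp add: size_enc_append)+
  then show ?thesis by (simp add: fold_append_conv_concat)
qed

lemma ptime_concat [ptime_intros]: "ptime l \<Longrightarrow> ptime (\<lambda>x. concat (l x))"
  using ptime_concat_map[of l "\<lambda>_ a. a"] by (simp add: ptime_intros)

lemma ptime_map [ptime_intros]:
  "ptime (\<lambda>z. f (fst z) (snd z)) \<Longrightarrow> ptime l \<Longrightarrow> ptime (\<lambda>x. map (f x) (l x))"
  using ptime_concat_map[of l "\<lambda>x a. [f x a]"] by (simp add: ptime_intros)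

lemma ptime_filter [ptime_intros]:
  "ptime (\<lambda>z. f (fst z) (snd z)) \<Longrightarrow> ptime l \<Longrightarrow> ptime (\<lambda>x. filter (f x) (l x))"
proof -
  assume "ptime (\<lambda>z. f (fst z) (snd z))" "ptime l"
  then have "ptime (\<lambda>x. concat (map (\<lambda>a. if f x a then [a] else []) (l x)))"
    by (intro ptime_intros)
  moreover have "concat (map (\<lambda>a. if h a then [a] else []) ys) = filter h ys" for h and ys :: "'b list"
    by (induction ys) auto
  ultimately show ?thesis by simp
qed

lemma ptime_ex [ptime_intros]:
  "ptime (\<lambda>z. f (fst z) (snd z)) \<Longrightarrow> ptime l \<Longrightarrow> ptime (\<lambda>x. \<exists>a\<in>set (l x). f x a)"
proof -
  assume "ptime (\<lambda>z. f (fst z) (snd z))" "ptime l"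
  then have "ptime (\<lambda>x. filter (f x) (l x) \<noteq> [])" by (intro ptime_intros)
  then show ?thesis by (simp add: filter_empty_conv)
qed

lemma ptime_all [ptime_intros]:
  "ptime (\<lambda>z. f (fst z) (snd z)) \<Longrightarrow> ptime l \<Longrightarrow> ptime (\<lambda>x. \<forall>a\<in>set (l x). f x a)"
proof -
  assume "ptime (\<lambda>z. f (fst z) (snd z))" "ptime l"
  then have "ptime (\<lambda>x. filter (\<lambda>a. \<not> f x a) (l x) = [])" by (intro ptime_intros)
  then show ?thesis by (simp add: filter_empty_conv)
qed

text \<open>The number \<open>n\<close> is a constant of the program: the induction unrolls the
  comparison into \<open>n\<close> tests for emptiness.\<close>

lemma ptime_length_ge [ptime_intros]: "ptime l \<Longrightarrow> ptime (\<lambda>x. n \<le> length (l x))"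
proof (induction n arbitrary: l)
  case (Suc n)
  have "ptime (\<lambda>x. l x \<noteq> [] \<and> n \<le> length (tl (l x)))"
    by (intro ptime_intros Suc)
  then show ?case by (rule ptime_cong) (case_tac "l x"; simp)
qed (simp add: ptime_const)

lemma ptime_length_eq [ptime_intros]: "ptime l \<Longrightarrow> ptime (\<lambda>x. length (l x) = n)"
proof -
  assume "ptime l"
  then have "ptime (\<lambda>x. n \<le> length (l x) \<and> \<not> Suc n \<le> length (l x))" by (intro ptime_intros)
  moreover have "(\<lambda>x. n \<le> length (l x) \<and> \<not> Suc n \<le> length (l x)) = (\<lambda>x. length (l x) = n)" by auto
  ultimately show ?thesis by simp
qed

lemma ptime_take_1: "ptime l \<Longrightarrow> ptime (\<lambda>x. take 1 (l x))"
proof -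
  assume "ptime l"
  then have "ptime (\<lambda>x. case l x of [] \<Rightarrow> [] | a # r \<Rightarrow> [a])" by (intro ptime_intros)
  then show ?thesis by (rule ptime_cong) (simp split: list.split)
qed

text \<open>A number and its list of bits are the same tree, so the program does nothing.\<close>

lemma ptime_bits [ptime_intros]: "ptime f \<Longrightarrow> ptime (\<lambda>x. bits (f x))"
proof (rule ptime_comp[of bits])
  have "enc (bits n) = enc n" for n
    by (simp add: enc_list_def enc_nat_def enc_bool_eq[abs_def] enc_nat_eq)
  then show "ptime bits" by (intro ptime_exp[of "Var 0" _ 0]) auto
qed

lemma ptime_eq_bool [ptime_intros]: "ptime f \<Longrightarrow> ptime g \<Longrightarrow> ptime (\<lambda>x. f x = (g x :: bool))"
proof -
  assume "ptime f" "ptime g"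
  then have "ptime (\<lambda>x. (f x \<and> g x) \<or> (\<not> f x \<and> \<not> g x))" by (intro ptime_intros)
  moreover have "(\<lambda>x. (f x \<and> g x) \<or> (\<not> f x \<and> \<not> g x)) = (\<lambda>x. f x = g x)" by auto
  ultimately show ?thesis by simp
qed

lemma inj_bits: "bits m = bits n \<Longrightarrow> m = n"
proof (induction m arbitrary: n rule: bits.induct)
  case 1
  then show ?case by (cases n) auto
next
  case (2 m)
  then obtain k where n: "n = Suc k" by (cases n) auto
  with 2 have "odd (Suc m) = odd (Suc k)" "Suc m div 2 = Suc k div 2" by auto
  then have "Suc m mod 2 = Suc k mod 2" by presburger
  with \<open>Suc m div 2 = Suc k div 2\<close> show ?case unfolding n by (metis div_mult_mod_eq)
qed

text \<open>The accumulator holds the unread rest of the second list and whether all bits agreed so far.\<close>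

lemma ptime_eq_bools:
  assumes "ptime f" "ptime g"
  shows "ptime (\<lambda>x. f x = (g x :: bool list))"
proof -
  define h :: "bool \<Rightarrow> bool list \<times> bool \<Rightarrow> bool list \<times> bool" where
    "h a acc = (case fst acc of [] \<Rightarrow> ([], False) | b # r \<Rightarrow> (r, snd acc \<and> a = b))" for a acc
  have h: "ptime (\<lambda>z. h (fst (snd z)) (snd (snd z)))" unfolding h_def by (intro ptime_intros)
  have "ptime (\<lambda>x. fold (\<lambda>a. h a) (f x) (g x, True))"
    by (rule ptime_fold[where g = "\<lambda>x a. 1"])
      (intro h assms ptime_intros pbounded_const |
        auto simp: h_def enc_prod_def enc_bool_eq enc_bool_def split: list.splits)+
  then have "ptime (\<lambda>x. snd (fold h (f x) (g x, True)) \<and> fst (fold h (f x) (g x, True)) = [])"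
    by (intro ptime_intros) simp_all
  moreover have "(snd (fold h xs (ys, c)) \<and> fst (fold h xs (ys, c)) = []) \<longleftrightarrow> c \<and> xs = ys" for xs ys c
    by (induction xs arbitrary: ys c) (auto simp: h_def split: list.splits)
  ultimately show ?thesis by simp
qed

lemma ptime_eq_nat [ptime_intros]:
  assumes "ptime f" "ptime g" shows "ptime (\<lambda>x. f x = (g x :: nat))"
proof -
  have "ptime (\<lambda>x. bits (f x) = bits (g x))" by (intro ptime_eq_bools ptime_bits assms)
  then show ?thesis by (rule ptime_cong) (auto dest: inj_bits)
qed

lemma ptime_eq_prod:
  assumes "ptime (\<lambda>x. fst (f x) = fst (g x))" "ptime (\<lambda>x. snd (f x) = snd (g x))"
  shows "ptime (\<lambda>x. f x = g x)"
  using ptime_conj[OF assms] by (simp add: prod_eq_iff)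

subsection \<open>Numbers from bit strings\<close>

definition of_bits :: "bool list \<Rightarrow> nat" where
  "of_bits bs = foldr (\<lambda>b n. of_bool b + 2 * n) bs 0"

lemma of_bits_simps [simp]: "of_bits [] = 0" "of_bits (b # bs) = of_bool b + 2 * of_bits bs"
  by (simp_all add: of_bits_def)

lemma bits_rec: "0 < m \<Longrightarrow> bits m = odd m # bits (m div 2)"
  by (cases m) simp_all

lemma bits_double: "0 < n \<or> b \<Longrightarrow> bits (of_bool b + 2 * n) = b # bits n"
  by (subst bits_rec) auto

lemma bits_of_bits: "bits (of_bits bs) = rev (dropWhile Not (rev bs))"
proof (induction bs)
  case (Cons b bs)
  show ?case
  proof (cases "of_bits bs = 0 \<and> \<not> b")
    case True
    then have "bits (of_bits bs) = []" by simp
    with Cons have "dropWhile Not (rev bs) = []" by simp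
    then show ?thesis using True by (simp add: dropWhile_append1 dropWhile_eq_Nil_conv dropWhile_append)
  next
    case False
    then have "bits (of_bits (b # bs)) = b # bits (of_bits bs)" by (metis bits_double of_bits_simps(2) neq0_conv)
    moreover have "dropWhile Not (rev bs @ [b]) = dropWhile Not (rev bs) @ [b]"
    proof (cases "b")
      case True
      then show ?thesis by (auto simp: dropWhile_append)
    next
      case b: False
      with False have "bits (of_bits bs) \<noteq> []" by (cases "of_bits bs") auto
      with Cons have "dropWhile Not (rev bs) \<noteq> []" by simp
      then show ?thesis by (simp add: dropWhile_append)
    qed
    ultimately show ?thesis using Cons by simp
  qed
qed simp

text \<open>A final \<open>True\<close> rules out leading zeros, which makes \<open>of_bits\<close>
  injective on such lists. The names of the knapsack items rely on this.\<close>

lemma bits_of_bits_snoc_True: "bits (of_bits (bs @ [True])) = bs @ [True]"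
  by (simp add: bits_of_bits)

text \<open>As numbers are stored as bits, the only work is to strip the zeros at the most
  significant end. The fold runs from that end and drops \<open>False\<close> as long as its
  accumulator is empty.\<close>

lemma ptime_of_bits [ptime_intros]: "ptime f \<Longrightarrow> ptime (\<lambda>x. of_bits (f x))"
proof (rule ptime_comp[of of_bits])
  define h :: "bool \<Rightarrow> bool list \<Rightarrow> bool list" where
    "h b acc = (if b then b # acc else (case acc of [] \<Rightarrow> [] | a # r \<Rightarrow> False # acc))" for b acc
  have h: "ptime (\<lambda>z. h (fst (snd z)) (snd (snd z)))" unfolding h_def by (intro ptime_intros)
  have "ptime (\<lambda>x. fold h (rev x) [])"
    by (rule ptime_fold[where g = "\<lambda>x a. 2"])
      (intro h ptime_rev ptime_intros pbounded_const | auto simp: h_def split: list.splits)+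
  moreover have "fold h (rev bs) [] = bits (of_bits bs)" for bs
  proof (induction bs)
    case (Cons b bs)
    have "of_bits bs = 0 \<longleftrightarrow> bits (of_bits bs) = []" by (cases "of_bits bs") auto
    then show ?case using Cons bits_double[of "of_bits bs" b] by (auto simp: h_def split: list.splits)
  qed simp
  moreover have "enc (bits n) = enc n" for n
    by (simp add: enc_list_def enc_nat_def enc_bool_eq[abs_def] enc_nat_eq)
  ultimately show "ptime of_bits" by (simp add: ptime_def)
qed

section \<open>Sparsification\<close>

definition units :: "'a set set \<Rightarrow> 'a set" where
  "units F = {l. {l} \<in> F}"

text \<open>The clauses in \<open>Z\<close> will be those of the input formula: the number of its 2-clauses containing
  a given literal is not bounded, hence they are not counted.\<close>

definition pairs :: "'a set set \<Rightarrow> 'a set set \<Rightarrow> 'a set set" where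
  "pairs Z F = {C \<in> F. card C = 2 \<and> C \<notin> Z}"

text \<open>Dropping the clauses subsumed by new ones keeps the family an antichain.\<close>

definition upd :: "'a set set \<Rightarrow> 'a set set \<Rightarrow> 'a set set" where
  "upd P F = P \<union> {D \<in> F. \<forall>C\<in>P. \<not> C \<subseteq> D}"

text \<open>Clauses sharing a heart \<open>H\<close> form a flower with these petals. An assignment
  satisfying all of them makes \<open>H\<close> true or every petal true, and this is the dichotomy
  on which the search branches.\<close>

definition petals :: "'a set \<Rightarrow> nat \<Rightarrow> 'a set set \<Rightarrow> 'a set set" where
  "petals H k F = (\<lambda>C. C - H) ` {C \<in> F. card C = k \<and> H \<subseteq> C}"

text \<open>\<open>Z\<close> stands for the input clauses and \<open>F\<close> for the current ones.
  Subsumption of \<open>Z\<close> makes every assignment satisfying \<open>F\<close> satisfy the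
  input; the degree condition limits how many counted 2-clauses a new unit clause can
  remove.\<close>

definition wf_fam :: "'a set \<Rightarrow> nat \<Rightarrow> 'a set set \<Rightarrow> 'a set set \<Rightarrow> bool" where
  "wf_fam L \<theta> Z F \<longleftrightarrow> (\<forall>C\<in>F. C \<subseteq> L \<and> C \<noteq> {} \<and> card C \<le> 3) \<and>
     (\<forall>C\<in>F. \<forall>D\<in>F. C \<subseteq> D \<longrightarrow> C = D) \<and> (\<forall>C\<in>Z. \<exists>D\<in>F. D \<subseteq> C) \<and>
     (\<forall>l. card {C \<in> pairs Z F. l \<in> C} \<le> 2 * \<theta>)"

text \<open>The potential decreases by at least \<open>\<alpha>\<close> with every new unit clause, although the unit clause
  may remove up to \<open>2 \<theta>\<close> counted 2-clauses, and by \<open>\<beta>\<close> with every new 2-clause.\<close>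

definition pot :: "real \<Rightarrow> real \<Rightarrow> 'a set \<Rightarrow> nat \<Rightarrow> 'a set set \<Rightarrow> 'a set set \<Rightarrow> real" where
  "pot \<alpha> \<beta> L \<theta> Z F = (\<alpha> + 2 * \<theta> * \<beta>) * (real (card L) - card (units F)) +
     \<beta> * (2 * \<theta> * card L - real (card (pairs Z F)))"

lemma wf_fam_antichain: "wf_fam L \<theta> Z F \<Longrightarrow> C \<in> F \<Longrightarrow> D \<in> F \<Longrightarrow> C \<subseteq> D \<Longrightarrow> C = D"
  by (simp add: wf_fam_def)

lemma finite_family: "wf_fam L \<theta> Z F \<Longrightarrow> finite L \<Longrightarrow> finite F"
  by (rule finite_subset[of _ "Pow L"]) (auto simp: wf_fam_def)

lemma card_le_degree_sum:
  assumes "finite L" "\<And>C. C \<in> T \<Longrightarrow> C \<subseteq> L \<and> C \<noteq> {}" "\<And>l. card {C \<in> T. l \<in> C} \<le> d"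
  shows "card T \<le> d * card L"
proof -
  have "finite T" by (rule finite_subset[of _ "Pow L"]) (use assms in auto)
  have "T \<subseteq> (\<Union>l\<in>L. {C \<in> T. l \<in> C})" using assms(2) by fastforce
  then have "card T \<le> card (\<Union>l\<in>L. {C \<in> T. l \<in> C})"
    by (rule card_mono[rotated]) (use assms(1) \<open>finite T\<close> in auto)
  also have "\<dots> \<le> (\<Sum>l\<in>L. card {C \<in> T. l \<in> C})" by (rule card_UN_le[OF assms(1)])
  also have "\<dots> \<le> (\<Sum>l\<in>L. d)" by (rule sum_mono) (rule assms(3))
  finally show ?thesis by (simp add: mult.commute)
qed

lemma card_units_le: "wf_fam L \<theta> Z F \<Longrightarrow> finite L \<Longrightarrow> card (units F) \<le> card L"
  by (rule card_mono) (auto simp: wf_fam_def units_def)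

text \<open>Both brackets of \<open>pot\<close> are nonnegative: units are elements of
  \<open>L\<close>, and the degree condition bounds the number of counted 2-clauses. Thus the weight
  of a formula is at least 1.\<close>

lemma pot_nonneg:
  assumes "wf_fam L \<theta> Z F" "finite L" "\<alpha> \<ge> 0" "\<beta> \<ge> 0"
  shows "pot \<alpha> \<beta> L \<theta> Z F \<ge> 0"
proof -
  have "card (pairs Z F) \<le> 2 * \<theta> * card L"
    by (rule card_le_degree_sum) (use assms in \<open>auto simp: wf_fam_def pairs_def\<close>)
  then have "real (card (pairs Z F)) \<le> 2 * \<theta> * card L" by (metis of_nat_le_iff of_nat_mult of_nat_numeral)
  moreover have "card (units F) \<le> card L" by (rule card_units_le) fact+
  ultimately show ?thesis using assms(3,4) unfolding pot_def
    by (intro add_nonneg_nonneg mult_nonneg_nonneg) auto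
qed

text \<open>Comparable clauses can only arise between new and old ones. A new clause inside an old
  one removes the latter, and \<open>new\<close> excludes the converse.\<close>

lemma wf_upd:
  assumes wf: "wf_fam L \<theta> Z F"
    and P: "\<And>C. C \<in> P \<Longrightarrow> C \<subseteq> L \<and> C \<noteq> {} \<and> card C \<le> 3"
    and new: "\<And>C D. C \<in> P \<Longrightarrow> D \<in> F \<Longrightarrow> \<not> D \<subseteq> C"
    and anti: "\<And>C D. C \<in> P \<Longrightarrow> D \<in> P \<Longrightarrow> C \<subseteq> D \<Longrightarrow> C = D"
    and deg: "\<And>l. card {C \<in> pairs Z (upd P F). l \<in> C} \<le> 2 * \<theta>"
  shows "wf_fam L \<theta> Z (upd P F)"
  unfolding wf_fam_def
proof (intro conjI)
  show "\<forall>C\<in>upd P F. C \<subseteq> L \<and> C \<noteq> {} \<and> card C \<le> 3"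
    using wf P by (auto simp: upd_def wf_fam_def)
  show "\<forall>C\<in>upd P F. \<forall>D\<in>upd P F. C \<subseteq> D \<longrightarrow> C = D"
  proof (intro ballI impI)
    fix C D assume "C \<in> upd P F" "D \<in> upd P F" "C \<subseteq> D"
    then show "C = D" unfolding upd_def
      by (elim UnE CollectE conjE) (meson anti new wf_fam_antichain[OF wf])+
  qed
  show "\<forall>C\<in>Z. \<exists>D\<in>upd P F. D \<subseteq> C"
  proof
    fix C assume "C \<in> Z"
    then obtain D where D: "D \<in> F" "D \<subseteq> C" using wf by (auto simp: wf_fam_def)
    show "\<exists>D\<in>upd P F. D \<subseteq> C"
    proof (cases "\<forall>E\<in>P. \<not> E \<subseteq> D")
      case True
      then show ?thesis using D by (auto simp: upd_def)
    next
      case False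
      then obtain E where "E \<in> P" "E \<subseteq> D" by auto
      with D show ?thesis unfolding upd_def by (meson UnI1 order_trans)
    qed
  qed
  show "\<forall>l. card {C \<in> pairs Z (upd P F). l \<in> C} \<le> 2 * \<theta>" using deg by simp
qed

section \<open>The effect of new clauses on the potential\<close>

lemma upd_units:
  assumes wf: "wf_fam L \<theta> Z F" and L: "finite L" and A: "A \<subseteq> L" "A \<inter> units F = {}" and \<beta>: "\<beta> \<ge> 0"
  shows "wf_fam L \<theta> Z (upd ((\<lambda>a. {a}) ` A) F)"
    and "pot \<alpha> \<beta> L \<theta> Z (upd ((\<lambda>a. {a}) ` A) F) \<le> pot \<alpha> \<beta> L \<theta> Z F - \<alpha> * card A"
proof -
  let ?F = "upd ((\<lambda>a. {a}) ` A) F"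
  have finF: "finite F" by (rule finite_family) fact+
  have finA: "finite A" using A(1) L by (rule finite_subset)
  have deg: "card {C \<in> pairs Z F. l \<in> C} \<le> 2 * \<theta>" for l using wf by (simp add: wf_fam_def)
  have sub: "pairs Z ?F \<subseteq> pairs Z F" by (auto simp: pairs_def upd_def)
  have finp: "finite (pairs Z F)" using finF by (simp add: pairs_def)
  show "wf_fam L \<theta> Z ?F"
  proof (rule wf_upd[OF wf])
    fix C D assume "C \<in> (\<lambda>a. {a}) ` A" "D \<in> F"
    moreover from this have "D \<noteq> {}" using wf by (auto simp: wf_fam_def)
    ultimately show "\<not> D \<subseteq> C" using A(2) by (auto simp: units_def subset_singleton_iff)
  next
    fix l
    have "card {C \<in> pairs Z ?F. l \<in> C} \<le> card {C \<in> pairs Z F. l \<in> C}"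
      by (rule card_mono) (use sub finp in auto)
    with deg[of l] show "card {C \<in> pairs Z ?F. l \<in> C} \<le> 2 * \<theta>" by simp
  qed (use A in auto)
  have "units ?F = A \<union> units F" by (auto simp: units_def upd_def)
  moreover have "finite (units F)"
    by (rule finite_subset[OF _ L]) (use wf in \<open>auto simp: wf_fam_def units_def\<close>)
  ultimately have u: "card (units ?F) = card A + card (units F)"
    using A(2) finA by (simp add: card_Un_disjoint)
  \<comment> \<open>Only counted 2-clauses through a new unit are lost, at most
    \<open>2 * \<theta>\<close> per unit. Their loss raises the potential by at most
    \<open>2 * \<theta> * \<beta>\<close>, so that \<open>\<alpha>\<close> remains of the
    coefficient \<open>\<alpha> + 2 * \<theta> * \<beta>\<close>.\<close>
  have "pairs Z F \<subseteq> pairs Z ?F \<union> (\<Union>a\<in>A. {C \<in> pairs Z F. a \<in> C})"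
    by (auto simp: pairs_def upd_def)
  then have "card (pairs Z F) \<le> card (pairs Z ?F \<union> (\<Union>a\<in>A. {C \<in> pairs Z F. a \<in> C}))"
    by (rule card_mono[rotated]) (use finp finite_subset[OF sub finp] finA in auto)
  also have "\<dots> \<le> card (pairs Z ?F) + card (\<Union>a\<in>A. {C \<in> pairs Z F. a \<in> C})" by (rule card_Un_le)
  also have "card (\<Union>a\<in>A. {C \<in> pairs Z F. a \<in> C}) \<le> (\<Sum>a\<in>A. card {C \<in> pairs Z F. a \<in> C})"
    by (rule card_UN_le[OF finA])
  also have "\<dots> \<le> (\<Sum>a\<in>A. 2 * \<theta>)" by (rule sum_mono) (rule deg)
  finally have "card (pairs Z F) \<le> card (pairs Z ?F) + 2 * \<theta> * card A" by (simp add: mult.commute)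
  then have "real (card (pairs Z F)) \<le> card (pairs Z ?F) + 2 * \<theta> * card A"
    by (metis of_nat_add of_nat_le_iff of_nat_mult of_nat_numeral)
  from mult_left_mono[OF this \<beta>] show "pot \<alpha> \<beta> L \<theta> Z ?F \<le> pot \<alpha> \<beta> L \<theta> Z F - \<alpha> * card A"
    unfolding pot_def u by (simp add: algebra_simps)
qed

text \<open>Distinct 2-sets are incomparable, so no counted 2-clause is lost and all of
  \<open>P\<close> is gained. Fewer than \<open>\<theta>\<close> old and at most
  \<open>\<theta>\<close> new 2-clauses contain a given literal, which explains the bound
  \<open>2 * \<theta>\<close> in \<open>wf_fam\<close>.\<close>

lemma upd_pairs:
  assumes wf: "wf_fam L \<theta> Z F" and L: "finite L"
    and P: "\<And>C. C \<in> P \<Longrightarrow> C \<subseteq> L \<and> card C = 2"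
    and new: "\<And>C D. C \<in> P \<Longrightarrow> D \<in> F \<Longrightarrow> \<not> D \<subseteq> C"
    and d1: "\<And>l. card {C \<in> F. card C = 2 \<and> {l} \<subseteq> C} < \<theta>"
    and d2: "\<And>l. card {C \<in> P. l \<in> C} \<le> \<theta>"
  shows "wf_fam L \<theta> Z (upd P F)"
    and "pot \<alpha> \<beta> L \<theta> Z (upd P F) = pot \<alpha> \<beta> L \<theta> Z F - \<beta> * card P"
proof -
  have finF: "finite F" by (rule finite_family) fact+
  have finP: "finite P" by (rule finite_subset[of _ "Pow L"]) (use P L in auto)
  have fin2: "finite C" if "card C = 2" for C :: "'a set"
    using that by (metis card.infinite zero_neq_numeral)
  \<comment> \<open>A clause of \<open>Z\<close> contains a member of \<open>F\<close>, contrary to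
    \<open>new\<close>. So the new 2-clauses are all counted although those of the input are
    exempt.\<close>
  have PO: "P \<inter> Z = {}" using new wf by (fastforce simp: wf_fam_def)
  have PF: "P \<inter> F = {}" using new by auto
  have eq: "C = D" if "C \<subseteq> D" "card C = 2" "card D = 2" for C D :: "'a set"
    using that by (metis card_subset_eq fin2)
  have *: "pairs Z (upd P F) = P \<union> pairs Z F"
    unfolding pairs_def upd_def using PO PF P by (auto dest: eq)
  show "wf_fam L \<theta> Z (upd P F)"
  proof (rule wf_upd[OF wf])
    fix l
    have "{C \<in> pairs Z (upd P F). l \<in> C} \<subseteq> {C \<in> P. l \<in> C} \<union> {C \<in> F. card C = 2 \<and> {l} \<subseteq> C}"
      unfolding * by (auto simp: pairs_def)
    then have "card {C \<in> pairs Z (upd P F). l \<in> C} \<le> card ({C \<in> P. l \<in> C} \<union> {C \<in> F. card C = 2 \<and> {l} \<subseteq> C})"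
      by (rule card_mono[rotated]) (use finF finP in auto)
    also have "\<dots> \<le> card {C \<in> P. l \<in> C} + card {C \<in> F. card C = 2 \<and> {l} \<subseteq> C}" by (rule card_Un_le)
    finally show "card {C \<in> pairs Z (upd P F). l \<in> C} \<le> 2 * \<theta>" using d1[of l] d2[of l] by simp
  next
    show "C \<subseteq> L \<and> C \<noteq> {} \<and> card C \<le> 3" if "C \<in> P" for C using P[OF that] by auto
    show "C = D" if "C \<in> P" "D \<in> P" "C \<subseteq> D" for C D
      using eq[OF that(3)] P[OF that(1)] P[OF that(2)] by simp
  qed (rule new)
  have "P \<inter> pairs Z F = {}" using PF by (auto simp: pairs_def)
  then have c: "card (pairs Z (upd P F)) = card P + card (pairs Z F)"
    unfolding * by (rule card_Un_disjoint[rotated 2]) (use finP finF in \<open>auto simp: pairs_def\<close>)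
  have "units (upd P F) = units F"
    using P by (fastforce simp: units_def upd_def subset_singleton_iff)
  then show "pot \<alpha> \<beta> L \<theta> Z (upd P F) = pot \<alpha> \<beta> L \<theta> Z F - \<beta> * card P"
    by (simp add: pot_def c algebra_simps)
qed

text \<open>A clause inside a petal would lie inside the clause from which the petal was cut, hence
  equal it by the antichain property; but the petal lacks \<open>H\<close>.\<close>

lemma petals_new:
  assumes "wf_fam L \<theta> Z F" "C \<in> petals H k F" "H \<noteq> {}" "D \<in> F"
  shows "\<not> D \<subseteq> C"
proof
  assume "D \<subseteq> C"
  from assms(2) obtain E where E: "E \<in> F" "H \<subseteq> E" "C = E - H" by (auto simp: petals_def)
  have "D = E" by (rule wf_fam_antichain[OF assms(1,4) E(1)]) (use E \<open>D \<subseteq> C\<close> in auto)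
  with E \<open>D \<subseteq> C\<close> assms(3) show False by auto
qed

lemma heart_new:
  assumes "wf_fam L \<theta> Z F" "E \<in> F" "H \<subset> E" "D \<in> F"
  shows "\<not> D \<subseteq> H"
proof
  assume "D \<subseteq> H"
  with assms(3) have "D = E" by (intro wf_fam_antichain[OF assms(1,4,2)]) auto
  with \<open>D \<subseteq> H\<close> assms(3) show False by auto
qed

lemma card_petals: "card (petals H k F) = card {C \<in> F. card C = k \<and> H \<subseteq> C}"
  unfolding petals_def by (rule card_image) (auto simp: inj_on_def)

text \<open>Clauses with exactly one literal outside the heart have singleton petals, so each petal
  is a new unit clause worth \<open>\<alpha>\<close>.\<close>

lemma branch_singles:
  assumes wf: "wf_fam L \<theta> Z F" and L: "finite L" and \<beta>: "\<beta> \<ge> 0" and H: "H \<noteq> {}"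
  shows "wf_fam L \<theta> Z (upd (petals H (Suc (card H)) F) F)"
    and "pot \<alpha> \<beta> L \<theta> Z (upd (petals H (Suc (card H)) F) F) \<le>
      pot \<alpha> \<beta> L \<theta> Z F - \<alpha> * card {C \<in> F. card C = Suc (card H) \<and> H \<subseteq> C}"
proof -
  let ?P = "petals H (Suc (card H)) F"
  define A where "A = {a. {a} \<in> ?P}"
  have FL: "C \<subseteq> L" if "C \<in> F" for C using wf that by (auto simp: wf_fam_def)
  have "\<exists>a. C = {a}" if "C \<in> ?P" for C
  proof -
    from that obtain E where E: "E \<in> F" "H \<subseteq> E" "C = E - H" "card E = Suc (card H)" by (auto simp: petals_def)
    then have "finite H" using FL L by (meson finite_subset)
    with E have "card C = 1" by (simp add: card_Diff_subset)
    then show ?thesis by (simp add: card_1_singleton_iff)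
  qed
  then have PA: "?P = (\<lambda>a. {a}) ` A" by (auto simp: A_def)
  have "A \<subseteq> L" using FL by (fastforce simp: A_def petals_def)
  moreover have "A \<inter> units F = {}" using petals_new[OF wf _ H] by (fastforce simp: A_def units_def)
  moreover have "card A = card ?P" unfolding PA by (simp add: card_image)
  ultimately show "wf_fam L \<theta> Z (upd ?P F)"
    "pot \<alpha> \<beta> L \<theta> Z (upd ?P F) \<le> pot \<alpha> \<beta> L \<theta> Z F - \<alpha> * card {C \<in> F. card C = Suc (card H) \<and> H \<subseteq> C}"
    using upd_units(1)[OF wf L _ _ \<beta>, of A] upd_units(2)[OF wf L _ _ \<beta>, of A \<alpha>]
    unfolding PA[symmetric] card_petals[symmetric] by auto
qed

lemma branch_heart_single:
  assumes wf: "wf_fam L \<theta> Z F" and L: "finite L" and \<beta>: "\<beta> \<ge> 0" and E: "E \<in> F" "{l} \<subset> E"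
  shows "wf_fam L \<theta> Z (upd {{l}} F)" "pot \<alpha> \<beta> L \<theta> Z (upd {{l}} F) \<le> pot \<alpha> \<beta> L \<theta> Z F - \<alpha>"
proof -
  have "{l} \<subseteq> L" "{l} \<inter> units F = {}"
    using heart_new[OF wf E, of "{l}"] E wf by (auto simp: wf_fam_def units_def)
  from upd_units(1)[OF wf L this \<beta>] upd_units(2)[OF wf L this \<beta>, of \<alpha>] show "wf_fam L \<theta> Z (upd {{l}} F)"
    "pot \<alpha> \<beta> L \<theta> Z (upd {{l}} F) \<le> pot \<alpha> \<beta> L \<theta> Z F - \<alpha>" by simp_all
qed

lemma branch_heart_pair:
  assumes wf: "wf_fam L \<theta> Z F" and L: "finite L" and E: "E \<in> F" "{l, m} \<subset> E" "l \<noteq> m"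
    and d1: "\<And>l. card {C \<in> F. card C = 2 \<and> {l} \<subseteq> C} < \<theta>"
  shows "wf_fam L \<theta> Z (upd {{l, m}} F)"
    "pot \<alpha> \<beta> L \<theta> Z (upd {{l, m}} F) \<le> pot \<alpha> \<beta> L \<theta> Z F - \<beta>"
proof -
  have "card {C \<in> {{l, m}}. x \<in> C} \<le> \<theta>" for x
  proof -
    have "card {C \<in> {{l, m}}. x \<in> C} \<le> card {{l, m}}" by (rule card_mono) auto
    with d1[of x] show ?thesis by simp
  qed
  moreover have "C \<subseteq> L \<and> card C = 2" if "C \<in> {{l, m}}" for C
    using that E wf by (auto simp: wf_fam_def)
  moreover have "\<not> D \<subseteq> C" if "C \<in> {{l, m}}" "D \<in> F" for C D
    using heart_new[OF wf E(1,2)] that by auto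
  ultimately show "wf_fam L \<theta> Z (upd {{l, m}} F)"
    "pot \<alpha> \<beta> L \<theta> Z (upd {{l, m}} F) \<le> pot \<alpha> \<beta> L \<theta> Z F - \<beta>"
    using upd_pairs(1)[OF wf L _ _ d1, of "{{l, m}}"] upd_pairs(2)[OF wf L _ _ d1, of "{{l, m}}" \<alpha> \<beta>] by auto
qed

lemma branch_pairs:
  assumes wf: "wf_fam L \<theta> Z F" and L: "finite L"
    and d1: "\<And>l. card {C \<in> F. card C = 2 \<and> {l} \<subseteq> C} < \<theta>"
    and d2: "\<And>l m. l \<noteq> m \<Longrightarrow> card {C \<in> F. card C = 3 \<and> {l, m} \<subseteq> C} < \<theta>"
  shows "wf_fam L \<theta> Z (upd (petals {l} 3 F) F)"
    and "pot \<alpha> \<beta> L \<theta> Z (upd (petals {l} 3 F) F) =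
      pot \<alpha> \<beta> L \<theta> Z F - \<beta> * card {C \<in> F. card C = 3 \<and> {l} \<subseteq> C}"
proof -
  let ?P = "petals {l} 3 F"
  have finF: "finite F" by (rule finite_family) fact+
  have P: "C \<subseteq> L \<and> card C = 2" if "C \<in> ?P" for C
  proof -
    from that obtain E where E: "E \<in> F" "l \<in> E" "C = E - {l}" "card E = 3" by (auto simp: petals_def)
    then have "E \<subseteq> L" using wf by (auto simp: wf_fam_def)
    with E show ?thesis by (auto simp: card_Diff_singleton)
  qed
  \<comment> \<open>A petal through \<open>m\<close> comes from a 3-clause containing both
    \<open>l\<close> and \<open>m\<close>. Few of these exist because flowers with two-literal
    hearts are already excluded by \<open>d2\<close>.\<close>
  have d: "card {C \<in> ?P. m \<in> C} \<le> \<theta>" for m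
  proof (cases "m = l")
    case True
    then have "{C \<in> ?P. m \<in> C} = {}" by (auto simp: petals_def)
    then show ?thesis by (metis card.empty zero_le)
  next
    case False
    have "{C \<in> ?P. m \<in> C} \<subseteq> (\<lambda>C. C - {l}) ` {C \<in> F. card C = 3 \<and> {l, m} \<subseteq> C}"
      by (auto simp: petals_def)
    then have "card {C \<in> ?P. m \<in> C} \<le> card ((\<lambda>C. C - {l}) ` {C \<in> F. card C = 3 \<and> {l, m} \<subseteq> C})"
      by (rule card_mono[rotated]) (use finF in auto)
    also have "\<dots> \<le> card {C \<in> F. card C = 3 \<and> {l, m} \<subseteq> C}" by (rule card_image_le) (use finF in auto)
    finally show ?thesis using d2[of l m] False by simp
  qed
  show "wf_fam L \<theta> Z (upd ?P F)" "pot \<alpha> \<beta> L \<theta> Z (upd ?P F) =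
      pot \<alpha> \<beta> L \<theta> Z F - \<beta> * card {C \<in> F. card C = 3 \<and> {l} \<subseteq> C}"
    using upd_pairs(1)[OF wf L P petals_new[OF wf] d1 d]
      upd_pairs(2)[where \<alpha> = \<alpha> and \<beta> = \<beta>, OF wf L P petals_new[OF wf] d1 d]
    by (auto simp: card_petals)
qed

lemma card_sparse_family:
  assumes wf: "wf_fam L \<theta> Z F" and L: "finite L"
    and d1: "\<And>l. card {C \<in> F. card C = 2 \<and> {l} \<subseteq> C} \<le> \<theta>1"
    and d2: "\<And>l. card {C \<in> F. card C = 3 \<and> {l} \<subseteq> C} \<le> \<theta>2"
  shows "card F \<le> (1 + \<theta>1 + \<theta>2) * card L"
proof -
  have finF: "finite F" by (rule finite_family) fact+
  have k: "card {C \<in> F. card C = k} \<le> d * card L"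
    if "\<And>l. card {C \<in> F. card C = k \<and> {l} \<subseteq> C} \<le> d" for k d
  proof (rule card_le_degree_sum[OF L])
    show "card {C \<in> {C \<in> F. card C = k}. l \<in> C} \<le> d" for l using that[of l] by (simp add: conj_assoc)
  qed (use wf in \<open>auto simp: wf_fam_def\<close>)
  have "{C \<in> F. card C = 1} = (\<lambda>l. {l}) ` units F" by (auto simp: units_def card_1_singleton_iff)
  then have "card {C \<in> F. card C = 1} = card (units F)" by (simp add: card_image)
  then have c1: "card {C \<in> F. card C = 1} \<le> card L" using card_units_le[OF wf L] by simp
  have fin: "finite C" if "C \<in> F" for C using wf that L by (meson finite_subset wf_fam_def)
  have "F \<subseteq> {C \<in> F. card C = 1} \<union> ({C \<in> F. card C = 2} \<union> {C \<in> F. card C = 3})"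
  proof
    fix C assume "C \<in> F"
    then have "card C \<noteq> 0" "card C \<le> 3" using wf fin by (auto simp: wf_fam_def)
    then have "card C = 1 \<or> card C = 2 \<or> card C = 3" by linarith
    with \<open>C \<in> F\<close> show "C \<in> {C \<in> F. card C = 1} \<union> ({C \<in> F. card C = 2} \<union> {C \<in> F. card C = 3})" by auto
  qed
  then have "card F \<le> card ({C \<in> F. card C = 1} \<union> ({C \<in> F. card C = 2} \<union> {C \<in> F. card C = 3}))"
    by (rule card_mono[rotated]) (use finF in auto)
  also have "\<dots> \<le> card {C \<in> F. card C = 1} + (card {C \<in> F. card C = 2} + card {C \<in> F. card C = 3})"
    by (meson card_Un_le add_left_mono order_trans)
  also have "\<dots> \<le> card L + (\<theta>1 * card L + \<theta>2 * card L)"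
    by (intro add_mono c1 k d1 d2)
  finally show ?thesis by (simp add: algebra_simps)
qed

text \<open>This crude bound holds at every node of the search, before any sparsity is reached, and
  keeps the formulas on the stack of polynomial size.\<close>

lemma card_family_le:
  assumes wf: "wf_fam L \<theta> Z F" and L: "finite L"
  shows "card F \<le> card L ^ 3"
proof -
  have "C \<in> (\<lambda>(a, b, c). {a, b, c}) ` (L \<times> L \<times> L)" if "C \<in> F" for C
  proof -
    have C: "C \<subseteq> L" "C \<noteq> {}" "card C \<le> 3" using wf that by (auto simp: wf_fam_def)
    then have "finite C" using L by (meson finite_subset)
    then have "card C \<noteq> 0" using C by auto
    then consider "card C = 1" | "card C = 2" | "card C = 3" using C(3) by linarith
    then have "\<exists>a b c. C = {a, b, c}"
    proof cases
      case 1 then show ?thesis by (auto simp: card_1_singleton_iff)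
    next
      case 2 then show ?thesis by (auto simp: card_2_iff)
    next
      case 3 then show ?thesis by (auto simp: card_3_iff)
    qed
    then obtain a b c where "C = {a, b, c}" by auto
    with C(1) have "C = (\<lambda>(a, b, c). {a, b, c}) (a, b, c)" "(a, b, c) \<in> L \<times> L \<times> L" by auto
    then show ?thesis by (rule image_eqI)
  qed
  then have "card F \<le> card ((\<lambda>(a, b, c). {a, b, c}) ` (L \<times> L \<times> L))"
    by (intro card_mono) (use L in auto)
  also have "\<dots> \<le> card (L \<times> L \<times> L)" by (rule card_image_le) (use L in auto)
  finally show ?thesis by (simp add: card_cartesian_product power3_eq_cube mult.assoc)
qed

subsection \<open>The branching step on lists of clauses\<close>

definition fam :: "'a list list \<Rightarrow> 'a set set" where
  "fam F = set ` set F"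

text \<open>No repetitions even up to reordering, so that lengths of lists can be used as
  cardinalities in the set-level analysis.\<close>

definition good :: "'a list list \<Rightarrow> bool" where
  "good F \<longleftrightarrow> distinct (map set F) \<and> (\<forall>C\<in>set F. distinct C)"

definition hits :: "('a \<Rightarrow> bool) \<Rightarrow> 'a list list \<Rightarrow> bool" where
  "hits a F \<longleftrightarrow> (\<forall>C\<in>set F. \<exists>l\<in>set C. a l)"

definition upd_list :: "'a list list \<Rightarrow> 'a list list \<Rightarrow> 'a list list" where
  "upd_list P F = P @ filter (\<lambda>D. \<forall>C\<in>set P. \<not> set C \<subseteq> set D) F"

definition petals_list :: "'a list \<Rightarrow> nat \<Rightarrow> 'a list list \<Rightarrow> 'a list list" where
  "petals_list H k F = map (filter (\<lambda>l. l \<notin> set H)) (filter (\<lambda>C. length C = k \<and> set H \<subseteq> set C) F)"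

definition flowers :: "nat \<Rightarrow> nat \<Rightarrow> 'a list list \<Rightarrow> 'a list list \<Rightarrow> ('a list \<times> 'a list list) list" where
  "flowers \<theta> k Hs F = filter (\<lambda>p. \<theta> \<le> length (snd p)) (map (\<lambda>H. (H, petals_list H k F)) Hs)"

definition single_hearts :: "'a list list \<Rightarrow> 'a list list" where
  "single_hearts F = map (\<lambda>l. [l]) (concat F)"

definition pair_hearts :: "'a list list \<Rightarrow> 'a list list" where
  "pair_hearts F = concat (map (\<lambda>l. map (\<lambda>m. [l, m]) (filter (\<lambda>m. l \<noteq> m) (concat F))) (concat F))"

text \<open>The order is a priority: the analysis of each kind of flower uses that there is none of
  the earlier kinds. Only the first flower is branched on; a formula without flowers is
  sparse.\<close>

definition all_flowers :: "nat \<Rightarrow> nat \<Rightarrow> 'a list list \<Rightarrow> ('a list \<times> 'a list list) list" where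
  "all_flowers \<theta>1 \<theta>2 F = flowers \<theta>1 2 (single_hearts F) F @ flowers \<theta>1 3 (pair_hearts F) F @
     flowers \<theta>2 3 (single_hearts F) F"

definition branch :: "nat \<Rightarrow> nat \<Rightarrow> 'a list list \<Rightarrow> 'a list list list" where
  "branch \<theta>1 \<theta>2 F = concat (map (\<lambda>p. [upd_list [fst p] F, upd_list (snd p) F]) (take 1 (all_flowers \<theta>1 \<theta>2 F)))"

lemma fam_upd_list: "fam (upd_list P F) = upd (fam P) (fam F)"
  by (auto simp: fam_def upd_list_def upd_def)

lemma card_set_good: "good F \<Longrightarrow> C \<in> set F \<Longrightarrow> card (set C) = length C"
  by (simp add: good_def distinct_card)

lemma fam_petals_list:
  assumes "good F" shows "fam (petals_list H k F) = petals (set H) k (fam F)"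
proof -
  have "set (filter (\<lambda>l. l \<notin> set H) C) = set C - set H" for C by auto
  moreover have "{C \<in> fam F. card C = k \<and> set H \<subseteq> C} = set ` {C \<in> set F. length C = k \<and> set H \<subseteq> set C}"
    using card_set_good[OF assms] by (auto simp: fam_def)
  ultimately show ?thesis
    by (simp add: fam_def[of "map _ _"] petals_list_def petals_def image_image)
qed

lemma length_petals_list:
  assumes "good F" shows "length (petals_list H k F) = card {C \<in> fam F. card C = k \<and> set H \<subseteq> C}"
proof -
  have "{C \<in> fam F. card C = k \<and> set H \<subseteq> C} = set (map set (filter (\<lambda>C. length C = k \<and> set H \<subseteq> set C) F))"
    using card_set_good[OF assms] by (auto simp: fam_def)
  moreover have "distinct (map set (filter (\<lambda>C. length C = k \<and> set H \<subseteq> set C) F))"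
    using assms by (simp add: good_def distinct_map_filter)
  ultimately show ?thesis by (simp add: petals_list_def distinct_card del: set_map)
qed

lemma card_fam: "good F \<Longrightarrow> card (fam F) = length F"
  using distinct_card[of "map set F"] by (simp add: good_def fam_def)

lemma good_upd_list: "good P \<Longrightarrow> good F \<Longrightarrow> good (upd_list P F)"
  by (auto simp: good_def upd_list_def distinct_map_filter)

lemma good_petals_list:
  assumes "good F" shows "good (petals_list H k F)"
  unfolding good_def
proof
  have "distinct (filter (\<lambda>C. length C = k \<and> set H \<subseteq> set C) F)"
    using assms by (auto simp: good_def distinct_map)
  moreover have "inj_on (\<lambda>C. set (filter (\<lambda>l. l \<notin> set H) C)) (set (filter (\<lambda>C. length C = k \<and> set H \<subseteq> set C) F))"
  proof (rule inj_onI)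
    fix C D assume *: "C \<in> set (filter (\<lambda>C. length C = k \<and> set H \<subseteq> set C) F)"
      "D \<in> set (filter (\<lambda>C. length C = k \<and> set H \<subseteq> set C) F)"
      "set (filter (\<lambda>l. l \<notin> set H) C) = set (filter (\<lambda>l. l \<notin> set H) D)"
    then have "set C = set D" by auto
    with * assms show "C = D" by (auto simp: good_def distinct_map inj_on_def)
  qed
  ultimately show "distinct (map set (petals_list H k F))"
    by (simp add: petals_list_def distinct_map comp_def)
  show "\<forall>C\<in>set (petals_list H k F). distinct C"
    using assms by (auto simp: petals_list_def good_def)
qed

text \<open>If no literal of the heart is true, the true literal of each clause of the flower lies
  in its petal. The converse direction is covered by the subsumption condition of
  \<open>wf_fam\<close>.\<close>

lemma hits_upd:
  assumes "hits a F"
  shows "hits a (upd_list [H] F) \<or> hits a (upd_list (petals_list H k F) F)"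
proof (cases "\<exists>l\<in>set H. a l")
  case True
  with assms show ?thesis by (auto simp: hits_def upd_list_def)
next
  case False
  then have "hits a (upd_list (petals_list H k F) F)"
    using assms by (fastforce simp: hits_def upd_list_def petals_list_def)
  then show ?thesis ..
qed

lemma single_petals_less:
  assumes "good F" "flowers \<theta> k (single_hearts F) F = []" "0 < \<theta>" "0 < k"
  shows "card {C \<in> fam F. card C = k \<and> {l} \<subseteq> C} < \<theta>"
proof (cases "l \<in> set (concat F)")
  case True
  then have "[l] \<in> set (single_hearts F)" by (simp add: single_hearts_def)
  then have "length (petals_list [l] k F) < \<theta>"
    using assms(2) by (auto simp: flowers_def filter_empty_conv not_le)
  then show ?thesis using length_petals_list[OF assms(1), of "[l]" k] by simp
next
  case False
  then have "{C \<in> fam F. card C = k \<and> {l} \<subseteq> C} = {}" by (auto simp: fam_def)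
  then show ?thesis using assms(3) by (metis card.empty)
qed

lemma pair_petals_less:
  assumes "good F" "flowers \<theta> 3 (pair_hearts F) F = []" "0 < \<theta>" "l \<noteq> m"
  shows "card {C \<in> fam F. card C = 3 \<and> {l, m} \<subseteq> C} < \<theta>"
proof (cases "l \<in> set (concat F) \<and> m \<in> set (concat F)")
  case True
  then have "[l, m] \<in> set (pair_hearts F)" using assms(4) unfolding pair_hearts_def by force
  then have "length (petals_list [l, m] 3 F) < \<theta>"
    using assms(2) by (auto simp: flowers_def filter_empty_conv not_le)
  then show ?thesis using length_petals_list[OF assms(1), of "[l, m]" 3] by simp
next
  case False
  then have "{C \<in> fam F. card C = 3 \<and> {l, m} \<subseteq> C} = {}" by (auto simp: fam_def)
  then show ?thesis using assms(3) by (metis card.empty)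
qed

lemma branch_eq:
  assumes "all_flowers \<theta>1 \<theta>2 F = p # ps"
  shows "branch \<theta>1 \<theta>2 F = [upd_list [fst p] F, upd_list (snd p) F]"
  using assms by (simp add: branch_def)

text \<open>The usual condition for a branching recurrence: decreases by \<open>x\<close> and
  \<open>y\<close> are affordable if \<open>exp (- x) + exp (- y) \<le> 1\<close>.\<close>

lemma exp_sum_le:
  fixes p :: real
  assumes "p1 \<le> p - x" "p2 \<le> p - y" "exp (- x) + exp (- y) \<le> 1"
  shows "exp p1 + exp p2 \<le> exp p"
proof -
  have "exp p1 + exp p2 \<le> exp (p - x) + exp (p - y)" using assms(1,2) by (intro add_mono) simp_all
  also have "\<dots> = exp p * (exp (- x) + exp (- y))"
    by (simp add: distrib_left exp_add[symmetric])
  also have "\<dots> \<le> exp p * 1" by (rule mult_left_mono) (use assms(3) in auto)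
  finally show ?thesis by simp
qed

text \<open>The inequalities \<open>num\<close> belong to the three kinds of flowers in their order
  of priority. The heart branch gains \<open>\<alpha>\<close>, \<open>\<beta>\<close> and
  \<open>\<alpha>\<close>, the petal branch at least \<open>\<alpha> * \<theta>1\<close>,
  \<open>\<alpha> * \<theta>1\<close> and \<open>\<beta> * \<theta>2\<close>: one heart clause
  against many petals.\<close>

theorem branch_cases:
  fixes \<alpha> \<beta> :: real
  assumes good: "good F" and wf: "wf_fam L \<theta>1 Z (fam F)" and L: "finite L"
    and pos: "0 < \<theta>1" "0 < \<theta>2" "0 \<le> \<alpha>" "0 \<le> \<beta>"
    and num: "exp (- \<alpha>) + exp (- (\<alpha> * \<theta>1)) \<le> 1" "exp (- \<beta>) + exp (- (\<alpha> * \<theta>1)) \<le> 1"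
      "exp (- \<alpha>) + exp (- (\<beta> * \<theta>2)) \<le> 1"
  obtains (leaf) "branch \<theta>1 \<theta>2 F = []" "length F \<le> (1 + \<theta>1 + \<theta>2) * card L"
  | (split) F1 F2 where "branch \<theta>1 \<theta>2 F = [F1, F2]"
      "good F1" "good F2" "wf_fam L \<theta>1 Z (fam F1)" "wf_fam L \<theta>1 Z (fam F2)"
      "exp (pot \<alpha> \<beta> L \<theta>1 Z (fam F1)) + exp (pot \<alpha> \<beta> L \<theta>1 Z (fam F2)) \<le> exp (pot \<alpha> \<beta> L \<theta>1 Z (fam F))"
      "\<And>a. hits a F \<Longrightarrow> hits a F1 \<or> hits a F2"
proof (cases "all_flowers \<theta>1 \<theta>2 F")
  case Nil
  have "card (fam F) \<le> (1 + \<theta>1 + \<theta>2) * card L"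
    by (rule card_sparse_family[OF wf L]; rule less_imp_le; rule single_petals_less[OF good])
      (use Nil pos in \<open>auto simp: all_flowers_def\<close>)
  then show ?thesis using Nil leaf card_fam[OF good] by (simp add: branch_def)
next
  case (Cons p ps)
  obtain H k \<theta> where p: "p = (H, petals_list H k F)" "\<theta> \<le> length (petals_list H k F)" and
    c: "(\<exists>l. H = [l] \<and> k = 2 \<and> \<theta> = \<theta>1) \<or>
      (\<exists>l m. l \<noteq> m \<and> H = [l, m] \<and> k = 3 \<and> \<theta> = \<theta>1 \<and> flowers \<theta>1 2 (single_hearts F) F = []) \<or>
      (\<exists>l. H = [l] \<and> k = 3 \<and> \<theta> = \<theta>2 \<and> flowers \<theta>1 2 (single_hearts F) F = [] \<and>
         flowers \<theta>1 3 (pair_hearts F) F = [])"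
  proof -
    consider "p \<in> set (flowers \<theta>1 2 (single_hearts F) F)"
      | "p \<in> set (flowers \<theta>1 3 (pair_hearts F) F)" "flowers \<theta>1 2 (single_hearts F) F = []"
      | "p \<in> set (flowers \<theta>2 3 (single_hearts F) F)" "flowers \<theta>1 2 (single_hearts F) F = []"
        "flowers \<theta>1 3 (pair_hearts F) F = []"
      using Cons unfolding all_flowers_def by (auto simp: append_eq_Cons_conv)
    then show ?thesis
    proof cases
      case 1
      then show ?thesis using that[of _ 2 \<theta>1] by (auto simp: flowers_def single_hearts_def)
    next
      case 2
      then show ?thesis using that[of _ 3 \<theta>1] by (auto simp: flowers_def pair_hearts_def)
    next
      case 3
      then show ?thesis using that[of _ 3 \<theta>2] by (auto simp: flowers_def single_hearts_def)
    qed
  qed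
  let ?F1 = "upd_list [H] F" and ?F2 = "upd_list (petals_list H k F) F"
  let ?pot = "\<lambda>F. pot \<alpha> \<beta> L \<theta>1 Z (fam F)"
  have eq: "branch \<theta>1 \<theta>2 F = [?F1, ?F2]" using branch_eq[OF Cons] p by simp
  have f1: "fam ?F1 = upd {set H} (fam F)" by (simp add: fam_upd_list) (simp add: fam_def)
  have f2: "fam ?F2 = upd (petals (set H) k (fam F)) (fam F)"
    by (simp add: fam_upd_list fam_petals_list[OF good])
  have card: "card {C \<in> fam F. card C = k \<and> set H \<subseteq> C} \<ge> \<theta>"
    using p(2) length_petals_list[OF good, of H k] by simp
  have "distinct H" using c by auto
  then have g1: "good ?F1" by (intro good_upd_list good) (simp add: good_def)
  have g2: "good ?F2" by (intro good_upd_list good good_petals_list)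
  have E: "\<exists>E\<in>fam F. set H \<subset> E" if "0 < \<theta>" "card (set H) < k"
  proof -
    have "{C \<in> fam F. card C = k \<and> set H \<subseteq> C} \<noteq> {}" using card \<open>0 < \<theta>\<close> by (metis card.empty not_le)
    with that(2) show ?thesis by blast
  qed
  have d1: "card {C \<in> fam F. card C = 2 \<and> {l} \<subseteq> C} < \<theta>1"
    if "flowers \<theta>1 2 (single_hearts F) F = []" for l
    by (rule single_petals_less[OF good that]) (use pos in auto)
  have d2: "card {C \<in> fam F. card C = 3 \<and> {l, m} \<subseteq> C} < \<theta>1"
    if "flowers \<theta>1 3 (pair_hearts F) F = []" "l \<noteq> m" for l m
    by (rule pair_petals_less[OF good that(1) _ that(2)]) (use pos in auto)
  from c have "wf_fam L \<theta>1 Z (fam ?F1) \<and> wf_fam L \<theta>1 Z (fam ?F2) \<and>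
    exp (?pot ?F1) + exp (?pot ?F2) \<le> exp (?pot F)"
  proof (elim disjE exE conjE)
    fix l assume *: "H = [l]" "k = 2" "\<theta> = \<theta>1"
    then obtain E where "E \<in> fam F" "{l} \<subset> E" using E pos by auto
    note 1 = branch_heart_single[OF wf L pos(4) this]
    note 2 = branch_singles[OF wf L pos(4), of "{l}"]
    have "\<alpha> * \<theta>1 \<le> \<alpha> * card {C \<in> fam F. card C = 2 \<and> {l} \<subseteq> C}"
      using card * pos(3) by (intro mult_left_mono) auto
    then have "?pot ?F2 \<le> ?pot F - \<alpha> * \<theta>1"
      using 2(2)[of \<alpha>] unfolding f2 using * by (simp add: numeral_2_eq_2)
    moreover have "?pot ?F1 \<le> ?pot F - \<alpha>" using 1(2)[of \<alpha>] unfolding f1 using * by simp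
    ultimately have "exp (?pot ?F1) + exp (?pot ?F2) \<le> exp (?pot F)"
      by (intro exp_sum_le[OF _ _ num(1)])
    then show ?thesis using 1(1) 2(1) * unfolding f1 f2 by (simp add: numeral_2_eq_2)
  next
    fix l m assume *: "l \<noteq> m" "H = [l, m]" "k = 3" "\<theta> = \<theta>1" "flowers \<theta>1 2 (single_hearts F) F = []"
    then obtain E where "E \<in> fam F" "{l, m} \<subset> E" using E pos by auto
    note 1 = branch_heart_pair[OF wf L this *(1) d1[OF *(5)]]
    note 2 = branch_singles[OF wf L pos(4), of "{l, m}"]
    have "\<alpha> * \<theta>1 \<le> \<alpha> * card {C \<in> fam F. card C = 3 \<and> {l, m} \<subseteq> C}"
      using card * pos(3) by (intro mult_left_mono) auto
    then have "?pot ?F2 \<le> ?pot F - \<alpha> * \<theta>1"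
      using 2(2)[of \<alpha>] unfolding f2 using * by (simp add: numeral_3_eq_3)
    moreover have "?pot ?F1 \<le> ?pot F - \<beta>" using 1(2)[of \<alpha> \<beta>] unfolding f1 using * by simp
    ultimately have "exp (?pot ?F1) + exp (?pot ?F2) \<le> exp (?pot F)"
      by (intro exp_sum_le[OF _ _ num(2)])
    then show ?thesis using 1(1) 2(1) * unfolding f1 f2 by (simp add: numeral_3_eq_3)
  next
    fix l assume *: "H = [l]" "k = 3" "\<theta> = \<theta>2" "flowers \<theta>1 2 (single_hearts F) F = []"
      "flowers \<theta>1 3 (pair_hearts F) F = []"
    then obtain E where "E \<in> fam F" "{l} \<subset> E" using E pos by auto
    note 1 = branch_heart_single[OF wf L pos(4) this]
    note 2 = branch_pairs(1)[OF wf L d1[OF *(4)] d2[OF *(5)], of l]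
      branch_pairs(2)[where l = l and \<alpha> = \<alpha> and \<beta> = \<beta>, OF wf L d1[OF *(4)] d2[OF *(5)]]
    have "\<beta> * \<theta>2 \<le> \<beta> * card {C \<in> fam F. card C = 3 \<and> {l} \<subseteq> C}"
      using card * pos(4) by (intro mult_left_mono) auto
    then have "?pot ?F2 \<le> ?pot F - \<beta> * \<theta>2"
      using 2(2) unfolding f2 using * by simp
    moreover have "?pot ?F1 \<le> ?pot F - \<alpha>" using 1(2)[of \<alpha>] unfolding f1 using * by simp
    ultimately have "exp (?pot ?F1) + exp (?pot ?F2) \<le> exp (?pot F)"
      by (intro exp_sum_le[OF _ _ num(3)])
    then show ?thesis using 1(1) 2(1) * unfolding f1 f2 by simp
  qed
  then show ?thesis using split[OF eq g1 g2] hits_upd[of _ F H k] by blast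
qed

lemma branching_parameters:
  fixes \<epsilon> :: real
  assumes "\<epsilon> > 0"
  obtains \<alpha> \<beta> :: real and \<theta>1 \<theta>2 :: nat where "0 < \<theta>1" "0 < \<theta>2" "0 \<le> \<alpha>" "0 \<le> \<beta>"
    "exp (- \<alpha>) + exp (- (\<alpha> * \<theta>1)) \<le> 1" "exp (- \<beta>) + exp (- (\<alpha> * \<theta>1)) \<le> 1"
    "exp (- \<alpha>) + exp (- (\<beta> * \<theta>2)) \<le> 1" "\<alpha> + 4 * \<theta>1 * \<beta> \<le> \<epsilon>"
proof -
  \<comment> \<open>The other half of \<open>\<epsilon>\<close> goes to
    \<open>4 * \<theta>1 * \<beta>\<close>, which the later choice of \<open>\<beta>\<close> makes
    equal to \<open>\<alpha>\<close>. The order of choices is \<open>\<alpha>\<close>,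
    \<open>\<theta>1\<close>, \<open>\<beta>\<close>, \<open>\<theta>2\<close>.\<close>
  define \<alpha> where "\<alpha> = \<epsilon> / 2"
  have \<alpha>: "0 < \<alpha>" using assms by (simp add: \<alpha>_def)
  have lim: "\<forall>\<^sub>F n in sequentially. exp (- (c * real n)) \<le> e" if "0 < c" "0 < e" for c e
  proof -
    have "((\<lambda>n. exp (- (c * real n))) \<longlongrightarrow> 0) sequentially"
      using that(1)
      by (intro filterlim_compose[OF exp_at_bot] filterlim_compose[OF filterlim_uminus_at_bot_at_top]
          filterlim_tendsto_pos_mult_at_top[OF tendsto_const] filterlim_real_sequentially)
    then have "\<forall>\<^sub>F n in sequentially. exp (- (c * real n)) < e" by (rule order_tendstoD(2)) fact
    then show ?thesis by eventually_elim simp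
  qed
  text \<open>Once \<open>\<beta> = \<alpha> / (4 \<theta>1)\<close>, the second condition reads \<open>exp (- \<alpha> \<theta>1) \<le> 1 - exp (- \<beta>)\<close>,
    where the right-hand side decays only like \<open>1 / \<theta>1\<close>.\<close>
  have lim2: "\<forall>\<^sub>F n in sequentially. exp (- (\<alpha> / (4 * real n))) + exp (- (\<alpha> * real n)) \<le> 1"
    using eventually_ge_at_top[of "nat \<lceil>8 / \<alpha> ^ 3\<rceil> + 1"]
  proof eventually_elim
    case (elim n)
    define x where "x = \<alpha> / (4 * real n)"
    have n: "0 < real n" "8 / \<alpha> ^ 3 \<le> real n" using elim by linarith+
    then have x: "0 < x" using \<alpha> by (simp add: x_def)
    have "1 + x \<le> exp x" by (rule exp_ge_add_one_self)
    then have "exp (- x) \<le> 1 / (1 + x)" using x by (simp add: exp_minus field_simps)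
    moreover have "exp (- (\<alpha> * real n)) \<le> x / (1 + x)"
    proof -
      \<comment> \<open>The threshold \<open>8 / \<alpha> ^ 3\<close> is what makes the quadratic
        Taylor term of \<open>exp (\<alpha> * n)\<close> exceed
        \<open>1 / x = 4 * n / \<alpha>\<close>.\<close>
      have "8 \<le> \<alpha> ^ 3 * real n" using n(2) \<alpha> by (simp add: field_simps)
      then have "4 * real n / \<alpha> \<le> (\<alpha> * real n)\<^sup>2 / 2"
        using \<alpha> n(1) by (simp add: field_simps power2_eq_square power3_eq_cube)
      moreover have "0 \<le> \<alpha> * real n" using \<alpha> by simp
      ultimately have "1 + 4 * real n / \<alpha> \<le> exp (\<alpha> * real n)"
        using exp_lower_Taylor_quadratic[of "\<alpha> * real n"] by linarith
      moreover have "1 + 4 * real n / \<alpha> = (1 + x) / x" using \<alpha> n(1) by (simp add: x_def field_simps)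
      ultimately have "(1 + x) / x \<le> exp (\<alpha> * real n)" by simp
      then show ?thesis using x by (simp add: exp_minus field_simps)
    qed
    ultimately have "exp (- x) + exp (- (\<alpha> * real n)) \<le> 1 / (1 + x) + x / (1 + x)" by (rule add_mono)
    also have "\<dots> = 1" using x by (simp add: add_divide_distrib[symmetric])
    finally show ?case by (simp add: x_def)
  qed
  have "\<forall>\<^sub>F n in sequentially. 0 < n \<and> exp (- (\<alpha> / (4 * real n))) + exp (- (\<alpha> * real n)) \<le> 1 \<and>
      exp (- (\<alpha> * real n)) \<le> 1 - exp (- \<alpha>)"
    by (intro eventually_conj lim2 lim eventually_gt_at_top) (use \<alpha> in auto)
  then obtain \<theta>1 :: nat where \<theta>1: "0 < \<theta>1" "exp (- (\<alpha> / (4 * real \<theta>1))) + exp (- (\<alpha> * real \<theta>1)) \<le> 1"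
    "exp (- (\<alpha> * real \<theta>1)) \<le> 1 - exp (- \<alpha>)"
    by (auto simp: eventually_sequentially)
  define \<beta> where "\<beta> = \<alpha> / (4 * real \<theta>1)"
  have \<beta>: "0 < \<beta>" using \<alpha> \<theta>1 by (simp add: \<beta>_def)
  have "\<forall>\<^sub>F n in sequentially. 0 < n \<and> exp (- (\<beta> * real n)) \<le> 1 - exp (- \<alpha>)"
    by (intro eventually_conj lim eventually_gt_at_top) (use \<alpha> \<beta> in auto)
  then obtain \<theta>2 :: nat where \<theta>2: "0 < \<theta>2" "exp (- (\<beta> * real \<theta>2)) \<le> 1 - exp (- \<alpha>)"
    by (auto simp: eventually_sequentially)
  show ?thesis
  proof (rule that[of \<theta>1 \<theta>2 \<alpha> \<beta>])
    have "4 * \<theta>1 * \<beta> = \<alpha>" using \<theta>1(1) by (simp add: \<beta>_def)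
    then show "\<alpha> + 4 * \<theta>1 * \<beta> \<le> \<epsilon>" by (simp add: \<alpha>_def)
  qed (use \<alpha> \<beta> \<theta>1 \<theta>2 in \<open>auto simp: \<beta>_def\<close>)
qed

subsection \<open>The branching step in polynomial time\<close>

type_synonym cnf = "literal list list"

lemma ptime_comp2:
  assumes "ptime (\<lambda>z. f (fst z) (snd z))" "ptime g" "ptime h"
  shows "ptime (\<lambda>x. f (g x) (h x))"
  using ptime_comp[OF assms(1) ptime_Pair[OF assms(2,3)]] by simp

lemma ptime_eq_literal [ptime_intros]: "ptime f \<Longrightarrow> ptime g \<Longrightarrow> ptime (\<lambda>x. f x = (g x :: literal))"
  by (rule ptime_eq_prod) (intro ptime_intros; assumption)+

lemma ptime_mem:
  fixes l :: "'x::enc \<Rightarrow> 'a::enc list"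
  assumes "ptime (\<lambda>z :: ('a \<times> 'a list) \<times> 'a. snd z = fst (fst z))" "ptime a" "ptime l"
  shows "ptime (\<lambda>x. a x \<in> set (l x))"
proof (rule ptime_comp2[OF _ assms(2,3)])
  have "ptime (\<lambda>z. \<exists>m\<in>set (snd z). m = (fst z :: 'a))"
    by (intro ptime_ex assms(1) ptime_snd ptime_id)
  then show "ptime (\<lambda>z. (fst z :: 'a) \<in> set (snd z))" by (rule ptime_cong) auto
qed

lemma ptime_mem_literal [ptime_intros]:
  "ptime a \<Longrightarrow> ptime l \<Longrightarrow> ptime (\<lambda>x. (a x :: literal) \<in> set (l x))"
  by (rule ptime_mem) (intro ptime_intros | assumption)+

lemma ptime_mem_nat [ptime_intros]: "ptime a \<Longrightarrow> ptime l \<Longrightarrow> ptime (\<lambda>x. (a x :: nat) \<in> set (l x))"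
  by (rule ptime_mem) (intro ptime_intros | assumption)+

lemma ptime_subset [ptime_intros]:
  assumes "ptime k" "ptime l" shows "ptime (\<lambda>x. set (k x :: literal list) \<subseteq> set (l x))"
proof (rule ptime_comp2[OF _ assms])
  have "ptime (\<lambda>z. \<forall>m\<in>set (fst z). (m :: literal) \<in> set (snd z))" by (intro ptime_intros)
  then show "ptime (\<lambda>z. set (fst z :: literal list) \<subseteq> set (snd z))" by (rule ptime_cong) auto
qed

lemma ptime_upd_list [ptime_intros]:
  assumes "ptime P" "ptime F" shows "ptime (\<lambda>x. upd_list (P x :: cnf) (F x))"
  by (rule ptime_comp2[OF _ assms]) (unfold upd_list_def, intro ptime_intros)

lemma ptime_petals_list [ptime_intros]:
  assumes "ptime H" "ptime F" shows "ptime (\<lambda>x. petals_list (H x :: literal list) k (F x))"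
  by (rule ptime_comp2[OF _ assms]) (unfold petals_list_def, intro ptime_intros)

lemma ptime_flowers [ptime_intros]:
  assumes "ptime Hs" "ptime F" shows "ptime (\<lambda>x. flowers \<theta> k (Hs x :: cnf) (F x))"
  by (rule ptime_comp2[OF _ assms]) (unfold flowers_def, intro ptime_intros)

lemma ptime_branch: "ptime (branch \<theta>1 \<theta>2 :: cnf \<Rightarrow> _)"
proof -
  have 1: "ptime (\<lambda>F :: cnf. single_hearts F)"
    unfolding single_hearts_def by (intro ptime_intros)
  have 2: "ptime (\<lambda>F :: cnf. pair_hearts F)"
    unfolding pair_hearts_def by (intro ptime_intros)
  have 3: "ptime (\<lambda>F :: cnf. all_flowers \<theta>1 \<theta>2 F)"
    unfolding all_flowers_def by (intro ptime_append ptime_flowers 1 2 ptime_id)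
  have "ptime (\<lambda>F :: cnf. branch \<theta>1 \<theta>2 F)"
    unfolding branch_def by (intro ptime_intros ptime_take_1 3)
  then show ?thesis .
qed

section \<open>The initial family: minimal clauses of the input, without repetitions\<close>

definition dedup :: "'a list \<Rightarrow> 'a list" where
  "dedup xs = fold (\<lambda>x acc. if x \<in> set acc then acc else x # acc) xs []"

lemma dedup_aux:
  "distinct acc \<Longrightarrow> distinct (fold (\<lambda>x acc. if x \<in> set acc then acc else x # acc) xs acc) \<and>
    set (fold (\<lambda>x acc. if x \<in> set acc then acc else x # acc) xs acc) = set xs \<union> set acc"
  by (induction xs arbitrary: acc) auto

lemma distinct_dedup [simp]: "distinct (dedup xs)" and set_dedup [simp]: "set (dedup xs) = set xs"
  using dedup_aux[of "[]" xs] by (simp_all add: dedup_def)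

lemma ptime_dedup:
  assumes "ptime (\<lambda>z :: 'a list \<times> 'a \<times> 'a list. fst (snd z) \<in> set (snd (snd z)))" "ptime l"
  shows "ptime (\<lambda>x. dedup (l x :: 'a::enc list))"
  unfolding dedup_def
  by (rule ptime_comp[OF _ assms(2)], rule ptime_fold[where g = "\<lambda>x a. esize a + 1"])
    (intro assms ptime_intros ptime_size pbounded_add pbounded_const | simp)+

lemma ptime_dedup_literal [ptime_intros]: "ptime l \<Longrightarrow> ptime (\<lambda>x. dedup (l x :: literal list))"
  by (rule ptime_dedup) (intro ptime_intros | assumption)+

lemma ptime_dedup_nat [ptime_intros]: "ptime l \<Longrightarrow> ptime (\<lambda>x. dedup (l x :: nat list))"
  by (rule ptime_dedup) (intro ptime_intros | assumption)+

definition insert_clause :: "'a list \<Rightarrow> 'a list list \<Rightarrow> 'a list list" where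
  "insert_clause C F = (if \<exists>D\<in>set F. set D \<subseteq> set C then F else upd_list [C] F)"

definition init_family :: "'a list list \<Rightarrow> 'a list list" where
  "init_family Cs = fold insert_clause (map dedup Cs) []"

lemma size_enc_filter_le: "esize (filter p xs) \<le> esize xs"
  by (induction xs) auto

lemma ptime_init_family: "ptime (init_family :: cnf \<Rightarrow> _)"
proof -
  have "ptime (\<lambda>z. insert_clause (fst (snd z)) (snd (snd z) :: cnf))"
    unfolding insert_clause_def by (intro ptime_intros)
  moreover have "esize (insert_clause C F) \<le> esize F + (esize C + 1)" for C and F :: "cnf"
    using size_enc_filter_le[of _ F] by (simp add: insert_clause_def upd_list_def)
  ultimately have "ptime (\<lambda>Cs :: cnf. fold insert_clause (map dedup Cs) [])"
    by (intro ptime_fold[where g = "\<lambda>x a. esize a + 1"])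
      (intro ptime_intros ptime_size pbounded_add pbounded_const | simp)+
  then show ?thesis by (simp add: init_family_def[abs_def])
qed

definition antichain :: "'a set set \<Rightarrow> bool" where
  "antichain A \<longleftrightarrow> (\<forall>C\<in>A. \<forall>D\<in>A. C \<subseteq> D \<longrightarrow> C = D)"

lemma init_family_aux:
  assumes "good F" "antichain (fam F)" "\<forall>C\<in>set Cs. distinct C"
  shows "good (fold insert_clause Cs F) \<and> antichain (fam (fold insert_clause Cs F)) \<and>
    fam (fold insert_clause Cs F) \<subseteq> fam Cs \<union> fam F \<and>
    (\<forall>C\<in>fam Cs \<union> fam F. \<exists>D\<in>fam (fold insert_clause Cs F). D \<subseteq> C)"
  using assms
proof (induction Cs arbitrary: F)
  case Nil
  then show ?case by (auto simp: fam_def)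
next
  case (Cons C Cs)
  let ?F = "insert_clause C F"
  let ?G = "fold insert_clause Cs ?F"
  have f: "fam ?F = (if \<exists>D\<in>fam F. D \<subseteq> set C then fam F else upd {set C} (fam F))"
    using fam_upd_list[of "[C]" F] by (auto simp: insert_clause_def fam_def)
  have 1: "good ?F"
    using Cons.prems(1,3) good_upd_list[of "[C]" F] by (auto simp: insert_clause_def good_def)
  have 2: "antichain (fam ?F)"
    using Cons.prems(2) unfolding f upd_def antichain_def by (auto split: if_splits)
  have 3: "fam ?F \<subseteq> insert (set C) (fam F)" unfolding f upd_def by auto
  have 4: "\<exists>E\<in>fam ?F. E \<subseteq> D" if "D \<in> insert (set C) (fam F)" for D
    using that unfolding f upd_def by (auto split: if_splits)
  have C: "fam (C # Cs) = insert (set C) (fam Cs)" by (simp add: fam_def)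
  have IH: "good ?G" "antichain (fam ?G)" "fam ?G \<subseteq> fam Cs \<union> fam ?F"
    "\<And>E. E \<in> fam Cs \<union> fam ?F \<Longrightarrow> \<exists>D\<in>fam ?G. D \<subseteq> E"
    using Cons.IH[OF 1 2] Cons.prems(3) by simp_all
  have "\<exists>D\<in>fam ?G. D \<subseteq> E" if E: "E \<in> insert (set C) (fam F)" for E
  proof -
    obtain D where "D \<in> fam ?F" "D \<subseteq> E" using 4[OF E] by auto
    with IH(4)[of D] show ?thesis by (meson UnI2 order_trans)
  qed
  then have "\<forall>E\<in>fam (C # Cs) \<union> fam F. \<exists>D\<in>fam ?G. D \<subseteq> E" using IH(4) unfolding C by blast
  moreover have "fam ?G \<subseteq> fam (C # Cs) \<union> fam F" using IH(3) 3 unfolding C by blast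
  ultimately show ?case using IH(1,2) by simp
qed

lemma
  shows good_init_family: "good (init_family Cs)"
    and antichain_init_family: "antichain (fam (init_family Cs))"
    and init_family_subset: "fam (init_family Cs) \<subseteq> fam Cs"
    and init_family_subsumes: "\<forall>C\<in>fam Cs. \<exists>D\<in>fam (init_family Cs). D \<subseteq> C"
proof -
  have "good ([] :: 'a list list)" "fam ([] :: 'a list list) = {}" by (simp_all add: good_def fam_def)
  moreover have "fam (map dedup Cs) = fam Cs" by (auto simp: fam_def image_image)
  ultimately have "good (init_family Cs) \<and> antichain (fam (init_family Cs)) \<and>
    fam (init_family Cs) \<subseteq> fam Cs \<and> (\<forall>C\<in>fam Cs. \<exists>D\<in>fam (init_family Cs). D \<subseteq> C)"
    using init_family_aux[of "[]" "map dedup Cs"] by (simp add: init_family_def antichain_def)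
  then show "good (init_family Cs)" "antichain (fam (init_family Cs))"
    "fam (init_family Cs) \<subseteq> fam Cs" "\<forall>C\<in>fam Cs. \<exists>D\<in>fam (init_family Cs). D \<subseteq> C" by simp_all
qed

text \<open>The degree condition holds vacuously: every 2-clause at the start is an input clause and
  therefore not counted.\<close>

lemma wf_init_family:
  assumes "\<And>C. C \<in> set Cs \<Longrightarrow> C \<noteq> [] \<and> set C \<subseteq> L \<and> length C \<le> 3"
  shows "wf_fam L \<theta> (fam Cs) (fam (init_family Cs))"
  unfolding wf_fam_def antichain_def[symmetric]
proof (intro conjI ballI allI)
  fix C assume "C \<in> fam (init_family Cs)"
  then have "C \<in> fam Cs" using init_family_subset by (rule subsetD[rotated])
  then obtain D where D: "D \<in> set Cs" "C = set D" by (auto simp: fam_def)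
  note * = assms[OF D(1)]
  show "C \<subseteq> L" "C \<noteq> {}" using * D(2) by auto
  show "card C \<le> 3" using * card_length[of D] unfolding D(2) by linarith
next
  fix l
  have "pairs (fam Cs) (fam (init_family Cs)) = {}"
    using init_family_subset[of Cs] by (auto simp: pairs_def)
  then show "card {C \<in> pairs (fam Cs) (fam (init_family Cs)). l \<in> C} \<le> 2 * \<theta>" by simp
next
  fix C assume "C \<in> fam Cs"
  then show "\<exists>D\<in>fam (init_family Cs). D \<subseteq> C" using init_family_subsumes[of Cs] by blast
qed (rule antichain_init_family)

lemma hits_fam: "hits a F \<longleftrightarrow> (\<forall>C\<in>fam F. \<exists>l\<in>C. a l)"
  by (simp add: hits_def fam_def)

lemma hits_init_family:
  assumes "hits a Cs" shows "hits a (init_family Cs)"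
  unfolding hits_fam
proof
  fix C assume "C \<in> fam (init_family Cs)"
  then have "C \<in> fam Cs" using init_family_subset by (rule subsetD[rotated])
  with assms show "\<exists>l\<in>C. a l" by (simp add: hits_fam)
qed

text \<open>Justifies checking an assignment obtained at a leaf against the input formula.\<close>

lemma hits_subsumed:
  assumes "wf_fam L \<theta> (fam Cs) (fam F)" "hits a F" shows "hits a Cs"
  unfolding hits_fam
proof
  fix C assume "C \<in> fam Cs"
  then obtain D where D: "D \<in> fam F" "D \<subseteq> C" using assms(1) unfolding wf_fam_def by (elim conjE) auto
  then obtain l where "l \<in> D" "a l" using assms(2) by (auto simp: hits_fam)
  with D show "\<exists>l\<in>C. a l" by auto
qed

section \<open>Encoding sizes in terms of the number of variables\<close>

lemma size_enc_list_le: "(\<And>x. x \<in> set xs \<Longrightarrow> esize x \<le> b) \<Longrightarrow> esize xs \<le> length xs * (b + 1)"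
proof (induction xs)
  case (Cons x xs)
  then have "esize xs \<le> length xs * (b + 1)" "esize x \<le> b" by auto
  then show ?case by simp
qed simp

lemma length_bits_le: "length (bits n) \<le> n"
  by (induction n rule: bits.induct) auto

lemma enc_bits: "enc (bits n) = enc n"
  by (simp add: enc_list_def enc_nat_def enc_bool_eq[abs_def] enc_nat_eq)

lemma size_enc_bool_le: "esize (b :: bool) \<le> 1"
  by (cases b) auto

lemma size_enc_nat_le: "esize (n :: nat) \<le> 2 * n"
proof -
  have "esize (bits n) \<le> length (bits n) * (1 + 1)"
    by (rule size_enc_list_le) (rule size_enc_bool_le)
  with length_bits_le[of n] show ?thesis by (simp add: enc_bits)
qed

lemma size_enc_clauses_le:
  assumes "\<And>C. C \<in> set F \<Longrightarrow> set C \<subseteq> {..<N} \<times> UNIV \<and> length C \<le> 3"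
  shows "esize (F :: cnf) \<le> length F * (6 * N + 10)"
proof -
  have "esize C \<le> 6 * N + 9" if C: "C \<in> set F" for C
  proof -
    have "esize C \<le> length C * (2 * N + 2 + 1)"
    proof (rule size_enc_list_le)
      fix l assume "l \<in> set C"
      then have "fst l < N" using assms[OF C] by auto
      then show "esize l \<le> 2 * N + 2"
        using size_enc_nat_le[of "fst l"] size_enc_bool_le[of "snd l"] by (simp add: enc_prod_def)
    qed
    also have "\<dots> \<le> 3 * (2 * N + 2 + 1)" by (rule mult_right_mono) (use assms[OF C] in auto)
    finally show ?thesis by simp
  qed
  from size_enc_list_le[of F "6 * N + 9", OF this] show ?thesis by (simp add: add.commute)
qed

text \<open>The bound depends on \<open>N\<close> only, not on the depth in the search tree, so all
  iterations of the search share one time bound.\<close>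

lemma size_enc_family_le:
  assumes "good F" "wf_fam ({..<N} \<times> UNIV) \<theta> Z (fam F)"
  shows "esize (F :: cnf) \<le> (2 * N) ^ 3 * (6 * N + 10)"
proof -
  have "set C \<subseteq> {..<N} \<times> UNIV \<and> length C \<le> 3" if "C \<in> set F" for C
    using that assms by (auto simp: wf_fam_def fam_def good_def distinct_card)
  then have "esize F \<le> length F * (6 * N + 10)" by (rule size_enc_clauses_le)
  also have "\<dots> \<le> (2 * N) ^ 3 * (6 * N + 10)"
    using card_family_le[OF assms(2)] card_fam[OF assms(1)]
    by (intro mult_mono) (simp_all add: card_cartesian_product mult.commute)
  finally show ?thesis .
qed

section \<open>From sparse formulas to knapsack\<close>

subsection \<open>Distributing columns over the dimensions\<close>

text \<open>Round robin by rotating the queues: the program needs no arithmetic on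
  positions.\<close>

definition deal_step :: "'a \<Rightarrow> 'a list list \<Rightarrow> 'a list list" where
  "deal_step x qs = (case qs of [] \<Rightarrow> [] | q # r \<Rightarrow> r @ [x # q])"

definition deal :: "nat \<Rightarrow> 'a list \<Rightarrow> 'a list list" where
  "deal d xs = fold deal_step xs (replicate d [])"

lemma deal_step_simps [simp]: "deal_step x [] = []" "deal_step x (q # r) = r @ [x # q]"
  by (simp_all add: deal_step_def)

lemma deal_step_not_Nil: "qs \<noteq> [] \<Longrightarrow> deal_step x qs \<noteq> []"
  by (cases qs) simp_all

lemma length_fold_deal [simp]: "length (fold deal_step xs qs) = length qs"
proof (induction xs arbitrary: qs)
  case (Cons x xs)
  then show ?case by (cases qs) simp_all
qed simp

lemma length_deal [simp]: "length (deal d xs) = d"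
  by (simp add: deal_def)

text \<open>Dealing ignores the entries. The digits of all items and of the budgets are thus
  distributed in the same way, namely as the abstract columns are.\<close>

lemma deal_map: "deal d (map f xs) = map (map f) (deal d xs)"
proof -
  have "fold deal_step (map f xs) (map (map f) qs) = map (map f) (fold deal_step xs qs)" for qs
  proof (induction xs arbitrary: qs)
    case (Cons x xs)
    have "deal_step (f x) (map (map f) qs) = map (map f) (deal_step x qs)" by (cases qs) simp_all
    then show ?case by (simp add: Cons.IH)
  qed simp
  from this[of "replicate d []"] show ?thesis by (simp add: deal_def)
qed

lemma set_deal: "0 < d \<Longrightarrow> set (concat (deal d xs)) = set xs"
proof -
  have "qs \<noteq> [] \<Longrightarrow> set (concat (fold deal_step xs qs)) = set xs \<union> set (concat qs)" for qs
  proof (induction xs arbitrary: qs)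
    case (Cons x xs)
    have "set (concat (deal_step x qs)) = insert x (set (concat qs))"
      using Cons.prems by (cases qs) auto
    with Cons.IH[OF deal_step_not_Nil[OF Cons.prems]] show ?case by simp
  qed simp
  from this[of "replicate d []"] show "0 < d \<Longrightarrow> ?thesis" by (auto simp: deal_def)
qed

text \<open>The queue lengths stay sorted and differ by at most one.\<close>

lemma length_deal_le:
  assumes "q \<in> set (deal d xs)" shows "length q \<le> length xs div d + 1"
proof -
  define I where "I qs \<longleftrightarrow> sorted (map length qs) \<and> (\<forall>p\<in>set qs. \<forall>q\<in>set qs. length p \<le> length q + 1)"
    for qs :: "'a list list"
  have I: "I (fold deal_step xs qs)" if "I qs" for qs
    using that
  proof (induction xs arbitrary: qs)
    case (Cons x xs)
    have "I (deal_step x qs)" using Cons.prems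
      by (cases qs) (fastforce simp: I_def deal_step_def sorted_append)+
    then show ?case using Cons.IH by simp
  qed simp
  have s: "sum_list (map length (fold deal_step xs qs)) = length xs + sum_list (map length qs)" if "qs \<noteq> []" for qs
    using that
  proof (induction xs arbitrary: qs)
    case (Cons x xs)
    have "sum_list (map length (deal_step x qs)) = Suc (sum_list (map length qs))"
      using Cons.prems by (cases qs) auto
    with Cons.IH[OF deal_step_not_Nil[OF Cons.prems]] show ?case by simp
  qed simp
  have d: "0 < d" using length_pos_if_in_set[OF assms] by simp
  have "I (deal d xs)" unfolding deal_def by (rule I) (simp add: I_def)
  then have "length q - 1 \<le> length p" if "p \<in> set (deal d xs)" for p
    using assms that by (fastforce simp: I_def)
  then have "sum_list (map (\<lambda>_. length q - 1) (deal d xs)) \<le> sum_list (map length (deal d xs))"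
    by (intro sum_list_mono) auto
  also have "\<dots> = length xs" using s[of "replicate d []"] d by (simp add: deal_def sum_list_replicate)
  finally have "d * (length q - 1) \<le> length xs" by (simp add: sum_list_triv)
  then have "length q - 1 \<le> length xs div d" using d by (simp add: less_eq_div_iff_mult_less_eq mult.commute)
  then show ?thesis by simp
qed

lemma ptime_deal [ptime_intros]: "ptime l \<Longrightarrow> ptime (\<lambda>x. deal d (l x))"
proof (rule ptime_comp[of "deal d"])
  have "ptime (\<lambda>z :: 'b list \<times> 'b \<times> 'b list list. deal_step (fst (snd z)) (snd (snd z)))"
    unfolding deal_step_def by (intro ptime_intros)
  moreover have "esize (deal_step a qs) \<le> esize qs + (esize a + 1)" for a :: 'b and qs
    by (cases qs) (auto simp: size_enc_append)
  ultimately have "ptime (\<lambda>xs :: 'b list. fold deal_step xs (replicate d []))"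
    by (intro ptime_fold[where g = "\<lambda>x a. esize a + 1"])
      (intro ptime_intros ptime_size pbounded_add pbounded_const | simp)+
  then show "ptime (deal d :: 'b list \<Rightarrow> _)" by (simp add: deal_def[abs_def])
qed

subsection \<open>Numbers in base 8\<close>

fun nval :: "nat list \<Rightarrow> nat" where
  "nval [] = 0"
| "nval (x # xs) = x + 8 * nval xs"

lemma nval_append: "nval (xs @ ys) = nval xs + 8 ^ length xs * nval ys"
  by (induction xs) (auto simp: algebra_simps)

text \<open>\<open>nval\<close> is linear and admits digits of any size. Sums of items are therefore
  values of column totals, and the absence of carries matters only in
  \<open>nval_inj\<close>.\<close>

lemma nval_sum: "(\<Sum>i\<in>S. nval (map (f i) cs)) = nval (map (\<lambda>c. \<Sum>i\<in>S. f i c) cs)"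
  by (induction cs) (simp_all add: sum.distrib sum_distrib_left[symmetric])

lemma nval_less: "(\<And>x. x \<in> set xs \<Longrightarrow> x < 8) \<Longrightarrow> nval xs < 8 ^ length xs"
proof (induction xs)
  case (Cons x xs)
  then have "nval xs < 8 ^ length xs" "x < 8" by auto
  then show ?case by simp
qed simp

lemma nval_inj:
  "nval (map f cs) = nval (map g cs) \<Longrightarrow> (\<And>c. c \<in> set cs \<Longrightarrow> f c < 8 \<and> g c < 8) \<Longrightarrow> c \<in> set cs \<Longrightarrow> f c = g c"
proof (induction cs)
  case (Cons b cs)
  have "f b < 8" "g b < 8" using Cons.prems(2) by auto
  moreover have "f b + 8 * nval (map f cs) = g b + 8 * nval (map g cs)" using Cons.prems(1) by simp
  ultimately have "f b = g b \<and> nval (map f cs) = nval (map g cs)" by presburger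
  with Cons show ?case by auto
qed simp

text \<open>A block is weighted by a power of 8 that depends only on the lengths of the blocks
  before it, and these agree on both sides.\<close>

lemma nval_concat_mono:
  "(\<And>q. q \<in> set Q \<Longrightarrow> nval (map f q) \<le> nval (map g q)) \<Longrightarrow> nval (map f (concat Q)) \<le> nval (map g (concat Q))"
  by (induction Q) (auto simp: nval_append intro!: add_mono)

text \<open>Three bits per digit, the highest being 0. Base 8 turns writing down a number into
  concatenating bits.\<close>

definition number :: "(bool \<times> bool) list \<Rightarrow> nat" where
  "number ds = of_bits (concat (map (\<lambda>p. [fst p, snd p, False]) ds))"

lemma number_eq: "number ds = nval (map (\<lambda>p. of_bool (fst p) + 2 * of_bool (snd p)) ds)"
  by (induction ds) (auto simp: number_def)

lemma ptime_number [ptime_intros]: "ptime l \<Longrightarrow> ptime (\<lambda>x. number (l x))"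
  by (rule ptime_comp[of number]) (unfold number_def, intro ptime_intros)

subsection \<open>The instance\<close>

definition vars :: "cnf \<Rightarrow> nat list" where
  "vars F = dedup (map fst (concat F))"

text \<open>Digits are pairs of bits. There is one column per variable and one per clause. The items are
  the literals and two slack items per clause; the latter have digit 1 in the column of their clause
  only, since no clause contains another one.\<close>

definition lit_digits :: "cnf \<Rightarrow> literal \<Rightarrow> (bool \<times> bool) list" where
  "lit_digits F l = map (\<lambda>u. (u = fst l, False)) (vars F) @ map (\<lambda>C. (l \<in> set C, False)) F"

definition slack_digits :: "cnf \<Rightarrow> literal list \<Rightarrow> (bool \<times> bool) list" where
  "slack_digits F C = map (\<lambda>u. (False, False)) (vars F) @ map (\<lambda>D. (set C \<subseteq> set D, False)) F"

text \<open>The digits are 1 for a variable, forcing exactly one of its two literals, and 3 for a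
  clause, which two slack items of digit 1 can complete exactly if one to three literals of the
  clause are chosen.\<close>

definition target_digits :: "cnf \<Rightarrow> (bool \<times> bool) list" where
  "target_digits F = map (\<lambda>u. (True, False)) (vars F) @ map (\<lambda>D. (True, True)) F"

text \<open>The profit is the concatenation of all costs, hence increasing in each of them.\<close>

definition item :: "nat \<Rightarrow> bool list \<Rightarrow> (bool \<times> bool) list \<Rightarrow> nat list" where
  "item d w ds = of_bits (w @ [True]) # number (concat (deal d ds)) # map number (deal d ds)"

definition lit_name :: "literal \<Rightarrow> bool list" where
  "lit_name l = False # snd l # bits (fst l)"

text \<open>In an antichain a clause is identified by its row of digits. The leading flags separate
  slack items from literals and the two slack items of a clause from each other.\<close>

definition slack_name :: "cnf \<Rightarrow> literal list \<Rightarrow> bool \<Rightarrow> bool list" where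
  "slack_name F C b = True # b # map fst (slack_digits F C)"

definition items_list :: "nat \<Rightarrow> cnf \<Rightarrow> nat list list" where
  "items_list d F =
     concat (map (\<lambda>v. map (\<lambda>b. item d (lit_name (v, b)) (lit_digits F (v, b))) [False, True]) (vars F)) @
     concat (map (\<lambda>C. map (\<lambda>b. item d (slack_name F C b) (slack_digits F C)) [False, True]) F)"

definition knap_instance :: "nat \<Rightarrow> cnf \<Rightarrow> nat list \<times> nat list list" where
  "knap_instance d F = (map number (deal d (target_digits F)), items_list d F)"

lemma ptime_vars [ptime_intros]: "ptime l \<Longrightarrow> ptime (\<lambda>x. vars (l x))"
  by (rule ptime_comp[of vars]) (unfold vars_def, intro ptime_intros)

lemma ptime_lit_digits [ptime_intros]: "ptime f \<Longrightarrow> ptime g \<Longrightarrow> ptime (\<lambda>x. lit_digits (f x) (g x))"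
  by (rule ptime_comp2) (unfold lit_digits_def, intro ptime_intros)

lemma ptime_slack_digits [ptime_intros]:
  "ptime f \<Longrightarrow> ptime g \<Longrightarrow> ptime (\<lambda>x. slack_digits (f x) (g x))"
  by (rule ptime_comp2) (unfold slack_digits_def, intro ptime_intros)

lemma ptime_item [ptime_intros]: "ptime f \<Longrightarrow> ptime g \<Longrightarrow> ptime (\<lambda>x. item d (f x) (g x))"
  by (rule ptime_comp2) (unfold item_def, intro ptime_intros)

lemma ptime_knap_instance: "ptime (\<lambda>F. knap_instance d F)"
  unfolding knap_instance_def items_list_def target_digits_def lit_name_def slack_name_def
  by (intro ptime_intros)

subsection \<open>Correctness\<close>

type_synonym column = "nat + literal list"

type_synonym descriptor = "literal + (literal list \<times> bool)"

definition columns :: "cnf \<Rightarrow> column list" where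
  "columns F = map Inl (vars F) @ map Inr F"

fun digit :: "descriptor \<Rightarrow> column \<Rightarrow> bool" where
  "digit (Inl l) (Inl u) = (u = fst l)"
| "digit (Inl l) (Inr C) = (l \<in> set C)"
| "digit (Inr p) (Inl u) = False"
| "digit (Inr p) (Inr C) = (set (fst p) \<subseteq> set C)"

fun target :: "column \<Rightarrow> nat" where
  "target (Inl u) = 1"
| "target (Inr C) = 3"

definition queues :: "nat \<Rightarrow> cnf \<Rightarrow> column list list" where
  "queues d F = deal d (columns F)"

fun ident :: "cnf \<Rightarrow> descriptor \<Rightarrow> nat" where
  "ident F (Inl l) = of_bits (lit_name l @ [True])"
| "ident F (Inr p) = of_bits (slack_name F (fst p) (snd p) @ [True])"

definition descrs :: "cnf \<Rightarrow> descriptor list" where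
  "descrs F = concat (map (\<lambda>v. map (\<lambda>b. Inl (v, b)) [False, True]) (vars F)) @
     concat (map (\<lambda>C. map (\<lambda>b. Inr (C, b)) [False, True]) F)"

text \<open>Items must be numbers, while digits belong to descriptors; the inverse of
  \<open>ident\<close> leads back. The index \<open>j - 1\<close> translates dimensions, counted
  from 1, into list positions.\<close>

definition knap :: "nat \<Rightarrow> cnf \<Rightarrow> knapsack" where
  "knap d F = \<lparr>items = ident F ` set (descrs F),
    profit = (\<lambda>i. nval (map (\<lambda>c. of_bool (digit (inv_into (set (descrs F)) (ident F) i) c))
      (concat (queues d F)))),
    cost = (\<lambda>i j. nval (map (\<lambda>c. of_bool (digit (inv_into (set (descrs F)) (ident F) i) c))
      (queues d F ! (j - 1)))),
    budget = (\<lambda>j. nval (map target (queues d F ! (j - 1))))\<rparr>"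

lemma knap_simps [simp]:
  "items (knap d F) = ident F ` set (descrs F)"
  "profit (knap d F) i =
    nval (map (\<lambda>c. of_bool (digit (inv_into (set (descrs F)) (ident F) i) c)) (concat (queues d F)))"
  "cost (knap d F) i j =
    nval (map (\<lambda>c. of_bool (digit (inv_into (set (descrs F)) (ident F) i) c)) (queues d F ! (j - 1)))"
  "budget (knap d F) j = nval (map target (queues d F ! (j - 1)))"
  by (simp_all add: knap_def)

lemma target_less [simp]: "target c < 8"
  by (cases c) auto

lemma set_descrs: "set (descrs F) = (set (vars F) \<times> UNIV) <+> (set F \<times> UNIV)"
  by (auto simp: descrs_def UNIV_bool Plus_def)

lemma of_bits_snoc_True_inject: "of_bits (xs @ [True]) = of_bits (ys @ [True]) \<longleftrightarrow> xs = ys"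
  by (metis bits_of_bits_snoc_True butlast_snoc)

lemma inj_ident:
  assumes "antichain (fam F)" "good F"
  shows "inj_on (ident F) (set (descrs F))"
proof (rule inj_onI)
  fix x y assume x: "x \<in> set (descrs F)" and y: "y \<in> set (descrs F)" and e: "ident F x = ident F y"
  show "x = y"
  proof (cases x; cases y)
    fix k l assume "x = Inl k" "y = Inl l"
    then show ?thesis using e inj_bits
      by (auto simp: of_bits_snoc_True_inject lit_name_def prod_eq_iff simp flip: append_Cons)
  next
    fix p q assume *: "x = Inr p" "y = Inr q"
    then have pq: "fst p \<in> set F" "fst q \<in> set F" using x y by (auto simp: set_descrs)
    from e * have "slack_name F (fst p) (snd p) = slack_name F (fst q) (snd q)"
      by (simp add: of_bits_snoc_True_inject)
    then have **: "snd p = snd q" "map fst (slack_digits F (fst p)) = map fst (slack_digits F (fst q))"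
      by (simp_all add: slack_name_def)
    \<comment> \<open>Taking for \<open>D\<close> the two clauses themselves yields inclusion in
      both directions.\<close>
    then have "\<forall>D\<in>set F. set (fst p) \<subseteq> set D \<longleftrightarrow> set (fst q) \<subseteq> set D"
      by (simp add: slack_digits_def)
    then have "set (fst p) = set (fst q)" using pq by blast
    then have "fst p = fst q" using pq assms(2) by (auto simp: good_def distinct_map inj_on_def)
    with ** * show ?thesis by (simp add: prod_eq_iff)
  qed (use e in \<open>auto simp: of_bits_snoc_True_inject lit_name_def slack_name_def simp flip: append_Cons\<close>)
qed

definition item_of :: "nat \<Rightarrow> cnf \<Rightarrow> descriptor \<Rightarrow> nat list" where
  "item_of d F x = ident F x # nval (map (\<lambda>c. of_bool (digit x c)) (concat (queues d F))) #
     map (\<lambda>q. nval (map (\<lambda>c. of_bool (digit x c)) q)) (queues d F)"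

text \<open>Links the bit strings produced by the program with the digit functions used in the
  correctness proof.\<close>

lemma item_eq_item_of:
  "item d (lit_name l) (lit_digits F l) = item_of d F (Inl l)"
  "item d (slack_name F C b) (slack_digits F C) = item_of d F (Inr (C, b))"
proof -
  have 1: "lit_digits F l = map (\<lambda>c. (digit (Inl l) c, False)) (columns F)"
    by (simp add: lit_digits_def columns_def)
  have 2: "slack_digits F C = map (\<lambda>c. (digit (Inr (C, b)) c, False)) (columns F)"
    by (simp add: slack_digits_def columns_def)
  show "item d (lit_name l) (lit_digits F l) = item_of d F (Inl l)"
    unfolding item_def item_of_def 1 deal_map queues_def
    by (simp add: number_eq map_concat[symmetric] comp_def)
  show "item d (slack_name F C b) (slack_digits F C) = item_of d F (Inr (C, b))"
    unfolding item_def item_of_def 2 deal_map queues_def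
    by (simp add: number_eq map_concat[symmetric] comp_def)
qed

lemma items_list_eq: "items_list d F = map (item_of d F) (descrs F)"
  by (simp add: items_list_def descrs_def item_eq_item_of map_concat comp_def)

lemma budget_eq: "map number (deal d (target_digits F)) = map (\<lambda>q. nval (map target q)) (queues d F)"
proof -
  have "target_digits F = map (\<lambda>c. (True, case c of Inl _ \<Rightarrow> False | Inr _ \<Rightarrow> True)) (columns F)"
    by (simp add: target_digits_def columns_def)
  moreover have "1 + 2 * of_bool (case c of Inl _ \<Rightarrow> False | Inr _ \<Rightarrow> True) = target c" for c
    by (cases c) auto
  ultimately show ?thesis by (simp add: deal_map queues_def number_eq comp_def)
qed

lemma map_upt_dims: "length Q = d \<Longrightarrow> map (\<lambda>j. h (Q ! (j - 1))) [1..<d + 1] = map h Q"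
  by (rule nth_equalityI) (simp_all del: upt_Suc)

lemma distinct_concat_flags:
  "inj h \<Longrightarrow> distinct xs \<Longrightarrow> distinct (concat (map (\<lambda>v. map (\<lambda>b. h (v, b)) [False, True]) xs))"
  by (induction xs) (auto simp: inj_eq)

lemma encodes_knap_instance:
  assumes "antichain (fam F)" "good F"
  shows "encodes_knapsack d (enc (knap_instance d F)) (knap d F)"
  unfolding encodes_knapsack_def
proof (intro exI conjI)
  note inj = inj_ident[OF assms]
  have len: "length (queues d F) = d" by (simp add: queues_def)
  have "distinct (vars F)" "distinct F" using assms(2) by (auto simp: vars_def good_def distinct_map)
  then have "distinct (descrs F)"
    using distinct_concat_flags[of Inl "vars F"] distinct_concat_flags[of Inr F]
    unfolding descrs_def by auto
  then show "distinct (map (ident F) (descrs F))" using inj by (simp add: distinct_map)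
  show "set (map (ident F) (descrs F)) = items (knap d F)" by simp
  have it: "enc_item d (knap d F) (ident F x) = enc (item_of d F x)" if "x \<in> set (descrs F)" for x
    using inv_into_f_f[OF inj that]
      map_upt_dims[OF len, of "\<lambda>q. enc_nat (nval (map (\<lambda>c. of_bool (digit x c)) q))"]
    by (simp add: enc_item_def item_of_def enc_list_def enc_nat_eq comp_def del: upt_Suc)
  have bu: "enc (map (\<lambda>q. nval (map target q)) (queues d F)) =
      enc_list (map (\<lambda>j. enc_nat (budget (knap d F) j)) [1..<d + 1])"
    using map_upt_dims[OF len, of "\<lambda>q. enc_nat (nval (map target q))"]
    by (simp add: enc_list_def enc_nat_eq comp_def del: upt_Suc)
  have "enc (items_list d F) = enc_list (map (enc_item d (knap d F)) (map (ident F) (descrs F)))"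
    unfolding items_list_eq enc_list_def[of "map _ (descrs F)"] map_map comp_def
    by (rule arg_cong[where f = enc_list], rule map_cong[OF refl]) (simp only: it)
  then show "enc (knap_instance d F) = Node (enc_list (map (\<lambda>j. enc_nat (budget (knap d F) j)) [1..<d + 1]))
     (enc_list (map (enc_item d (knap d F)) (map (ident F) (descrs F))))"
    by (simp only: knap_instance_def enc_simps budget_eq bu)
qed


section \<open>Column totals and satisfying assignments\<close>

definition col_total :: "descriptor set \<Rightarrow> column \<Rightarrow> nat" where
  "col_total T c = (\<Sum>x\<in>T. of_bool (digit x c))"

lemma sum_of_bool_card: "finite A \<Longrightarrow> (\<Sum>x\<in>A. of_bool (P x)) = card {x \<in> A. P x}"
  by (simp add: of_bool_def sum.If_cases Int_def)

lemma col_total_Inl: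
  assumes "finite A" "finite B" shows "col_total (A <+> B) (Inl v) = card {l \<in> A. fst l = v}"
proof -
  have "col_total (A <+> B) (Inl v) = (\<Sum>l\<in>A. of_bool (v = fst l))"
    using sum.Plus[OF assms, of "\<lambda>x. of_bool (digit x (Inl v)) :: nat"] by (simp add: col_total_def comp_def)
  also have "\<dots> = card {l \<in> A. fst l = v}"
    by (simp only: sum_of_bool_card[OF assms(1)] eq_commute[of v])
  finally show ?thesis .
qed

lemma col_total_Inr:
  assumes "finite A" "finite B" "C \<in> set F" "fst ` B \<subseteq> set F" and F: "antichain (fam F)" "good F"
  shows "col_total (A <+> B) (Inr C) = card {l \<in> A. l \<in> set C} + card {p \<in> B. fst p = C}"
proof -
  have "(set (fst p) \<subseteq> set C) = (fst p = C)" if "p \<in> B" for p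
  proof
    assume "set (fst p) \<subseteq> set C"
    moreover have "fst p \<in> set F" using that assms(4) by auto
    ultimately have "set (fst p) = set C" using F(1) assms(3) by (auto simp: antichain_def fam_def)
    then show "fst p = C" using F(2) assms(3) \<open>fst p \<in> set F\<close> by (auto simp: good_def distinct_map inj_on_def)
  qed simp
  then have "(\<Sum>p\<in>B. of_bool (set (fst p) \<subseteq> set C)) = (\<Sum>p\<in>B. of_bool (fst p = C) :: nat)"
    by (intro sum.cong) simp_all
  then have "col_total (A <+> B) (Inr C) = (\<Sum>l\<in>A. of_bool (l \<in> set C)) + (\<Sum>p\<in>B. of_bool (fst p = C))"
    using sum.Plus[OF assms(1,2), of "\<lambda>x. of_bool (digit x (Inr C)) :: nat"]
    by (simp only: col_total_def comp_def digit.simps)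
  then show ?thesis by (simp only: sum_of_bool_card[OF assms(1)] sum_of_bool_card[OF assms(2)])
qed

lemma Plus_vimage: "T = (Inl -` T) <+> (Inr -` T)"
proof (rule set_eqI)
  show "x \<in> T \<longleftrightarrow> x \<in> (Inl -` T) <+> (Inr -` T)" for x by (cases x) auto
qed

lemma card_slack_le: "card {p \<in> B. fst p = (C :: literal list)} \<le> 2" for B :: "(literal list \<times> bool) set"
proof -
  have "{p \<in> B. fst p = C} \<subseteq> {C} \<times> UNIV" by auto
  then have "card {p \<in> B. fst p = C} \<le> card ({C} \<times> (UNIV :: bool set))" by (rule card_mono[rotated]) simp
  then show ?thesis by (simp add: card_cartesian_product)
qed

text \<open>A variable column sums to at most 2 and a clause column to at most 3 + 2 = 5. This holds
  for every set of items, feasible or not.\<close>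

lemma col_total_less:
  assumes T: "T \<subseteq> set (descrs F)" and F: "antichain (fam F)" "good F" "\<forall>C\<in>set F. length C \<le> 3"
    and c: "c \<in> set (columns F)"
  shows "col_total T c < 8"
proof -
  define A where "A = Inl -` T" define B where "B = Inr -` T"
  have TAB: "T = A <+> B" unfolding A_def B_def by (rule Plus_vimage)
  have "finite T" using T by (rule finite_subset) simp
  then have fin: "finite A" "finite B" unfolding A_def B_def by (simp_all add: finite_vimageI)
  have BF: "fst ` B \<subseteq> set F" using T by (auto simp: B_def set_descrs)
  show ?thesis
  proof (cases c)
    case (Inl v)
    have "{l \<in> A. fst l = v} \<subseteq> {v} \<times> UNIV" by auto
    then have "card {l \<in> A. fst l = v} \<le> card ({v} \<times> (UNIV :: bool set))" by (rule card_mono[rotated]) simp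
    then show ?thesis unfolding Inl TAB col_total_Inl[OF fin] by (simp add: card_cartesian_product)
  next
    case (Inr C)
    then have C: "C \<in> set F" using c by (auto simp: columns_def)
    have "card {l \<in> A. l \<in> set C} \<le> card (set C)" by (rule card_mono) auto
    also have "\<dots> \<le> 3" using F(3) C card_length[of C] by (meson order_trans)
    finally show ?thesis using card_slack_le[of B C] unfolding Inr TAB col_total_Inr[OF fin C BF F(1,2)] by linarith
  qed
qed

lemma satisfying_col_total:
  assumes a: "hits (lit_holds a) F" and F: "antichain (fam F)" "good F" "\<forall>C\<in>set F. length C \<le> 3"
  obtains T where "T \<subseteq> set (descrs F)" "\<And>c. c \<in> set (columns F) \<Longrightarrow> col_total T c = target c"
proof -
  define A where "A = (\<lambda>v. (v, a v)) ` set (vars F)"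
  define t where "t C = card {l \<in> A. l \<in> set C}" for C
  \<comment> \<open>A clause with one, two or three true literals receives two, one or no slack
    items, filling its column up to 3.\<close>
  define B where "B = {p \<in> set F \<times> UNIV. if snd p then t (fst p) \<le> 1 else t (fst p) \<le> 2}"
  have fin: "finite A" "finite B" by (simp_all add: A_def B_def)
  have BF: "fst ` B \<subseteq> set F" by (auto simp: B_def)
  have "A <+> B \<subseteq> set (descrs F)" by (auto simp: set_descrs A_def B_def)
  moreover have "col_total (A <+> B) c = target c" if c: "c \<in> set (columns F)" for c
  proof (cases c)
    case (Inl v)
    then have "v \<in> set (vars F)" using c by (auto simp: columns_def)
    then have "{l \<in> A. fst l = v} = {(v, a v)}" by (auto simp: A_def)
    then show ?thesis unfolding Inl col_total_Inl[OF fin] by simp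
  next
    case (Inr C)
    then have C: "C \<in> set F" using c by (auto simp: columns_def)
    have "t C \<le> card (set C)" unfolding t_def by (rule card_mono) auto
    then have "t C \<le> 3" using F(3) C card_length[of C] by (meson order_trans)
    moreover have "t C \<noteq> 0"
    proof -
      obtain l where l: "l \<in> set C" "a (fst l) = snd l" using a C by (auto simp: hits_def lit_holds_def)
      then have "fst l \<in> set (vars F)" using C by (auto simp: vars_def)
      then have "l \<in> A" using l(2) by (auto simp: A_def image_iff prod_eq_iff)
      with l(1) have "l \<in> {l \<in> A. l \<in> set C}" by simp
      then have "{l \<in> A. l \<in> set C} \<noteq> {}" by blast
      with fin(1) show ?thesis by (simp add: t_def card_eq_0_iff del: Collect_empty_eq)
    qed
    moreover have "card {p \<in> B. fst p = C} = of_bool (t C \<le> 1) + of_bool (t C \<le> 2)"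
    proof -
      have "{p \<in> B. fst p = C} = (if t C \<le> 1 then {(C, True)} else {}) \<union> (if t C \<le> 2 then {(C, False)} else {})"
        using C by (auto simp: B_def split: if_splits)
      then show ?thesis by auto
    qed
    ultimately show ?thesis unfolding Inr col_total_Inr[OF fin C BF F(1,2)] t_def[symmetric] by (auto simp: of_bool_def)
  qed
  ultimately show ?thesis by (rule that)
qed

text \<open>At most 2 of the total 3 in a clause column can be slack, so some literal of the clause
  is chosen. The total 1 in its variable column excludes the complementary literal, so the
  assignment agrees with the choice.\<close>

lemma col_total_satisfying:
  assumes T: "T \<subseteq> set (descrs F)" and F: "antichain (fam F)" "good F"
    and eq: "\<And>c. c \<in> set (columns F) \<Longrightarrow> col_total T c = target c"
  shows "hits (lit_holds (\<lambda>v. Inl (v, True) \<in> T)) F"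
  unfolding hits_def
proof
  fix C assume C: "C \<in> set F"
  define A where "A = Inl -` T" define B where "B = Inr -` T"
  have TAB: "T = A <+> B" unfolding A_def B_def by (rule Plus_vimage)
  have "finite T" using T by (rule finite_subset) simp
  then have fin: "finite A" "finite B" unfolding A_def B_def by (simp_all add: finite_vimageI)
  have BF: "fst ` B \<subseteq> set F" using T by (auto simp: B_def set_descrs)
  have "col_total T (Inr C) = 3" using eq[of "Inr C"] C by (simp add: columns_def)
  then have "card {l \<in> A. l \<in> set C} \<noteq> 0"
    using card_slack_le[of B C] unfolding TAB col_total_Inr[OF fin C BF F] by linarith
  then obtain l where l: "l \<in> A" "l \<in> set C" by (metis (mono_tags, lifting) Collect_empty_eq card.empty)
  have v: "fst l \<in> set (vars F)" using l(2) C by (auto simp: vars_def)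
  have "col_total T (Inl (fst l)) = 1" using eq[of "Inl (fst l)"] v by (simp add: columns_def)
  then have "card {k \<in> A. fst k = fst l} = 1" unfolding TAB col_total_Inl[OF fin] .
  then obtain k where k: "{k \<in> A. fst k = fst l} = {k}" by (auto simp: card_1_singleton_iff)
  have "l \<in> {k}" unfolding k[symmetric] using l(1) by simp
  have "(fst l, True) \<in> A \<longleftrightarrow> snd l"
  proof
    assume "(fst l, True) \<in> A"
    then have "(fst l, True) \<in> {k}" unfolding k[symmetric] by simp
    with \<open>l \<in> {k}\<close> have "(fst l, True) = l" by simp
    then show "snd l" by (metis snd_conv)
  qed (use l(1) in \<open>cases l, simp\<close>)
  then have "lit_holds (\<lambda>v. Inl (v, True) \<in> T) l" by (auto simp: lit_holds_def A_def)
  with l(2) show "\<exists>l\<in>set C. lit_holds (\<lambda>v. Inl (v, True) \<in> T) l" by auto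
qed

lemma knap_sums:
  assumes "T \<subseteq> set (descrs F)" "antichain (fam F)" "good F"
  shows "sum (profit (knap d F)) (ident F ` T) = nval (map (col_total T) (concat (queues d F)))"
    and "(\<Sum>i\<in>ident F ` T. cost (knap d F) i j) = nval (map (col_total T) (queues d F ! (j - 1)))"
proof -
  have inj: "inj_on (ident F) T" using inj_on_subset[OF inj_ident[OF assms(2,3)] assms(1)] .
  have desc: "inv_into (set (descrs F)) (ident F) (ident F x) = x" if "x \<in> T" for x
    by (rule inv_into_f_f[OF inj_ident[OF assms(2,3)]]) (use that assms(1) in auto)
  show "sum (profit (knap d F)) (ident F ` T) = nval (map (col_total T) (concat (queues d F)))"
    unfolding col_total_def nval_sum[symmetric] sum.reindex[OF inj]
    by (rule sum.cong) (simp_all add: desc)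
  show "(\<Sum>i\<in>ident F ` T. cost (knap d F) i j) = nval (map (col_total T) (queues d F ! (j - 1)))"
    unfolding col_total_def nval_sum[symmetric] sum.reindex[OF inj]
    by (rule sum.cong) (simp_all add: desc)
qed

text \<open>A squeeze: the satisfying assignment gives a solution meeting all budgets exactly, so
  the optimal profit is at least the concatenated budgets; feasibility in all dimensions bounds it
  by the same number. Equality of the two numbers is equality digit by digit.\<close>

theorem optimal_solution_hits:
  assumes d: "0 < d" and F: "antichain (fam F)" "good F" "\<forall>C\<in>set F. length C \<le> 3"
    and a: "hits (lit_holds a) F" and S: "is_optimal_solution d (knap d F) S"
  shows "hits (lit_holds (\<lambda>v. of_bits (lit_name (v, True) @ [True]) \<in> S)) F"
proof -
  let ?Q = "queues d F"
  have lenQ: "length ?Q = d" by (simp add: queues_def)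
  have setQ: "set (concat ?Q) = set (columns F)" unfolding queues_def by (rule set_deal[OF d])
  have feasible: "is_solution d (knap d F) (ident F ` T) \<longleftrightarrow>
      (\<forall>q\<in>set ?Q. nval (map (col_total T) q) \<le> nval (map target q))" if "T \<subseteq> set (descrs F)" for T
  proof -
    have "(\<forall>j\<in>{1..d}. P (?Q ! (j - 1))) \<longleftrightarrow> (\<forall>q\<in>set ?Q. P q)" for P
    proof -
      have "(\<forall>q\<in>set ?Q. P q) \<longleftrightarrow> (\<forall>i<d. P (?Q ! i))" using lenQ by (simp add: all_set_conv_all_nth)
      also have "\<dots> \<longleftrightarrow> (\<forall>j\<in>{1..d}. P (?Q ! (j - 1)))"
      proof safe
        fix i assume *: "\<forall>j\<in>{1..d}. P (?Q ! (j - 1))" "i < d"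
        from bspec[OF *(1), of "Suc i"] *(2) show "P (?Q ! i)" by simp
      next
        fix j assume *: "\<forall>i<d. P (?Q ! i)" "j \<in> {1..d}"
        then have "j - 1 < d" by auto
        with *(1) show "P (?Q ! (j - 1))" by blast
      qed
      finally show ?thesis by simp
    qed
    from this[of "\<lambda>q. nval (map (col_total T) q) \<le> nval (map target q)"] that show ?thesis
      unfolding is_solution_def knap_sums(2)[OF that F(1,2)] by auto
  qed
  obtain T0 where T0: "T0 \<subseteq> set (descrs F)" "\<And>c. c \<in> set (columns F) \<Longrightarrow> col_total T0 c = target c"
    using satisfying_col_total[OF a F] by blast
  have eq0: "map (col_total T0) q = map target q" if "set q \<subseteq> set (columns F)" for q
    using T0(2) that by auto
  have "is_solution d (knap d F) (ident F ` T0)"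
    unfolding feasible[OF T0(1)]
  proof
    fix q assume "q \<in> set ?Q"
    then have "set q \<subseteq> set (columns F)" using setQ by auto
    from eq0[OF this] show "nval (map (col_total T0) q) \<le> nval (map target q)"
      by (simp del: map_eq_conv)
  qed
  moreover obtain T where T: "T \<subseteq> set (descrs F)" "S = ident F ` T"
    using S by (auto simp: is_optimal_solution_def is_solution_def subset_image_iff)
  ultimately have le0: "sum (profit (knap d F)) (ident F ` T0) \<le> sum (profit (knap d F)) (ident F ` T)"
    and le: "\<forall>q\<in>set ?Q. nval (map (col_total T) q) \<le> nval (map target q)"
    using S feasible[OF T(1)] by (auto simp: is_optimal_solution_def)
  have e0: "map (col_total T0) (concat ?Q) = map target (concat ?Q)"
    by (rule eq0) (simp only: setQ order_refl)
  from le0 have "nval (map target (concat ?Q)) \<le> nval (map (col_total T) (concat ?Q))"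
    unfolding knap_sums(1)[OF T0(1) F(1,2)] knap_sums(1)[OF T(1) F(1,2)] e0 .
  moreover have "nval (map (col_total T) (concat ?Q)) \<le> nval (map target (concat ?Q))"
    by (rule nval_concat_mono) (use le in auto)
  ultimately have e: "nval (map (col_total T) (concat ?Q)) = nval (map target (concat ?Q))" by simp
  have "col_total T c = target c" if "c \<in> set (columns F)" for c
  proof (rule nval_inj[OF e])
    show "col_total T c < 8 \<and> target c < 8" if "c \<in> set (concat ?Q)" for c
      using col_total_less[OF T(1) F] that unfolding setQ by simp
  qed (simp only: setQ that)
  then have h: "hits (lit_holds (\<lambda>v. Inl (v, True) \<in> T)) F" by (rule col_total_satisfying[OF T(1) F(1,2)])
  have "of_bits (lit_name (v, True) @ [True]) \<in> S \<longleftrightarrow> Inl (v, True) \<in> T" if "v \<in> set (vars F)" for v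
  proof -
    have "Inl (v, True) \<in> set (descrs F)" using that by (auto simp: set_descrs)
    then show ?thesis using inj_on_image_mem_iff[OF inj_ident[OF F(1,2)] _ T(1), of "Inl (v, True)"] T(2) by simp
  qed
  moreover have "fst l \<in> set (vars F)" if "C \<in> set F" "l \<in> set C" for C l
    using that by (auto simp: vars_def)
  ultimately show ?thesis using h unfolding hits_def lit_holds_def by blast
qed

text \<open>Even dealing gives a dimension at most a d-th of the columns plus one, and each column
  contributes a factor 8.\<close>

lemma max_budget_knap_le:
  assumes "0 < d"
  shows "max_budget d (knap d F) \<le> 8 ^ ((length (vars F) + length F) div d + 1)"
  unfolding max_budget_def
proof (rule Max.boundedI)
  fix b assume "b \<in> budget (knap d F) ` {1..d}"
  then obtain j where j: "j \<in> {1..d}" "b = nval (map target (queues d F ! (j - 1)))"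
    by auto
  have "queues d F ! (j - 1) \<in> set (queues d F)" using j(1) by (intro nth_mem) (auto simp: queues_def)
  then have "length (queues d F ! (j - 1)) \<le> (length (vars F) + length F) div d + 1"
    using length_deal_le[of _ d "columns F"] by (simp add: queues_def columns_def)
  moreover have "x < 8" if "x \<in> set (map target q)" for x q
    using that by auto
  then have "b < 8 ^ length (queues d F ! (j - 1))" unfolding j(2) using nval_less by fastforce
  ultimately show "b \<le> 8 ^ ((length (vars F) + length F) div d + 1)"
    by (meson less_imp_le order_trans power_increasing one_le_numeral)
qed (use assms in auto)

section \<open>Exponential bounds\<close>

definition exp_bounded :: "real \<Rightarrow> (nat \<Rightarrow> real) \<Rightarrow> bool" where
  "exp_bounded r f \<longleftrightarrow> (\<exists>K\<ge>0. \<forall>n. f n \<le> K * 2 powr (r * real n))"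

lemma exp_bounded_add:
  assumes "exp_bounded r f" "exp_bounded r g" shows "exp_bounded r (\<lambda>n. f n + g n)"
proof -
  from assms obtain K L where "K \<ge> 0" "\<And>n. f n \<le> K * 2 powr (r * real n)"
    "L \<ge> 0" "\<And>n. g n \<le> L * 2 powr (r * real n)"
    unfolding exp_bounded_def by blast
  then show ?thesis unfolding exp_bounded_def
    by (intro exI[of _ "K + L"]) (auto simp: distrib_right intro: add_mono)
qed

lemma exp_bounded_mult:
  assumes "exp_bounded r f" "exp_bounded s g" "\<And>n. 0 \<le> g n" shows "exp_bounded (r + s) (\<lambda>n. f n * g n)"
proof -
  from assms obtain K L where K: "K \<ge> 0" "\<And>n. f n \<le> K * 2 powr (r * real n)"
    and L: "L \<ge> 0" "\<And>n. g n \<le> L * 2 powr (s * real n)"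
    unfolding exp_bounded_def by blast
  have "f n * g n \<le> (K * L) * 2 powr ((r + s) * real n)" for n
  proof -
    have "f n * g n \<le> (K * 2 powr (r * real n)) * (L * 2 powr (s * real n))"
      using K L assms(3) by (intro mult_mono) auto
    also have "2 powr ((r + s) * real n) = 2 powr (r * real n) * 2 powr (s * real n)"
      by (simp add: distrib_right powr_add)
    then have "(K * 2 powr (r * real n)) * (L * 2 powr (s * real n)) = (K * L) * 2 powr ((r + s) * real n)"
      by simp
    finally show ?thesis .
  qed
  then show ?thesis unfolding exp_bounded_def using K L by (intro exI[of _ "K * L"]) auto
qed

lemma exp_bounded_mono:
  assumes "exp_bounded r f" "\<And>n. g n \<le> f n" "r \<le> s" shows "exp_bounded s g"
proof -
  from assms(1) obtain K where K: "K \<ge> 0" "\<And>n. f n \<le> K * 2 powr (r * real n)" unfolding exp_bounded_def by blast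
  have "g n \<le> K * 2 powr (s * real n)" for n
  proof -
    have "K * 2 powr (r * real n) \<le> K * 2 powr (s * real n)"
      using K(1) assms(3) by (intro mult_left_mono) (auto intro!: powr_mono mult_right_mono)
    with K(2)[of n] assms(2)[of n] show ?thesis by linarith
  qed
  with K(1) show ?thesis unfolding exp_bounded_def by blast
qed

lemma exp_bounded_powr: "exp_bounded r (\<lambda>n. 2 powr (r * real n))"
  unfolding exp_bounded_def by (intro exI[of _ 1]) simp

lemma exp_bounded_poly:
  assumes "0 \<le> c" "0 < r" shows "exp_bounded r (\<lambda>n. real (n + 2) powr c)"
proof -
  \<comment> \<open>Chosen such that \<open>ln y \<le> \<delta> * y - 1 - ln \<delta>\<close>,
    multiplied by \<open>c\<close>, has slope at most \<open>r * ln 2\<close>. The summand 1 covers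
    \<open>c = 0\<close>.\<close>
  define \<delta> where "\<delta> = r * ln 2 / (c + 1)"
  have \<delta>: "0 < \<delta>" using assms by (simp add: \<delta>_def)
  have c\<delta>: "c * \<delta> \<le> r * ln 2"
  proof -
    have "c * \<delta> \<le> (c + 1) * \<delta>" using \<delta> by (intro mult_right_mono) auto
    also have "\<dots> = r * ln 2" using assms by (simp add: \<delta>_def)
    finally show ?thesis .
  qed
  have "real (n + 2) powr c \<le> exp (c * (2 * \<delta> - 1 - ln \<delta>)) * 2 powr (r * real n)" for n
  proof -
    have "ln (\<delta> * real (n + 2)) \<le> \<delta> * real (n + 2) - 1" using \<delta> by (intro ln_le_minus_one) simp
    then have "ln (real (n + 2)) \<le> \<delta> * real (n + 2) - 1 - ln \<delta>" using \<delta> by (simp add: ln_mult)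
    then have "c * ln (real (n + 2)) \<le> c * (\<delta> * real (n + 2) - 1 - ln \<delta>)" using assms(1) by (rule mult_left_mono)
    also have "\<dots> = c * (2 * \<delta> - 1 - ln \<delta>) + c * \<delta> * real n" by (simp add: algebra_simps)
    also have "\<dots> \<le> c * (2 * \<delta> - 1 - ln \<delta>) + r * ln 2 * real n" using c\<delta> by (intro add_left_mono mult_right_mono) auto
    finally have "exp (c * ln (real (n + 2))) \<le> exp (c * (2 * \<delta> - 1 - ln \<delta>) + r * ln 2 * real n)" by simp
    then show ?thesis by (simp add: powr_def exp_add mult_ac)
  qed
  then show ?thesis unfolding exp_bounded_def by (intro exI[of _ "exp (c * (2 * \<delta> - 1 - ln \<delta>))"]) auto
qed

text \<open>A tree of size \<open>n\<close>, by which the calculus of \<open>pbounded\<close> also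
  serves for polynomials in a number.\<close>

fun unary :: "nat \<Rightarrow> tree" where
  "unary 0 = Leaf"
| "unary (Suc n) = Node Leaf (unary n)"

lemma size_unary [simp]: "size (unary n) = n"
  by (induction n) auto

abbreviation poly :: "(nat \<Rightarrow> nat) \<Rightarrow> bool" where
  "poly \<equiv> pbounded UNIV unary"

lemma poly_id: "poly (\<lambda>n. n)"
  using pbounded_size[of UNIV unary] by simp

lemma exp_bounded_poly_powr:
  assumes "poly q" "0 < r" "0 \<le> e" shows "exp_bounded r (\<lambda>n. real (q n) powr e)"
proof -
  obtain c where c: "\<And>n. q n \<le> (n + 2) ^ c" using assms(1) by (auto simp: pbounded_def)
  have "real (q n) powr e \<le> real (n + 2) powr (real c * e)" for n
  proof -
    have "real (q n) \<le> real (n + 2) ^ c" using c[of n] by (metis of_nat_le_iff of_nat_power)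
    then have "real (q n) powr e \<le> (real (n + 2) ^ c) powr e" by (intro powr_mono2 assms(3)) auto
    also have "\<dots> = real (n + 2) powr (real c * e)" by (simp add: powr_realpow[symmetric] powr_powr)
    finally show ?thesis .
  qed
  then show ?thesis using exp_bounded_poly[of "real c * e" r] assms(2,3) exp_bounded_mono[of r _ _ r] by simp
qed

lemma exp_bounded_of_poly: "poly q \<Longrightarrow> 0 < r \<Longrightarrow> exp_bounded r (\<lambda>n. real (q n))"
  using exp_bounded_poly_powr[of q r 1] exp_bounded_mono[of r "\<lambda>n. real (q n) powr 1" "\<lambda>n. real (q n)" r] by simp

section \<open>The algorithm for 3-SAT\<close>

text \<open>A solver in the sense of \<open>runs\<close> may leave anything outside variable 0; this
  restores the convention of the calculus. The last assignment is a skip.\<close>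

fun clear :: "nat \<Rightarrow> com" where
  "clear 0 = Assign 0 (Var 0)"
| "clear (Suc n) = Seq (Assign (Suc n) ELeaf) (clear n)"

lemma exec_skip: "exec (Assign 0 (Var 0)) s 2 s"
  using exec_AssignI[of s s 0 "Var 0"] by (simp add: numeral_2_eq_2)

lemma exec_clear: "exec (clear n) s (2 * Suc n) (\<lambda>v. if 1 \<le> v \<and> v \<le> n then Leaf else s v)"
proof (induction n arbitrary: s)
  case 0
  have "(\<lambda>v. if 1 \<le> v \<and> v \<le> (0 :: nat) then Leaf else s v) = s" by auto
  then show ?case using exec_skip[of s] by (simp only: clear.simps One_nat_def mult_Suc_right) simp
next
  case (Suc n)
  have "exec (Assign (Suc n) ELeaf) s 2 (s(Suc n := Leaf))"
    using exec_AssignI[of "s(Suc n := Leaf)" s "Suc n" ELeaf] by (simp add: numeral_2_eq_2)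
  from exec.Seq[OF this Suc.IH[of "s(Suc n := Leaf)"]]
  have "exec (clear (Suc n)) s (2 * Suc (Suc n)) (\<lambda>v. if 1 \<le> v \<and> v \<le> n then Leaf else (s(Suc n := Leaf)) v)"
    by simp
  moreover have "(\<lambda>v. if 1 \<le> v \<and> v \<le> n then Leaf else (s(Suc n := Leaf)) v) =
      (\<lambda>v. if 1 \<le> v \<and> v \<le> Suc n then Leaf else s v)" by (rule ext) (auto simp: le_Suc_eq)
  ultimately show ?case by simp
qed

lemma runs_clean:
  assumes "runs P x t y"
  shows "exec (Seq P (clear (com_bound P))) (st [x]) (t + 2 * Suc (com_bound P)) (st [y])"
proof -
  from assms obtain s where s: "exec P ((\<lambda>_. Leaf)(0 := x)) t s" "s 0 = y" by (auto simp: runs_def)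
  have "(\<lambda>v. if 1 \<le> v \<and> v \<le> com_bound P then Leaf else s v) = st [y]"
  proof
    fix v
    show "(if 1 \<le> v \<and> v \<le> com_bound P then Leaf else s v) = st [y] v"
      using exec_frame[OF s(1), of v] s(2) by (auto simp: st_single not_le Suc_le_eq)
  qed
  then show ?thesis using exec.Seq[OF s(1) exec_clear[of "com_bound P" s]] by (simp only: st_single)
qed

lemma ptime_program:
  assumes "ptime f"
  shows "\<exists>P c. \<forall>x. (\<exists>t. t \<le> (esize x + 2) ^ c \<and> exec P (st [enc x]) t (st [enc (f x)])) \<and>
    esize (f x) \<le> (esize x + 2) ^ c"
proof -
  from assms obtain P T where P: "\<And>x. exec P (st [enc x]) (T x) (st [enc (f x)])"
    "pbounded UNIV enc T" "pbounded UNIV enc (\<lambda>x. esize (f x))"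
    unfolding ptime_def by (rule computesE) blast
  from pbounded_add[OF P(2,3)] obtain c where c: "\<And>x. T x + esize (f x) \<le> (esize x + 2) ^ c"
    unfolding pbounded_def by blast
  show ?thesis
  proof (intro exI allI conjI)
    show "T x \<le> (esize x + 2) ^ c" "exec P (st [enc x]) (T x) (st [enc (f x)])" for x
      using P(1)[of x] c[of x] by simp_all
    show "esize (f x) \<le> (esize x + 2) ^ c" for x using c[of x] by simp
  qed
qed

text \<open>Amortised counting, modelled on the \<open>2 * l - 1\<close> nodes of a binary tree with
  \<open>l\<close> leaves. The sum of \<open>2 * w F - 1\<close> over the stack drops by at least 1
  per continuing iteration: a split leaves at most \<open>2 * w F - 2\<close>, and discarding a leaf
  removes \<open>2 * w F - 1 \<ge> 1\<close>. Here \<open>I\<close> is the invariant,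
  \<open>G\<close> satisfiability of a stacked formula and \<open>A\<close> satisfiability of the
  input.\<close>

lemma search_loop:
  fixes Fs :: "'s::enc list" and w :: "'s \<Rightarrow> real" and \<tau> :: real
  assumes step: "\<And>F Fs. I F \<Longrightarrow>
     (\<exists>F1 F2 t. real t \<le> \<tau> \<and> exec B (st [x, enc (F # Fs), Leaf]) t (st [x, enc (F1 # F2 # Fs), Leaf]) \<and>
        I F1 \<and> I F2 \<and> w F1 + w F2 \<le> w F \<and> (G F \<longrightarrow> G F1 \<or> G F2)) \<or>
     (\<exists>t. real t \<le> \<tau> \<and> exec B (st [x, enc (F # Fs), Leaf]) t (st [x, enc Fs, Leaf]) \<and> \<not> G F) \<or>
     (\<exists>t. real t \<le> \<tau> \<and> exec B (st [x, enc (F # Fs), Leaf]) t (st [x, Leaf, enc True]) \<and> A)"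
    and w: "\<And>F. I F \<Longrightarrow> 1 \<le> w F" and \<tau>: "0 \<le> \<tau>"
  shows "\<forall>F\<in>set Fs. I F \<Longrightarrow> (\<Sum>F\<leftarrow>Fs. 2 * w F - 1) \<le> real k \<Longrightarrow>
    \<exists>t y. real t \<le> real k * (\<tau> + 2) + 2 \<and>
      exec (While (Var 1) B) (st [x, enc Fs, Leaf]) t (st [x, Leaf, enc y]) \<and>
      (y \<longrightarrow> A) \<and> ((\<exists>F\<in>set Fs. G F) \<longrightarrow> y)"
proof (induction k arbitrary: Fs)
  let ?W = "While (Var 1) B"
  have stop: "exec ?W (st [x, Leaf, y]) 2 (st [x, Leaf, y])" for y
    using exec.WhileFalse[of "Var 1" "st [x, Leaf, y]" B] by (simp add: numeral_2_eq_2)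
  have bound: "2 \<le> real k * (\<tau> + 2) + 2" for k
    using \<tau> by simp
  have nonneg: "0 \<le> (\<Sum>F\<leftarrow>Gs. 2 * w F - 1)" if "\<forall>F\<in>set Gs. I F" for Gs
  proof (rule sum_list_nonneg)
    fix r assume "r \<in> set (map (\<lambda>F. 2 * w F - 1) Gs)"
    then obtain F where "F \<in> set Gs" "r = 2 * w F - 1" by auto
    with w[of F] that show "0 \<le> r" by auto
  qed
  {
    case 0
    have "Fs = []"
    proof (cases Fs)
      case (Cons F Gs)
      then show ?thesis using 0 nonneg[of Gs] w[of F] by simp
    qed
    then show ?case using stop[of Leaf] bound[of 0] by (intro exI[of _ 2] exI[of _ False]) simp
  next
    case (Suc k)
    show ?case
    proof (cases Fs)
      case Nil
      then show ?thesis using stop[of Leaf] bound[of "Suc k"] by (intro exI[of _ 2] exI[of _ False]) simp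
    next
      case (Cons F Gs)
      have I: "I F" "\<forall>F\<in>set Gs. I F" using Suc.prems(1) Cons by auto
      have sum: "2 * w F - 1 + (\<Sum>F\<leftarrow>Gs. 2 * w F - 1) \<le> real (Suc k)" using Suc.prems(2) Cons by simp
      have test: "eval_exp (Var 1) (st [x, enc Fs, Leaf]) \<noteq> Leaf" using Cons by simp
      have k: "real (Suc k) * (\<tau> + 2) + 2 = real k * (\<tau> + 2) + 2 + (\<tau> + 2)" by (simp add: algebra_simps)
      have loop: ?thesis
        if B: "exec B (st [x, enc Fs, Leaf]) t (st [x, enc Hs, Leaf])" "real t \<le> \<tau>"
          and H: "\<forall>F\<in>set Hs. I F" "(\<Sum>F\<leftarrow>Hs. 2 * w F - 1) \<le> real k"
          and G: "\<exists>F\<in>set Fs. G F \<Longrightarrow> \<exists>F\<in>set Hs. G F" for t Hs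
      proof -
        from Suc.IH[OF H] obtain u y where u: "real u \<le> real k * (\<tau> + 2) + 2"
          "exec ?W (st [x, enc Hs, Leaf]) u (st [x, Leaf, enc y])"
          "y \<longrightarrow> A" "(\<exists>F\<in>set Hs. G F) \<longrightarrow> y" by blast
        have "exec ?W (st [x, enc Fs, Leaf]) (1 + exp_time (Var 1) + t + u) (st [x, Leaf, enc y])"
          by (rule exec.WhileTrue[OF test B(1) u(2)])
        moreover have "real (1 + exp_time (Var 1) + t + u) \<le> real (Suc k) * (\<tau> + 2) + 2"
          unfolding k using u(1) B(2) by simp
        ultimately show ?thesis using u(3,4) G by blast
      qed
      from step[OF I(1), of Gs] show ?thesis
      proof (elim disjE exE conjE)
        fix F1 F2 t
        assume *: "real t \<le> \<tau>" "exec B (st [x, enc (F # Gs), Leaf]) t (st [x, enc (F1 # F2 # Gs), Leaf])"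
          "I F1" "I F2" "w F1 + w F2 \<le> w F" "G F \<longrightarrow> G F1 \<or> G F2"
        show ?thesis
          by (rule loop[of t "F1 # F2 # Gs"]) (use * I sum Cons in auto)
      next
        fix t
        assume *: "real t \<le> \<tau>" "exec B (st [x, enc (F # Gs), Leaf]) t (st [x, enc Gs, Leaf])" "\<not> G F"
        show ?thesis
          by (rule loop[of t Gs]) (use * I sum w[OF I(1)] Cons in auto)
      next
        fix t
        assume *: "real t \<le> \<tau>" "exec B (st [x, enc (F # Gs), Leaf]) t (st [x, Leaf, enc True])" A
        have "exec ?W (st [x, enc Fs, Leaf]) (1 + exp_time (Var 1) + t + 2) (st [x, Leaf, enc True])"
          by (rule exec.WhileTrue[OF test _ stop]) (use * Cons in simp)
        moreover have "real (1 + exp_time (Var 1) + t + 2) \<le> real (Suc k) * (\<tau> + 2) + 2"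
        proof -
          have "0 \<le> real k * (\<tau> + 2)" using \<tau> by simp
          moreover have "real (1 + exp_time (Var 1) + t + 2) = real t + 4" by simp
          ultimately show ?thesis unfolding k using *(1) by linarith
        qed
        ultimately show ?thesis using *(3) by blast
      qed
    qed
  }
qed

text \<open>A variable counts as true if the item of its positive literal was chosen. Names are
  recomputed and looked up, so the naming need not be inverted.\<close>

definition check :: "cnf \<Rightarrow> nat list \<Rightarrow> bool" where
  "check Cs y = (\<forall>C\<in>set Cs. \<exists>l\<in>set C. (of_bits (lit_name (fst l, True) @ [True]) \<in> set y) = snd l)"

lemma check_eq: "check Cs y = hits (lit_holds (\<lambda>v. of_bits (lit_name (v, True) @ [True]) \<in> set y)) Cs"
  by (simp add: check_def hits_def lit_holds_def)

lemma ptime_check: "ptime (\<lambda>z. check (snd (fst z)) (snd z))"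
  unfolding check_def lit_name_def by (intro ptime_intros)

subsection \<open>Satisfiability\<close>

definition clause_list :: "clause \<Rightarrow> literal list" where
  "clause_list = (\<lambda>(l1, l2, l3). [l1, l2, l3])"

lemma clause_holds_iff: "clause_holds a C \<longleftrightarrow> (\<exists>l\<in>set (clause_list C). lit_holds a l)"
  by (auto simp: clause_holds_def clause_list_def split: prod.splits)

lemma SAT_eq_card_iff:
  assumes "finite (clauses \<phi>)"
  shows "SAT \<phi> = card (clauses \<phi>) \<longleftrightarrow> (\<exists>a. \<forall>C\<in>clauses \<phi>. clause_holds a C)"
proof -
  let ?f = "\<lambda>a. card {C \<in> clauses \<phi>. clause_holds a C}"
  have le: "?f a \<le> card (clauses \<phi>)" for a by (rule card_mono) (use assms in auto)
  have fin: "finite (range ?f)" by (rule finite_subset[of _ "{..card (clauses \<phi>)}"]) (use le in auto)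
  have full: "?f a = card (clauses \<phi>) \<longleftrightarrow> (\<forall>C\<in>clauses \<phi>. clause_holds a C)" for a
  proof
    assume "?f a = card (clauses \<phi>)"
    then have "{C \<in> clauses \<phi>. clause_holds a C} = clauses \<phi>" by (intro card_subset_eq assms) auto
    then show "\<forall>C\<in>clauses \<phi>. clause_holds a C" by blast
  next
    assume "\<forall>C\<in>clauses \<phi>. clause_holds a C"
    then have "{C \<in> clauses \<phi>. clause_holds a C} = clauses \<phi>" by blast
    then show "?f a = card (clauses \<phi>)" by simp
  qed
  have "SAT \<phi> = card (clauses \<phi>) \<longleftrightarrow> (\<exists>a. ?f a = card (clauses \<phi>))"
  proof
    assume "SAT \<phi> = card (clauses \<phi>)"
    moreover have "SAT \<phi> \<in> range ?f" unfolding SAT_def by (rule Max_in[OF fin]) auto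
    ultimately show "\<exists>a. ?f a = card (clauses \<phi>)" by auto
  next
    assume "\<exists>a. ?f a = card (clauses \<phi>)"
    then obtain a where "?f a = card (clauses \<phi>)" by auto
    then have "card (clauses \<phi>) \<in> range ?f" by (intro image_eqI[of _ ?f a]) simp_all
    then have "card (clauses \<phi>) \<le> SAT \<phi>" unfolding SAT_def by (rule Max_ge[OF fin])
    moreover have "SAT \<phi> \<le> card (clauses \<phi>)" unfolding SAT_def by (rule Max.boundedI[OF fin]) (use le in auto)
    ultimately show "SAT \<phi> = card (clauses \<phi>)" by simp
  qed
  then show ?thesis using full by simp
qed

lemma encodes_formula_lists:
  assumes "formula_wf \<phi>" "encodes_formula x \<phi>"
  obtains Cs where "x = enc (num_vars \<phi>, Cs)"
    "\<And>C. C \<in> set Cs \<Longrightarrow> length C = 3 \<and> set C \<subseteq> {..<num_vars \<phi>} \<times> UNIV"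
    "length Cs \<le> (2 * num_vars \<phi>) ^ 3"
    "SAT \<phi> = card (clauses \<phi>) \<longleftrightarrow> (\<exists>a. hits (lit_holds a) Cs)"
proof -
  let ?L = "{..<num_vars \<phi>} \<times> (UNIV :: bool set)"
  from assms(2) obtain Ds where D: "distinct Ds" "set Ds = clauses \<phi>"
    "x = Node (enc_nat (num_vars \<phi>)) (enc_list (map enc_clause Ds))" by (auto simp: encodes_formula_def)
  have lit: "set (clause_list C) \<subseteq> ?L" if "C \<in> clauses \<phi>" for C
    using assms(1) that by (fastforce simp: formula_wf_def clause_list_def split: prod.splits)
  show ?thesis
  proof (rule that[of "map clause_list Ds"])
    have "enc_clause C = enc (clause_list C)" for C
      by (cases C) (simp add: enc_clause_def clause_list_def enc_literal_def enc_prod_def enc_nat_eq enc_bool_eq)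
    then have "map enc_clause Ds = map enc (map clause_list Ds)" by simp
    then show "x = enc (num_vars \<phi>, map clause_list Ds)"
      unfolding D(3) by (simp only: enc_simps enc_nat_eq enc_list_def[of "map clause_list Ds"])
    show "length C = 3 \<and> set C \<subseteq> ?L" if "C \<in> set (map clause_list Ds)" for C
    proof -
      from that obtain C' where "C' \<in> clauses \<phi>" "C = clause_list C'" using D(2) by auto
      with lit[of C'] show ?thesis by (auto simp: clause_list_def split: prod.splits)
    qed
    have "clauses \<phi> \<subseteq> ?L \<times> ?L \<times> ?L"
    proof
      fix C assume "C \<in> clauses \<phi>"
      from lit[OF this] show "C \<in> ?L \<times> ?L \<times> ?L" by (cases C) (simp add: clause_list_def)
    qed
    then have "card (clauses \<phi>) \<le> card (?L \<times> ?L \<times> ?L)" by (rule card_mono[rotated]) simp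
    moreover have "card (clauses \<phi>) = length Ds" using D(1,2) distinct_card by metis
    ultimately show "length (map clause_list Ds) \<le> (2 * num_vars \<phi>) ^ 3"
      by (simp add: card_cartesian_product power3_eq_cube mult_ac)
    show "SAT \<phi> = card (clauses \<phi>) \<longleftrightarrow> (\<exists>a. hits (lit_holds a) (map clause_list Ds))"
      using SAT_eq_card_iff[of \<phi>] assms(1) D(2)
      by (simp add: formula_wf_def hits_def clause_holds_iff)
  qed
qed

text \<open>Variable 0 holds the input, variable 1 the stack of formulas still to be searched, variable 2
  the answer; the loop ends when the stack is empty.\<close>

definition push_branches :: com where
  "push_branches = Seq (Assign 1 (ENode (Hd (Var 4)) (ENode (Hd (Tl (Var 4))) (Var 1))))
    (Seq (Assign 4 ELeaf) (Assign 3 ELeaf))"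

text \<open>Variable 3 holds in turn the formula, the knapsack instance, the solution, its pair with
  the input, and the verdict. A positive verdict also empties the stack, which ends the
  loop.\<close>

definition test_leaf :: "com \<Rightarrow> com \<Rightarrow> com \<Rightarrow> com" where
  "test_leaf Rd Sv Ch = Seq (shift_com 3 Rd) (Seq (shift_com 3 Sv) (Seq (Assign 3 (ENode (Var 0) (Var 3))) (Seq (shift_com 3 Ch)
    (If (Var 3) (Seq (Assign 2 (Var 3)) (Seq (Assign 3 ELeaf) (Assign 1 ELeaf))) (Assign 0 (Var 0))))))"

definition search_body :: "com \<Rightarrow> com \<Rightarrow> com \<Rightarrow> com \<Rightarrow> com" where
  "search_body Br Rd Sv Ch = Seq (Assign 3 (Hd (Var 1))) (Seq (Assign 1 (Tl (Var 1))) (Seq (Assign 4 (Var 3))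
    (Seq (shift_com 4 Br) (If (Var 4) push_branches (test_leaf Rd Sv Ch)))))"

lemma exec_search_start:
  fixes F :: "'s::enc"
  assumes "exec Br (st [enc F]) t (st [b])"
    and "exec (If (Var 4) push_branches (test_leaf Rd Sv Ch)) (st [x, enc Fs, Leaf, enc F, b]) u s"
  shows "exec (search_body Br Rd Sv Ch) (st [x, enc (F # Fs), Leaf]) (3 + (3 + (2 + (t + u)))) s"
  unfolding search_body_def
proof (intro exec.Seq)
  show "exec (Assign 3 (Hd (Var 1))) (st [x, enc (F # Fs), Leaf]) 3 (st [x, enc (F # Fs), Leaf, enc F])"
    by (rule exec_push) (simp_all add: numeral_eq_Suc)
  show "exec (Assign 1 (Tl (Var 1))) (st [x, enc (F # Fs), Leaf, enc F]) 3 (st [x, enc Fs, Leaf, enc F])"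
    by (rule exec_set) (simp_all add: numeral_eq_Suc)
  show "exec (Assign 4 (Var 3)) (st [x, enc Fs, Leaf, enc F]) 2 (st [x, enc Fs, Leaf, enc F, enc F])"
    by (rule exec_push) (simp_all add: numeral_eq_Suc)
  show "exec (shift_com 4 Br) (st [x, enc Fs, Leaf, enc F, enc F]) t (st [x, enc Fs, Leaf, enc F, b])"
    using exec_shift_st[OF assms(1), of "[x, enc Fs, Leaf, enc F]"] by (simp add: numeral_eq_Suc)
qed (rule assms(2))

lemma exec_search_branch:
  fixes F :: "'s::enc"
  assumes "exec Br (st [enc F]) t (st [enc [F1, F2]])"
  shows "exec (search_body Br Rd Sv Ch) (st [x, enc (F # Fs), Leaf]) (t + 23) (st [x, enc (F1 # F2 # Fs), Leaf])"
proof -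
  let ?b = "enc [F1, F2]" and ?s = "enc (F1 # F2 # Fs)"
  have 1: "exec push_branches (st [x, enc Fs, Leaf, enc F, ?b]) (9 + (2 + 2)) (st [x, ?s, Leaf])"
    unfolding push_branches_def
  proof (intro exec.Seq)
    show "exec (Assign 1 (ENode (Hd (Var 4)) (ENode (Hd (Tl (Var 4))) (Var 1))))
      (st [x, enc Fs, Leaf, enc F, ?b]) 9 (st [x, ?s, Leaf, enc F, ?b])"
      by (rule exec_set) (simp_all add: numeral_eq_Suc)
    show "exec (Assign 4 ELeaf) (st [x, ?s, Leaf, enc F, ?b]) 2 (st [x, ?s, Leaf, enc F])"
      by (rule exec_pop) simp_all
    show "exec (Assign 3 ELeaf) (st [x, ?s, Leaf, enc F]) 2 (st [x, ?s, Leaf])"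
      by (rule exec_pop) simp_all
  qed
  have test: "eval_exp (Var 4) (st [x, enc Fs, Leaf, enc F, ?b]) \<noteq> Leaf" by (simp add: numeral_eq_Suc)
  show ?thesis
    using exec_search_start[OF assms exec.IfTrue[OF test 1]] by (simp add: add_ac)
qed

lemma exec_search_leaf:
  fixes F :: "'s::enc"
  assumes "exec Br (st [enc F]) t (st [Leaf])" "exec Rd (st [enc F]) u (st [r])"
    "exec Sv (st [r]) v (st [y])" "exec Ch (st [Node x y]) w (st [enc b])"
  shows "\<exists>z \<le> t + u + v + w + 26. exec (search_body Br Rd Sv Ch) (st [x, enc (F # Fs), Leaf]) z
    (st [x, if b then Leaf else enc Fs, enc b])"
proof -
  let ?I = "If (Var 3) (Seq (Assign 2 (Var 3)) (Seq (Assign 3 ELeaf) (Assign 1 ELeaf))) (Assign 0 (Var 0))"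
  have "\<exists>a \<le> 8. exec ?I (st [x, enc Fs, Leaf, enc b]) a (st [x, if b then Leaf else enc Fs, enc b])"
  proof (cases b)
    case True
    have "exec (Seq (Assign 2 (Var 3)) (Seq (Assign 3 ELeaf) (Assign 1 ELeaf))) (st [x, enc Fs, Leaf, enc b])
      (2 + (2 + 2)) (st [x, Leaf, enc b])"
    proof (intro exec.Seq)
      show "exec (Assign 2 (Var 3)) (st [x, enc Fs, Leaf, enc b]) 2 (st [x, enc Fs, enc b, enc b])"
        by (rule exec_set) (simp_all add: numeral_eq_Suc)
      show "exec (Assign 3 ELeaf) (st [x, enc Fs, enc b, enc b]) 2 (st [x, enc Fs, enc b])"
        by (rule exec_pop) simp_all
      show "exec (Assign 1 ELeaf) (st [x, enc Fs, enc b]) 2 (st [x, Leaf, enc b])"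
        by (rule exec_set) (simp_all add: numeral_eq_Suc)
    qed
    from exec.IfTrue[OF _ this, of "Var 3" "Assign 0 (Var 0)"] True show ?thesis
      by (intro exI[of _ 8]) (simp add: numeral_eq_Suc)
  next
    case False
    have "st [x, enc Fs, Leaf, Leaf] = st [x, enc Fs, Leaf]" using st_Leaf[of "[x, enc Fs, Leaf]"] by simp
    with exec.IfFalse[OF _ exec_skip, of "Var 3" "st [x, enc Fs, Leaf, Leaf]"] False show ?thesis
      by (intro exI[of _ 4]) (simp add: numeral_eq_Suc)
  qed
  then obtain a where a: "a \<le> 8" "exec ?I (st [x, enc Fs, Leaf, enc b]) a (st [x, if b then Leaf else enc Fs, enc b])"
    by blast
  have "exec (test_leaf Rd Sv Ch) (st [x, enc Fs, Leaf, enc F]) (u + (v + (4 + (w + a))))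
      (st [x, if b then Leaf else enc Fs, enc b])"
    unfolding test_leaf_def
  proof (intro exec.Seq)
    show "exec (shift_com 3 Rd) (st [x, enc Fs, Leaf, enc F]) u (st [x, enc Fs, Leaf, r])"
      using exec_shift_st[OF assms(2), of "[x, enc Fs, Leaf]"] by (simp add: numeral_eq_Suc)
    show "exec (shift_com 3 Sv) (st [x, enc Fs, Leaf, r]) v (st [x, enc Fs, Leaf, y])"
      using exec_shift_st[OF assms(3), of "[x, enc Fs, Leaf]"] by (simp add: numeral_eq_Suc)
    show "exec (Assign 3 (ENode (Var 0) (Var 3))) (st [x, enc Fs, Leaf, y]) 4 (st [x, enc Fs, Leaf, Node x y])"
      by (rule exec_set) (simp_all add: numeral_eq_Suc)
    show "exec (shift_com 3 Ch) (st [x, enc Fs, Leaf, Node x y]) w (st [x, enc Fs, Leaf, enc b])"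
      using exec_shift_st[OF assms(4), of "[x, enc Fs, Leaf]"] by (simp add: numeral_eq_Suc)
  qed (rule a(2))
  moreover have "st [x, enc Fs, Leaf, enc F, Leaf] = st [x, enc Fs, Leaf, enc F]"
    using st_Leaf[of "[x, enc Fs, Leaf, enc F]"] by simp
  moreover have test: "eval_exp (Var 4) (st [x, enc Fs, Leaf, enc F, Leaf]) = Leaf" by (simp add: numeral_eq_Suc)
  ultimately have "exec (search_body Br Rd Sv Ch) (st [x, enc (F # Fs), Leaf])
     (3 + (3 + (2 + (t + (1 + exp_time (Var 4) + (u + (v + (4 + (w + a))))))))) (st [x, if b then Leaf else enc Fs, enc b])"
    by (intro exec_search_start[OF assms(1)] exec.IfFalse) simp_all
  moreover have "3 + (3 + (2 + (t + (1 + exp_time (Var 4) + (u + (v + (4 + (w + a)))))))) \<le> t + u + v + w + 26"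
    using a(1) by simp
  ultimately show ?thesis by blast
qed

lemma pot_le:
  assumes "0 \<le> \<alpha>" "0 \<le> \<beta>"
  shows "pot \<alpha> \<beta> L \<theta> Z F \<le> real (card L) * (\<alpha> + 4 * \<theta> * \<beta>)"
proof -
  have "(\<alpha> + 2 * \<theta> * \<beta>) * (real (card L) - card (units F)) \<le> (\<alpha> + 2 * \<theta> * \<beta>) * real (card L)"
    using assms by (intro mult_left_mono) auto
  moreover have "\<beta> * (2 * \<theta> * card L - real (card (pairs Z F))) \<le> \<beta> * (2 * \<theta> * card L)"
    using assms by (intro mult_left_mono) auto
  ultimately show ?thesis unfolding pot_def by (simp add: algebra_simps)
qed

text \<open>The check is polynomial in the solver's output, but the solver's time may be
  exponential, so the output must be bounded otherwise: it lists distinct items whose names occur in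
  the instance.\<close>

lemma knapsack_output_size:
  assumes "antichain (fam F)" "good F" "encodes_item_set y S" "is_optimal_solution d (knap d F) S"
  obtains xs :: "nat list" where "y = enc xs" "set xs = S"
    "size y \<le> esize (knap_instance d F) * (esize (knap_instance d F) + 1)"
proof -
  let ?s = "esize (knap_instance d F)"
  from assms(3) obtain xs where xs: "distinct xs" "set xs = S" "y = enc_list (map enc_nat xs)"
    by (auto simp: encodes_item_set_def)
  have y: "y = enc xs" unfolding xs(3) by (simp add: enc_list_def enc_nat_eq[abs_def])
  have S: "S \<subseteq> ident F ` set (descrs F)"
    using assms(4) by (simp add: is_optimal_solution_def is_solution_def)
  have items: "esize (items_list d F) \<le> ?s" by (simp add: knap_instance_def)
  have "esize i \<le> ?s" if "i \<in> set xs" for i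
  proof -
    from that S xs(2) obtain z where z: "z \<in> set (descrs F)" "i = ident F z" by auto
    then obtain rest where "i # rest \<in> set (items_list d F)" unfolding items_list_eq item_of_def by auto
    then have "esize (i # rest) \<le> esize (items_list d F)" by (rule size_enc_mem)
    then show ?thesis using items by simp
  qed
  then have "esize xs \<le> length xs * (?s + 1)" by (rule size_enc_list_le)
  also have "length xs \<le> ?s"
  proof -
    have "length xs = card S" using xs(1,2) distinct_card by metis
    also have "\<dots> \<le> card (ident F ` set (descrs F))" by (rule card_mono[OF _ S]) simp
    also have "\<dots> \<le> card (set (descrs F))" by (rule card_image_le) simp
    also have "\<dots> \<le> length (descrs F)" by (rule card_length)
    also have "\<dots> = length (items_list d F)" by (simp add: items_list_eq)
    also have "\<dots> \<le> esize (items_list d F)" by (rule length_le_size_enc)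
    finally show ?thesis using items by simp
  qed
  finally have "esize xs \<le> ?s * (?s + 1)" by (simp only: mult_right_mono)
  with y xs(2) show ?thesis by (intro that[of xs]) simp_all
qed

theorem knapsack_solver_decides_3SAT:
  fixes \<xi> \<alpha> \<beta> :: real and \<theta>1 \<theta>2 :: nat
  assumes \<xi>: "0 < \<xi>"
    and pos: "0 < \<theta>1" "0 < \<theta>2" "0 \<le> \<alpha>" "0 \<le> \<beta>"
    and num: "exp (- \<alpha>) + exp (- (\<alpha> * \<theta>1)) \<le> 1" "exp (- \<beta>) + exp (- (\<alpha> * \<theta>1)) \<le> 1"
      "exp (- \<alpha>) + exp (- (\<beta> * \<theta>2)) \<le> 1"
    and growth: "\<alpha> + 4 * \<theta>1 * \<beta> \<le> \<xi> * ln 2 / 16"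
    and d: "2 \<le> d"
    and P: "solves_knapsack_in_time d P (\<lambda>n W. real (n + W) powr
      (\<xi> / (16 * real (3 + 2 * \<theta>1 + 2 * \<theta>2)) * (real d / log 2 (real d))))"
  shows "\<exists>Q. decides_3SAT_in_time Q (\<lambda>n. 2 powr (\<xi> * real n))"
proof -
  \<comment> \<open>A leaf has at most \<open>N\<close> variables and
    \<open>(1 + \<theta>1 + \<theta>2) * 2 * N\<close> clauses, in total \<open>c0 * N\<close>
    columns.\<close>
  define c0 where "c0 = 3 + 2 * \<theta>1 + 2 * \<theta>2"
  define \<zeta> where "\<zeta> = \<xi> / (16 * real c0)"
  define e where "e = \<zeta> * (real d / log 2 (real d))"
  have c0: "0 < c0" by (simp add: c0_def)
  have \<zeta>: "0 < \<zeta>" using \<xi> c0 by (simp add: \<zeta>_def)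
  have log: "1 \<le> log 2 (real d)" using d by simp
  \<comment> \<open>As \<open>log 2 d \<ge> 1\<close>, the exponent of the budget is at most
    proportional to \<open>d\<close>, which cancels the division of the columns by
    \<open>d\<close>.\<close>
  have e: "0 \<le> e" "e \<le> \<zeta> * d"
  proof -
    show "0 \<le> e" using \<zeta> log by (simp add: e_def)
    have "real d / log 2 (real d) \<le> real d / 1" by (rule divide_left_mono) (use log in auto)
    then show "e \<le> \<zeta> * d" unfolding e_def using \<zeta> by (intro mult_left_mono) auto
  qed
  from P have "\<exists>K. \<forall>I x. finite (items I) \<and> encodes_knapsack d x I \<longrightarrow>
      (\<exists>t y S. runs P x t y \<and> encodes_item_set y S \<and> is_optimal_solution d I S \<and>
        real t \<le> K * real (size x + max_budget d I) powr e)"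
    unfolding solves_knapsack_in_time_def e_def \<zeta>_def c0_def .
  then obtain K where K: "\<And>I x. finite (items I) \<Longrightarrow> encodes_knapsack d x I \<Longrightarrow>
      \<exists>t y S. runs P x t y \<and> encodes_item_set y S \<and> is_optimal_solution d I S \<and>
        real t \<le> K * real (size x + max_budget d I) powr e"
    by metis
  define K' where "K' = max K 0"
  define m where "m = 2 * Suc (com_bound P)"
  define Sv where "Sv = Seq P (clear (com_bound P))"
  obtain Br cb where Br: "\<forall>F. (\<exists>t. t \<le> (esize F + 2) ^ cb \<and>
      exec Br (st [enc F]) t (st [enc (branch \<theta>1 \<theta>2 (F :: cnf))])) \<and>
      esize (branch \<theta>1 \<theta>2 F) \<le> (esize F + 2) ^ cb"
    using ptime_program[OF ptime_branch[of \<theta>1 \<theta>2]] by blast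
  obtain Rd cr where Rd: "\<forall>F. (\<exists>t. t \<le> (esize F + 2) ^ cr \<and>
      exec Rd (st [enc F]) t (st [enc (knap_instance d F)])) \<and>
      esize (knap_instance d F) \<le> (esize F + 2) ^ cr"
    using ptime_program[OF ptime_knap_instance[of d]] by blast
  obtain Ch cc where Ch: "\<forall>z :: (nat \<times> cnf) \<times> nat list. (\<exists>t. t \<le> (esize z + 2) ^ cc \<and>
      exec Ch (st [enc z]) t (st [enc (check (snd (fst z)) (snd z))])) \<and>
      esize (check (snd (fst z)) (snd z)) \<le> (esize z + 2) ^ cc"
    using ptime_program[OF ptime_check] by blast
  obtain In ci where In: "\<forall>z :: nat \<times> cnf. (\<exists>t. t \<le> (esize z + 2) ^ ci \<and>
      exec In (st [enc z]) t (st [enc (init_family (snd z))])) \<and>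
      esize (init_family (snd z)) \<le> (esize z + 2) ^ ci"
    using ptime_program[OF ptime_comp[OF ptime_init_family ptime_snd[OF ptime_id]]] by blast
  \<comment> \<open>Sizes: \<open>s0\<close> bounds the input, \<open>s1\<close> a formula on the
    stack, \<open>s2\<close> a knapsack instance. Then \<open>q\<close> is the polynomial part of
    the time of one iteration, \<open>\<tau>\<close> that time including the solver, and
    \<open>k\<close> the number of iterations.\<close>
  define s0 where "s0 N = 2 * N + (2 * N) ^ 3 * (6 * N + 10) + 1" for N :: nat
  define s1 where "s1 N = (2 * N) ^ 3 * (6 * N + 10)" for N :: nat
  define s2 where "s2 N = (s1 N + 2) ^ cr" for N
  define W :: "nat \<Rightarrow> nat" where "W N = 8 ^ ((c0 * N) div d + 1)" for N
  define q where "q N = (s1 N + 2) ^ cb + (s1 N + 2) ^ cr + m + (s0 N + s2 N * (s2 N + 1) + 3) ^ cc + 26" for N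
  define \<tau> where "\<tau> N = real (q N) + K' * real (s2 N + W N) powr e" for N
  define k where "k N = nat \<lceil>2 * exp (real (2 * N) * (\<xi> * ln 2 / 16))\<rceil>" for N :: nat
  define T where "T N = real ((s0 N + 2) ^ ci + 10) + real (k N) * (\<tau> N + 2)" for N
  define Q where "Q = Seq (Assign 1 (Var 0)) (Seq (shift_com 1 In) (Seq (Assign 1 (ENode (Var 1) ELeaf))
    (Seq (While (Var 1) (search_body Br Rd Sv Ch)) (Assign 0 (Var 2)))))"
  have K': "0 \<le> K'" "K \<le> K'" by (simp_all add: K'_def)
  have \<tau>: "0 \<le> \<tau> N" for N using K' by (simp add: \<tau>_def)
  have correct: "\<exists>t y. runs Q x t y \<and> (y \<noteq> Leaf \<longleftrightarrow> SAT \<phi> = card (clauses \<phi>)) \<and> real t \<le> T (num_vars \<phi>)"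
    if wf: "formula_wf \<phi>" and enc: "encodes_formula x \<phi>" for \<phi> x
  proof -
    define N where "N = num_vars \<phi>"
    obtain Cs where x: "x = enc (N, Cs)"
      and Cs: "\<And>C. C \<in> set Cs \<Longrightarrow> length C = 3 \<and> set C \<subseteq> {..<N} \<times> UNIV"
      and len: "length Cs \<le> (2 * N) ^ 3"
      and sat: "SAT \<phi> = card (clauses \<phi>) \<longleftrightarrow> (\<exists>a. hits (lit_holds a) Cs)"
      using encodes_formula_lists[OF wf enc] unfolding N_def by blast
    let ?L = "{..<N} \<times> (UNIV :: bool set)"
    let ?B = "search_body Br Rd Sv Ch"
    have L: "finite ?L" "card ?L = 2 * N" by (simp_all add: card_cartesian_product)
    have sx: "size x \<le> s0 N"
    proof -
      have "esize Cs \<le> length Cs * (6 * N + 10)" by (rule size_enc_clauses_le) (use Cs in auto)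
      also have "\<dots> \<le> (2 * N) ^ 3 * (6 * N + 10)" by (rule mult_right_mono[OF len]) simp
      finally show ?thesis using size_enc_nat_le[of N] by (simp add: x s0_def)
    qed
    define I where "I F \<longleftrightarrow> good F \<and> wf_fam ?L \<theta>1 (fam Cs) (fam F)" for F :: "cnf"
    define w where "w F = exp (pot \<alpha> \<beta> ?L \<theta>1 (fam Cs) (fam F))" for F :: "cnf"
    define G where "G F \<longleftrightarrow> (\<exists>a. hits (lit_holds a) F)" for F
    have step: "(\<exists>F1 F2 t. real t \<le> \<tau> N \<and>
        exec ?B (st [x, enc (F # Fs), Leaf]) t (st [x, enc (F1 # F2 # Fs), Leaf]) \<and>
        I F1 \<and> I F2 \<and> w F1 + w F2 \<le> w F \<and> (G F \<longrightarrow> G F1 \<or> G F2)) \<or>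
     (\<exists>t. real t \<le> \<tau> N \<and> exec ?B (st [x, enc (F # Fs), Leaf]) t (st [x, enc Fs, Leaf]) \<and> \<not> G F) \<or>
     (\<exists>t. real t \<le> \<tau> N \<and> exec ?B (st [x, enc (F # Fs), Leaf]) t (st [x, Leaf, enc True]) \<and> G Cs)"
      if IF: "I F" for F Fs
    proof -
      have good: "good F" and wfF: "wf_fam ?L \<theta>1 (fam Cs) (fam F)" using IF by (simp_all add: I_def)
      have sF: "esize F \<le> s1 N" unfolding s1_def by (rule size_enc_family_le[OF good wfF])
      then have pow: "(esize F + 2) ^ c \<le> (s1 N + 2) ^ c" for c by (intro power_mono) auto
      obtain t where t: "t \<le> (esize F + 2) ^ cb" "exec Br (st [enc F]) t (st [enc (branch \<theta>1 \<theta>2 F)])"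
        using Br by blast
      show ?thesis
      proof (rule branch_cases[OF good wfF L(1) pos num])
        fix F1 F2
        assume *: "branch \<theta>1 \<theta>2 F = [F1, F2]" "good F1" "good F2"
          "wf_fam ?L \<theta>1 (fam Cs) (fam F1)" "wf_fam ?L \<theta>1 (fam Cs) (fam F2)"
          "exp (pot \<alpha> \<beta> ?L \<theta>1 (fam Cs) (fam F1)) + exp (pot \<alpha> \<beta> ?L \<theta>1 (fam Cs) (fam F2))
            \<le> exp (pot \<alpha> \<beta> ?L \<theta>1 (fam Cs) (fam F))"
          "\<And>a. hits a F \<Longrightarrow> hits a F1 \<or> hits a F2"
        have "t + 23 \<le> q N" using t(1) pow[of cb] unfolding q_def by linarith
        then have "real (t + 23) \<le> \<tau> N" unfolding \<tau>_def using K' by (intro add_increasing2) auto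
        moreover have "exec ?B (st [x, enc (F # Fs), Leaf]) (t + 23) (st [x, enc (F1 # F2 # Fs), Leaf])"
          by (rule exec_search_branch) (use t(2) *(1) in simp)
        ultimately show ?thesis using * unfolding I_def w_def G_def by blast
      next
        assume leaf: "branch \<theta>1 \<theta>2 F = []" "length F \<le> (1 + \<theta>1 + \<theta>2) * card ?L"
        have anti: "antichain (fam F)" using wfF by (simp add: wf_fam_def antichain_def)
        have len3: "\<forall>C\<in>set F. length C \<le> 3"
        proof
          fix C assume "C \<in> set F"
          then show "length C \<le> 3" using wfF good by (auto simp: wf_fam_def fam_def good_def distinct_card)
        qed
        obtain u where u: "u \<le> (esize F + 2) ^ cr" "exec Rd (st [enc F]) u (st [enc (knap_instance d F)])"
          using Rd by blast
        let ?s = "esize (knap_instance d F)"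
        have s: "?s \<le> s2 N" using Rd[rule_format, of F] pow[of cr] unfolding s2_def by linarith
        obtain v y S where v: "runs P (enc (knap_instance d F)) v y" "encodes_item_set y S"
          "is_optimal_solution d (knap d F) S"
          "real v \<le> K * real (?s + max_budget d (knap d F)) powr e"
          using K[OF _ encodes_knap_instance[OF anti good]] by (simp only: knap_simps) blast
        obtain ys where ys: "y = enc ys" "set ys = S" "size y \<le> ?s * (?s + 1)"
          using knapsack_output_size[OF anti good v(2,3)] by blast
        have "max_budget d (knap d F) \<le> W N"
        proof -
          have "set (vars F) \<subseteq> {..<N}" using wfF by (fastforce simp: wf_fam_def fam_def vars_def)
          then have "card (set (vars F)) \<le> card {..<N}" by (intro card_mono) auto
          moreover have "card (set (vars F)) = length (vars F)" by (rule distinct_card) (simp add: vars_def)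
          ultimately have "length (vars F) + length F \<le> c0 * N"
            using leaf(2) unfolding L(2) c0_def by (simp add: algebra_simps)
          then have "(8 :: nat) ^ ((length (vars F) + length F) div d + 1) \<le> W N"
            unfolding W_def by (intro power_increasing add_right_mono div_le_mono) auto
          with max_budget_knap_le[of d F] d show ?thesis by linarith
        qed
        with s have "?s + max_budget d (knap d F) \<le> s2 N + W N" by simp
        then have "real (?s + max_budget d (knap d F)) powr e \<le> real (s2 N + W N) powr e"
          by (intro powr_mono2 e(1)) auto
        then have "K * real (?s + max_budget d (knap d F)) powr e \<le> K' * real (s2 N + W N) powr e"
          using K' by (intro mult_mono) auto
        with v(4) have v': "real v \<le> K' * real (s2 N + W N) powr e" by linarith
        have solve: "exec Sv (st [enc (knap_instance d F)]) (v + m) (st [y])"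
          unfolding Sv_def m_def by (rule runs_clean[OF v(1)])
        define b where "b = check Cs ys"
        obtain r where r: "r \<le> (esize ((N, Cs), ys) + 2) ^ cc" "exec Ch (st [enc ((N, Cs), ys)]) r (st [enc b])"
          using Ch[rule_format, of "((N, Cs), ys)"] unfolding b_def fst_conv snd_conv by blast
        have "esize ((N, Cs), ys) + 2 \<le> s0 N + s2 N * (s2 N + 1) + 3"
        proof -
          have "size y \<le> s2 N * (s2 N + 1)" using ys(3) mult_mono[OF s, of "?s + 1" "s2 N + 1"] s by simp
          then show ?thesis using sx ys(1) x by simp
        qed
        then have "(esize ((N, Cs), ys) + 2) ^ cc \<le> (s0 N + s2 N * (s2 N + 1) + 3) ^ cc"
          by (rule power_mono) simp
        with r(1) have r': "r \<le> (s0 N + s2 N * (s2 N + 1) + 3) ^ cc" by linarith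
        have br: "exec Br (st [enc F]) t (st [Leaf])" using t(2) leaf(1) by simp
        have ch: "exec Ch (st [Node x y]) r (st [enc b])" using r(2) x ys(1) by simp
        obtain z where z: "z \<le> t + u + (v + m) + r + 26"
          "exec ?B (st [x, enc (F # Fs), Leaf]) z (st [x, if b then Leaf else enc Fs, enc b])"
          using exec_search_leaf[OF br u(2) solve ch] by blast
        have "t + u + m + r + 26 \<le> q N"
          using t(1) u(1) pow[of cb] pow[of cr] r' unfolding q_def by linarith
        then have "real (t + u + m + r + 26) \<le> real (q N)" by simp
        then have z': "real z \<le> \<tau> N" using z(1) v' unfolding \<tau>_def by simp
        show ?thesis
        proof (cases b)
          case True
          then have "G Cs" unfolding b_def check_eq G_def by blast
          then show ?thesis using z(2) z' True by auto
        next
          case False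
          \<comment> \<open>A failed check refutes the leaf: were \<open>F\<close> satisfiable, the
            optimal solution would satisfy \<open>F\<close> and, by subsumption, the input.\<close>
          have "\<not> G F"
          proof
            assume "G F"
            then obtain a where "hits (lit_holds a) F" by (auto simp: G_def)
            from optimal_solution_hits[OF _ anti good len3 this v(3)] d ys(2)
            have "hits (lit_holds (\<lambda>v. of_bits (lit_name (v, True) @ [True]) \<in> set ys)) F" by simp
            then have "check Cs ys" unfolding check_eq by (rule hits_subsumed[OF wfF])
            with False show False by (simp add: b_def)
          qed
          then show ?thesis using z(2) z' False by auto
        qed
      qed
    qed
    define F0 where "F0 = init_family Cs"
    have I0: "I F0" unfolding I_def F0_def
    proof
      show "wf_fam ?L \<theta>1 (fam Cs) (fam (init_family Cs))"
      proof (rule wf_init_family)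
        fix C assume "C \<in> set Cs"
        from Cs[OF this] show "C \<noteq> [] \<and> set C \<subseteq> ?L \<and> length C \<le> 3" by (cases C) auto
      qed
    qed (rule good_init_family)
    have w1: "1 \<le> w F" if "I F" for F
      unfolding w_def using pot_nonneg[of ?L \<theta>1 "fam Cs" "fam F" \<alpha> \<beta>] that pos L(1) by (simp add: I_def)
    have "(\<Sum>F\<leftarrow>[F0]. 2 * w F - 1) \<le> real (k N)"
    proof -
      have "pot \<alpha> \<beta> ?L \<theta>1 (fam Cs) (fam F0) \<le> real (2 * N) * (\<alpha> + 4 * \<theta>1 * \<beta>)"
        using pot_le[OF pos(3,4), of ?L \<theta>1 "fam Cs" "fam F0"] by (simp only: L(2) of_nat_mult of_nat_numeral)
      also have "\<dots> \<le> real (2 * N) * (\<xi> * ln 2 / 16)" by (rule mult_left_mono[OF growth]) simp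
      finally have "w F0 \<le> exp (real (2 * N) * (\<xi> * ln 2 / 16))" by (simp add: w_def)
      then show ?thesis unfolding k_def by simp linarith
    qed
    from search_loop[where I = I and w = w and G = G and A = "G Cs", OF step w1 \<tau> _ this] I0
    obtain t y where t: "real t \<le> real (k N) * (\<tau> N + 2) + 2"
      "exec (While (Var 1) ?B) (st [x, enc [F0], Leaf]) t (st [x, Leaf, enc y])"
      "y \<longrightarrow> G Cs" "G F0 \<longrightarrow> y" by auto
    obtain u where u: "u \<le> (size x + 2) ^ ci" "exec In (st [x]) u (st [enc F0])"
      using In[rule_format, of "(N, Cs)"] unfolding F0_def x snd_conv by blast
    have "exec Q (st [x]) (2 + (u + (4 + (t + 2)))) (st [enc y, Leaf, enc y])" unfolding Q_def
    proof (intro exec.Seq)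
      show "exec (Assign 1 (Var 0)) (st [x]) 2 (st [x, x])" by (rule exec_push) simp_all
      show "exec (shift_com 1 In) (st [x, x]) u (st [x, enc F0])"
        using exec_shift_st[OF u(2), of "[x]"] by simp
      have "st [x, enc [F0], Leaf] = st [x, enc [F0]]" using st_Leaf[of "[x, enc [F0]]"] by simp
      moreover have "exec (Assign 1 (ENode (Var 1) ELeaf)) (st [x, enc F0]) 4 (st [x, enc [F0]])"
        by (rule exec_set) (simp_all add: numeral_eq_Suc)
      ultimately show "exec (Assign 1 (ENode (Var 1) ELeaf)) (st [x, enc F0]) 4 (st [x, enc [F0], Leaf])" by simp
      show "exec (Assign 0 (Var 2)) (st [x, Leaf, enc y]) 2 (st [enc y, Leaf, enc y])"
        by (rule exec_set) (simp_all add: numeral_eq_Suc)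
    qed (rule t(2))
    then have "runs Q x (2 + (u + (4 + (t + 2)))) (enc y)"
      unfolding runs_def st_single[symmetric] by (intro exI conjI) (assumption, simp)
    moreover have "enc y \<noteq> Leaf \<longleftrightarrow> SAT \<phi> = card (clauses \<phi>)"
    proof -
      have "G Cs \<longrightarrow> G F0" unfolding G_def F0_def using hits_init_family by blast
      then have "y \<longleftrightarrow> G Cs" using t(3,4) by blast
      then show ?thesis unfolding sat G_def[symmetric] by (cases y) auto
    qed
    moreover have "real (2 + (u + (4 + (t + 2)))) \<le> T N"
    proof -
      have "(size x + 2) ^ ci \<le> (s0 N + 2) ^ ci" by (rule power_mono) (use sx in auto)
      with u(1) have "real u \<le> real ((s0 N + 2) ^ ci)" by linarith
      then show ?thesis unfolding T_def using t(1) by simp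
    qed
    ultimately show ?thesis unfolding N_def by blast
  qed
  have "exp_bounded \<xi> T"
  proof -
    have p0: "poly s0" and p1: "poly s1"
      unfolding s0_def s1_def
      by (intro pbounded_add pbounded_mult pbounded_power pbounded_const poly_id)+
    have p2: "poly s2" unfolding s2_def by (intro pbounded_power pbounded_add pbounded_const p1)
    have pq: "poly (\<lambda>N. q N + 2)" unfolding q_def
      by (intro pbounded_add pbounded_mult pbounded_power pbounded_const p0 p1 p2)
    have pi: "poly (\<lambda>N. (s0 N + 2) ^ ci + 10)"
      by (intro pbounded_add pbounded_power pbounded_const p0)
    have const: "exp_bounded 0 (\<lambda>N. c)" if "0 \<le> c" for c
      unfolding exp_bounded_def using that by (intro exI[of _ c]) simp
    \<comment> \<open>The 3 comes from \<open>8 = 2 ^ 3\<close>. The extra column per dimension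
      costs the factor \<open>2 powr (3 * \<zeta> * d)\<close>, a constant because \<open>d\<close>
      is fixed.\<close>
    have W: "exp_bounded (3 * c0 * \<zeta>) (\<lambda>N. real (W N) powr e)"
    proof -
      have "real (W N) powr e \<le> 2 powr (3 * \<zeta> * d) * 2 powr (3 * c0 * \<zeta> * real N)" for N
      proof -
        have "real (c0 * N div d) \<le> real (c0 * N) / real d" by (rule of_nat_div_le_of_nat)
        then have "3 * e * real (c0 * N div d + 1) \<le> 3 * (\<zeta> * d) * (real (c0 * N) / real d + 1)"
          using e \<zeta> by (intro mult_mono) auto
        also have "\<dots> = 3 * \<zeta> * d + 3 * c0 * \<zeta> * real N" using d by (simp add: field_simps)
        finally have *: "3 * e * real (c0 * N div d + 1) \<le> 3 * \<zeta> * d + 3 * c0 * \<zeta> * real N" .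
        have "real (W N) = 2 powr (3 * real (c0 * N div d + 1))"
        proof -
          have "real (W N) = (2 ^ 3) ^ (c0 * N div d + 1)" by (simp add: W_def)
          also have "\<dots> = 2 ^ (3 * (c0 * N div d + 1))" by (simp only: power_mult)
          also have "\<dots> = 2 powr real (3 * (c0 * N div d + 1))" by (simp only: powr_realpow zero_less_numeral)
          finally show ?thesis by simp
        qed
        then have "real (W N) powr e = 2 powr (3 * e * real (c0 * N div d + 1))"
          by (simp only: powr_powr mult_ac)
        also have "\<dots> \<le> 2 powr (3 * \<zeta> * d + 3 * c0 * \<zeta> * real N)" using * by simp
        finally show ?thesis by (simp add: powr_add)
      qed
      note le = this
      have eb: "exp_bounded (0 + 3 * c0 * \<zeta>) (\<lambda>N. 2 powr (3 * \<zeta> * d) * 2 powr (3 * c0 * \<zeta> * real N))"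
        by (intro exp_bounded_mult const exp_bounded_powr) auto
      show ?thesis by (rule exp_bounded_mono[OF eb le]) simp
    qed
    have r: "\<xi> / 16 + 3 * c0 * \<zeta> = \<xi> / 4" using c0 by (simp add: \<zeta>_def field_simps)
    have sW: "exp_bounded (0 + \<xi> / 4) (\<lambda>N. K' * real (s2 N + W N) powr e)"
    proof -
      have p: "poly (\<lambda>N. 2 * s2 N)" by (intro pbounded_mult pbounded_const p2)
      have "exp_bounded (0 + (\<xi> / 16 + 3 * c0 * \<zeta>)) (\<lambda>N. K' * (real (2 * s2 N) powr e * real (W N) powr e))"
        by (intro exp_bounded_mult const W exp_bounded_poly_powr[OF p] e(1)) (use K' \<xi> in auto)
      moreover have "K' * real (s2 N + W N) powr e \<le> K' * (real (2 * s2 N) powr e * real (W N) powr e)" for N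
      proof -
        \<comment> \<open>For positive numbers the sum is at most twice the product, which separates
          the polynomial factor from the budget.\<close>
        have "1 \<le> s2 N" "1 \<le> W N" by (simp_all add: s2_def W_def)
        then have "s2 N \<le> s2 N * W N" "W N \<le> s2 N * W N" by simp_all
        then have "s2 N + W N \<le> 2 * (s2 N * W N)" by linarith
        then have "real (s2 N + W N) \<le> real (2 * (s2 N * W N))" by (simp only: of_nat_le_iff)
        also have "\<dots> = real (2 * s2 N) * real (W N)" by simp
        finally have "real (s2 N + W N) \<le> real (2 * s2 N) * real (W N)" .
        then have "real (s2 N + W N) powr e \<le> (real (2 * s2 N) * real (W N)) powr e"
          by (intro powr_mono2 e(1)) auto
        also have "\<dots> = real (2 * s2 N) powr e * real (W N) powr e" by (rule powr_mult)
        finally show ?thesis using K'(1) by (rule mult_left_mono)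
      qed
      ultimately show ?thesis unfolding r by (rule exp_bounded_mono) simp
    qed
    have "exp_bounded (\<xi> / 4) (\<lambda>N. real (q N + 2) + K' * real (s2 N + W N) powr e)"
      by (intro exp_bounded_add exp_bounded_of_poly[OF pq]) (use \<xi> sW in auto)
    then have t: "exp_bounded (\<xi> / 4) (\<lambda>N. \<tau> N + 2)"
      by (rule exp_bounded_mono) (auto simp: \<tau>_def)
    have kb: "exp_bounded (0 + \<xi> / 8) (\<lambda>N. real (k N))"
    proof (rule exp_bounded_mono)
      show "exp_bounded (0 + \<xi> / 8) (\<lambda>N. 3 * 2 powr (\<xi> / 8 * real N))"
        by (intro exp_bounded_mult const exp_bounded_powr) auto
      show "real (k N) \<le> 3 * 2 powr (\<xi> / 8 * real N)" for N
      proof -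
        have "exp (real (2 * N) * (\<xi> * ln 2 / 16)) = 2 powr (\<xi> / 8 * real N)"
          by (simp add: powr_def field_simps)
        moreover have "1 \<le> 2 powr (\<xi> / 8 * real N)" using \<xi> by (intro ge_one_powr_ge_zero) auto
        moreover have "real (nat \<lceil>2 * z\<rceil>) \<le> 3 * z" if "1 \<le> z" for z :: real using that by linarith
        ultimately show ?thesis unfolding k_def by simp
      qed
    qed simp
    have "exp_bounded (0 + \<xi> / 8 + \<xi> / 4) (\<lambda>N. real (k N) * (\<tau> N + 2))"
      by (rule exp_bounded_mult[OF kb t]) (use \<tau> in \<open>simp add: add_nonneg_nonneg\<close>)
    then have "exp_bounded \<xi> (\<lambda>N. real (k N) * (\<tau> N + 2))"
      by (rule exp_bounded_mono) (use \<xi> in auto)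
    then show ?thesis unfolding T_def by (intro exp_bounded_add exp_bounded_of_poly[OF pi] \<xi>)
  qed
  then obtain M where M: "\<And>N. T N \<le> M * 2 powr (\<xi> * real N)" unfolding exp_bounded_def by blast
  have "decides_3SAT_in_time Q (\<lambda>n. 2 powr (\<xi> * real n))"
    unfolding decides_3SAT_in_time_def
  proof (intro exI[of _ M] allI impI)
    fix \<phi> x assume "formula_wf \<phi> \<and> encodes_formula x \<phi>"
    with correct[of \<phi> x] M[of "num_vars \<phi>"]
    show "\<exists>t y. runs Q x t y \<and> (y \<noteq> Leaf \<longleftrightarrow> SAT \<phi> = card (clauses \<phi>)) \<and>
        real t \<le> M * 2 powr (\<xi> * real (num_vars \<phi>))" by (meson order_trans)
  qed
  then show ?thesis ..
qed

theorem theorem1p3: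
  assumes ETH
  shows "\<exists>\<zeta>::real. \<exists>d0::nat. \<zeta> > 0 \<and> d0 > 0 \<and>
    (\<forall>d::nat. d > d0 \<longrightarrow>
      \<not> (\<exists>P. solves_knapsack_in_time d P
            (\<lambda>n W. real (n + W) powr (\<zeta> * (real d / log 2 (real d))))))"
proof -
  from assms obtain \<xi> :: real where \<xi>: "0 < \<xi>" "\<not> (\<exists>Q. decides_3SAT_in_time Q (\<lambda>n. 2 powr (\<xi> * real n)))"
    unfolding ETH_def by blast
  have "0 < \<xi> * ln 2 / 16" using \<xi>(1) by simp
  then obtain \<alpha> \<beta> :: real and \<theta>1 \<theta>2 :: nat where par: "0 < \<theta>1" "0 < \<theta>2" "0 \<le> \<alpha>" "0 \<le> \<beta>"
    "exp (- \<alpha>) + exp (- (\<alpha> * \<theta>1)) \<le> 1" "exp (- \<beta>) + exp (- (\<alpha> * \<theta>1)) \<le> 1"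
    "exp (- \<alpha>) + exp (- (\<beta> * \<theta>2)) \<le> 1" "\<alpha> + 4 * \<theta>1 * \<beta> \<le> \<xi> * ln 2 / 16"
    by (rule branching_parameters)
  show ?thesis
  \<comment> \<open>The thresholds \<open>\<theta>1\<close> and \<open>\<theta>2\<close> depend on
    \<open>\<xi>\<close> only, so one \<open>\<zeta>\<close> serves all dimensions. Starting from
    \<open>d = 2\<close> the logarithm is at least 1.\<close>
  proof (intro exI[of _ "\<xi> / (16 * real (3 + 2 * \<theta>1 + 2 * \<theta>2))"] exI[of _ "1 :: nat"] conjI allI impI)
    show "0 < \<xi> / (16 * real (3 + 2 * \<theta>1 + 2 * \<theta>2))" using \<xi>(1) by simp
    fix d :: nat assume "1 < d"
    then have "2 \<le> d" by simp
    from knapsack_solver_decides_3SAT[OF \<xi>(1) par this] \<xi>(2)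
    show "\<not> (\<exists>P. solves_knapsack_in_time d P (\<lambda>n W. real (n + W) powr
        (\<xi> / (16 * real (3 + 2 * \<theta>1 + 2 * \<theta>2)) * (real d / log 2 (real d)))))" by blast
  qed simp
qed

end
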